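(* Let $f\in\mathcal{S}(\mathbb{R}^n)$, $g\in\mathcal{D}$, and $h=(\bm{x},\bm{y},t)\in H$ with all entries of $\bm{x}$ and $\bm{y}$ at most $\frac12$ in absolute value. For $1\leq l\leq n$ write \[ g=\begin{pmatrix} I & 0 & T_l & S_l \\ 0 & I & S_l^{\top} & 0 \\ 0 & 0 & I & 0 \\ 0&0&0&I\end{pmatrix} \begin{pmatrix} U_l & R_l & 0 & 0 \\ 0 & I & 0 & 0 \\ 0&0&(U_l^{\top})^{-1} & 0 \\ 0&0& -R_l^{\top}(U_l^{\top})^{-1} & I\end{pmatrix} \begin{pmatrix} I&0&0&0\\0&I&0&X_l\\0&0&I&0\\0&0&0&I\end{pmatrix} \begin{pmatrix} V_l^{\frac12}&0&0&0\\0&Y_l^{\frac12}&0&0\\0&0&V_l^{-\frac12}&0\\0&0&0&(Y_l^{\frac12\,\top})^{-1}\end{pmatrix}k(Q), \] where $R_l,S_l$ are $l\times(n-l)$, $T_l$ is $l\times l$ symmetric, $U_l$ is $l\times l$ upper-triangular unipotent, $X_l$ is $(n-l)\times(n-l)$ symmetric, $V_l$ is $l\times l$ positive diagonal, $Y_l$ is $(n-l)\times(n-l)$ positive definite symmetric, and $Q\in\mathrm{U}(n)$. Define $(\bm{x}_l^{(1)},\bm{x}_l^{(2)},\bm{y}_l^{(1)},\bm{y}_l^{(2)})$ (blocks of lengths $l,n-l,l,n-l$) by \[ (\bm{x}_l^{(1)},\bm{x}_l^{(2)},\bm{y}_l^{(1)},\bm{y}_l^{(2)})=(\bm{x}^{(1)},\bm{x}^{(2)},\bm{y}^{(1)},\bm{y}^{(2)})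 \begin{pmatrix} I & 0 & T_l & S_l \\ 0 & I & S_l^{\top} & 0 \\ 0 & 0 & I & 0 \\ 0&0&0&I\end{pmatrix} \begin{pmatrix} U_l & R_l & 0 & 0 \\ 0 & I & 0 & 0 \\ 0&0&(U_l^{\top})^{-1} & 0 \\ 0&0& -R_l^{\top}(U_l^{\top})^{-1} & I\end{pmatrix}. \] Then for every $A>0$, \begin{align*} \Theta_f(h,g)={}&(\det V_l)^{\frac14}(\det Y_l)^{\frac14}\,\mathrm{e}\!\left(-t+\tfrac12\bm{x}_l\bm{y}_l^{\top}\right)\sum_{\bm{m}^{(2)}\in\mathbb{Z}^{n-l}} f_Q\!\left(\bm{x}_l^{(1)}V_l^{\frac12},\,(\bm{m}^{(2)}+\bm{x}_l^{(2)})Y_l^{\frac12}\right)\\ &\qquad\times\mathrm{e}\!\left(\tfrac12(\bm{m}^{(2)}+\bm{x}_l^{(2)})X_l(\bm{m}^{(2)}+\bm{x}_l^{(2)})^{\top}+\bm{m}^{(2)}\bm{y}_l^{(2)\top}\right) +O_{A,f}\!\left((\det V_l)^{\frac14}\,(v_l+\bm{x}V\bm{x}^{\top})^{-A}\right), \end{align*} where $V=\mathrm{diag}(v_1,\dots,v_n)$ is the diagonal matrix in the decomposition $Y=UVU^{\top}$ of $g$ and $v_l$ is its $l$-th diagonal entry.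
   Context: $\mathrm{e}(z)=e^{2\pi\mathrm{i}z}$. $H$ is the Heisenberg group $\mathbb{R}^n\times\mathbb{R}^n\times\mathbb{R}$ with $(\bm{x}_1,\bm{y}_1,t_1)(\bm{x}_2,\bm{y}_2,t_2)=(\bm{x}_1+\bm{x}_2,\bm{y}_1+\bm{y}_2,t_1+t_2+\frac12(\bm{y}_1\bm{x}_2^{\top}-\bm{x}_1\bm{y}_2^{\top}))$; $G=\mathrm{Sp}(n,\mathbb{R})$ acts on $H$ by $(\bm{x},\bm{y},t)^g=(\bm{x}A+\bm{y}C,\bm{x}B+\bm{y}D,t)$ for $g=\begin{pmatrix}A&B\\C&D\end{pmatrix}$. Schrödinger representation: $W(\bm{x},\bm{y},t)f(\bm{x}_0)=\mathrm{e}(-t+\frac12\bm{x}\bm{y}^{\top}+\bm{x}_0\bm{y}^{\top})f(\bm{x}_0+\bm{x})$. $R$ is the Segal–Shale–Weil projective representation of $G$ on $L^2(\mathbb{R}^n)$, i.e. unitary operators with $W(h^g)=R(g)^{-1}W(h)R(g)$, normalized so that $R\begin{pmatrix}A&B\\0&(A^{\top})^{-1}\end{pmatrix}f(\bm{x})=|\det A|^{1/2}\mathrm{e}(\frac12\bm{x}AB^{\top}\bm{x}^{\top})f(\bm{x}A)$ and $R(J_l)f(\bm{x})=\int_{\mathbb{R}^{n-l}}f(\bm{x}^{(1)},\bm{y}^{(2)})\mathrm{e}(-\bm{x}^{(2)}\bm{y}^{(2)\top})\,d\bm{y}^{(2)}$ for $J_l=\begin{pmatrix}I&0&0&0\\0&0&0&-I\\0&0&I&0\\0&I&0&0\end{pmatrix}$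 (blocks $l,n-l,l,n-l$). For $Q\in\mathrm{U}(n)$, $k(Q)=\begin{pmatrix}\mathrm{Re}Q&-\mathrm{Im}Q\\\mathrm{Im}Q&\mathrm{Re}Q\end{pmatrix}$ and $f_Q=R(k(Q))f$. The theta function is $\Theta_f(h,g)=\sum_{\bm{m}\in\mathbb{Z}^n}(W(h)R(g)f)(\bm{m})$; explicitly, for $g=\begin{pmatrix}I&X\\0&I\end{pmatrix}\begin{pmatrix}Y^{1/2}&0\\0&(Y^{1/2\,\top})^{-1}\end{pmatrix}k(Q)$ and $h=(\bm{x},\bm{y},t)$, $\Theta_f(h,g)=(\det Y)^{1/4}\mathrm{e}(-t+\frac12\bm{x}\bm{y}^{\top})\sum_{\bm{m}\in\mathbb{Z}^n}f_Q((\bm{m}+\bm{x})Y^{1/2})\mathrm{e}(\frac12(\bm{m}+\bm{x})X(\bm{m}+\bm{x})^{\top}+\bm{m}\bm{y}^{\top})$. Here $X$ symmetric, $Y$ positive definite with $Y^{1/2}$ upper triangular with positive diagonal, and $Y=UVU^{\top}$ with $U$ upper-triangular unipotent and $V$ positive diagonal. $\mathcal{D}\subset G$ is the Siegel-type fundamental domain for $\Gamma=\mathrm{Sp}(n,\mathbb{Z})$: the set of such $g$ with $|\det(C(X+\mathrm{i}Y)+D)|\ge1$ for all $\begin{pmatrix}A&B\\C&D\end{pmatrix}\in\Gamma$, all entries of $X$ of absolute value $\le\frac12$, and $Y$ in Grenier's recursively defined fundamental domain for $\mathrm{GL}(n,\mathbb{Z})$ (maximal first diagonal entry $v_1$ over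 the $\mathrm{GL}(n,\mathbb{Z})$-orbit, off-diagonal unipotent entries of absolute value $\le\frac12$, recursively on the lower block). *)

theory Defs
  imports
    "HOL-Analysis.Analysis"
    "Jordan_Normal_Form.Gauss_Jordan_Elimination"
    "Jordan_Normal_Form.Schur_Decomposition"
begin

(* Both HOL-Analysis and Jordan_Normal_Form provide vec, det, "$" and a dot for the inner product;
   vectors and matrices below are always those of Jordan_Normal_Form.  As in the source, vectors
   are row vectors: x A is written  x \<^sub>v* A, and x y^T is  scalar_prod x y. *)

no_notation Finite_Cartesian_Product.vec_nth (infixl \<open>$\<close> 90)

definition row_mult :: "real Matrix.vec \<Rightarrow> real mat \<Rightarrow> real Matrix.vec" (infixl \<open>\<^sub>v*\<close> 70) where
  "x \<^sub>v* A = transpose_mat A *\<^sub>v x"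

definition mat_inv :: "real mat \<Rightarrow> real mat" where
  "mat_inv A = the (mat_inverse A)"

definition blk_diag :: "real mat \<Rightarrow> real mat \<Rightarrow> real mat" where
  "blk_diag A B = four_block_mat A (0\<^sub>m (dim_row A) (dim_col B)) (0\<^sub>m (dim_row B) (dim_col A)) B"

definition int_vecs :: "nat \<Rightarrow> real Matrix.vec set" where
  "int_vecs n = {m \<in> carrier_vec n. \<forall>i<n. m $ i \<in> \<int>}"

definition ee :: "real \<Rightarrow> complex" where
  "ee s = exp (2 * complex_of_real pi * \<i> * complex_of_real s)"


section \<open>Functions on \<open>\<real>\<^sup>n\<close>\<close>

(* R^n is carrier_vec n; functions on it are total on real vec and only their restriction to
   carrier_vec n matters.  lborel_vec n is Lebesgue measure transported along the bijection
   between carrier_vec n and the extensional functions on {..<n}. *)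

definition borel_vec :: "nat \<Rightarrow> real Matrix.vec measure" where
  "borel_vec n = vimage_algebra (carrier_vec n) (\<lambda>x. \<lambda>i\<in>{..<n}. x $ i) (Pi\<^sub>M {..<n} (\<lambda>_. borel))"

definition lborel_vec :: "nat \<Rightarrow> real Matrix.vec measure" where
  "lborel_vec n = distr (Pi\<^sub>M {..<n} (\<lambda>_. lborel)) (borel_vec n) (Matrix.vec n)"

definition L2 :: "nat \<Rightarrow> (real Matrix.vec \<Rightarrow> complex) set" where
  "L2 n = {f \<in> borel_measurable (lborel_vec n). integrable (lborel_vec n) (\<lambda>x. (norm (f x))\<^sup>2)}"

definition L2_norm_sq :: "nat \<Rightarrow> (real Matrix.vec \<Rightarrow> complex) \<Rightarrow> real" where
  "L2_norm_sq n f = (\<integral>x. (norm (f x))\<^sup>2 \<partial>lborel_vec n)"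

definition ae_eq :: "nat \<Rightarrow> (real Matrix.vec \<Rightarrow> complex) \<Rightarrow> (real Matrix.vec \<Rightarrow> complex) \<Rightarrow> bool" where
  "ae_eq n f f' \<longleftrightarrow> (AE x in lborel_vec n. f x = f' x)"

(* The product topology on nat => real is used; vec n only sees the first n coordinates, so this
   is ordinary continuity on R^n. *)
definition continuous_vec :: "nat \<Rightarrow> (real Matrix.vec \<Rightarrow> complex) \<Rightarrow> bool" where
  "continuous_vec n f \<longleftrightarrow> continuous_on UNIV (\<lambda>u :: nat \<Rightarrow> real. f (Matrix.vec n u))"

definition along :: "nat \<Rightarrow> nat \<Rightarrow> (real Matrix.vec \<Rightarrow> complex) \<Rightarrow> real Matrix.vec \<Rightarrow> real \<Rightarrow> complex" where
  "along n i f x s = f (x + s \<cdot>\<^sub>v unit_vec n i)"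

fun partials :: "nat \<Rightarrow> nat list \<Rightarrow> (real Matrix.vec \<Rightarrow> complex) \<Rightarrow> real Matrix.vec \<Rightarrow> complex" where
  "partials n [] f = f"
| "partials n (i # is) f = (\<lambda>x. vector_derivative (along n i (partials n is f) x) (at 0))"

(* Continuity of every iterated partial derivative makes f a C-infinity function. *)
definition schwartz :: "nat \<Rightarrow> (real Matrix.vec \<Rightarrow> complex) \<Rightarrow> bool" where
  "schwartz n f \<longleftrightarrow> (\<forall>is. set is \<subseteq> {..<n} \<longrightarrow>
      continuous_vec n (partials n is f) \<and>
      (\<forall>i<n. \<forall>x\<in>carrier_vec n. along n i (partials n is f) x differentiable at 0) \<and>
      (\<forall>k::nat. \<exists>c. \<forall>x\<in>carrier_vec n. (1 + scalar_prod x x) ^ k * norm (partials n is f x) \<le> c))"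


section \<open>The symplectic group and its subgroups\<close>

definition symp_form :: "nat \<Rightarrow> real mat" where
  "symp_form n = four_block_mat (0\<^sub>m n n) (1\<^sub>m n) (- 1\<^sub>m n) (0\<^sub>m n n)"

definition Sp :: "nat \<Rightarrow> real mat set" where
  "Sp n = {g \<in> carrier_mat (n + n) (n + n). g * symp_form n * transpose_mat g = symp_form n}"

definition int_mat :: "real mat \<Rightarrow> bool" where
  "int_mat A \<longleftrightarrow> (\<forall>i<dim_row A. \<forall>j<dim_col A. A $$ (i, j) \<in> \<int>)"

definition SpZ :: "nat \<Rightarrow> real mat set" where
  "SpZ n = {g \<in> Sp n. int_mat g}"

definition GLZ :: "nat \<Rightarrow> real mat set" where
  "GLZ n = {A \<in> carrier_mat n n. int_mat A \<and> \<bar>Determinant.det A\<bar> = 1}"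

definition sym_mat :: "nat \<Rightarrow> real mat \<Rightarrow> bool" where
  "sym_mat n X \<longleftrightarrow> X \<in> carrier_mat n n \<and> transpose_mat X = X"

definition pos_def :: "nat \<Rightarrow> real mat \<Rightarrow> bool" where
  "pos_def n Y \<longleftrightarrow> sym_mat n Y \<and>
     (\<forall>x\<in>carrier_vec n. x \<noteq> 0\<^sub>v n \<longrightarrow> scalar_prod (x \<^sub>v* Y) x > 0)"

definition pos_diag :: "nat \<Rightarrow> real mat \<Rightarrow> bool" where
  "pos_diag n V \<longleftrightarrow> V \<in> carrier_mat n n \<and> diagonal_mat V \<and> (\<forall>i<n. V $$ (i, i) > 0)"

definition upper_unipotent :: "nat \<Rightarrow> real mat \<Rightarrow> bool" where
  "upper_unipotent n U \<longleftrightarrow> U \<in> carrier_mat n n \<and> upper_triangular U \<and> (\<forall>i<n. U $$ (i, i) = 1)"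

(* tri_root n Y Z: Z is the (unique) square root of Y that is upper triangular with positive
   diagonal.  The root satisfies Y = Z Z^T, so that n(X) a(Z) k(Q) moves iI to X + iY. *)
definition tri_root :: "nat \<Rightarrow> real mat \<Rightarrow> real mat \<Rightarrow> bool" where
  "tri_root n Y Z \<longleftrightarrow> Z \<in> carrier_mat n n \<and> upper_triangular Z \<and> (\<forall>i<n. Z $$ (i, i) > 0) \<and>
     Y = Z * transpose_mat Z"

definition unitary_mats :: "nat \<Rightarrow> complex mat set" where
  "unitary_mats n = {Q \<in> carrier_mat n n. Q * mat_adjoint Q = 1\<^sub>m n}"

definition n_mat :: "nat \<Rightarrow> real mat \<Rightarrow> real mat" where
  "n_mat n X = four_block_mat (1\<^sub>m n) X (0\<^sub>m n n) (1\<^sub>m n)"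

definition a_mat :: "nat \<Rightarrow> real mat \<Rightarrow> real mat" where
  "a_mat n Z = four_block_mat Z (0\<^sub>m n n) (0\<^sub>m n n) (mat_inv (transpose_mat Z))"

definition k_mat :: "complex mat \<Rightarrow> real mat" where
  "k_mat Q = four_block_mat (map_mat Re Q) (- map_mat Im Q) (map_mat Im Q) (map_mat Re Q)"

definition J_mat :: "nat \<Rightarrow> nat \<Rightarrow> real mat" where
  "J_mat n l = four_block_mat
     (blk_diag (1\<^sub>m l) (0\<^sub>m (n - l) (n - l))) (blk_diag (0\<^sub>m l l) (- 1\<^sub>m (n - l)))
     (blk_diag (0\<^sub>m l l) (1\<^sub>m (n - l))) (blk_diag (1\<^sub>m l) (0\<^sub>m (n - l) (n - l)))"

definition iwasawa :: "nat \<Rightarrow> real mat \<Rightarrow> real mat \<Rightarrow> real mat \<Rightarrow> bool" where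
  "iwasawa n g X Y \<longleftrightarrow> sym_mat n X \<and> pos_def n Y \<and>
     (\<exists>Z Q. tri_root n Y Z \<and> Q \<in> unitary_mats n \<and> g = n_mat n X * a_mat n Z * k_mat Q)"

(* V is the positive diagonal matrix attached to g through Y = U V U^T. *)
definition iwasawa_diag :: "nat \<Rightarrow> real mat \<Rightarrow> real mat \<Rightarrow> bool" where
  "iwasawa_diag n g V \<longleftrightarrow> pos_diag n V \<and>
     (\<exists>X Y U. iwasawa n g X Y \<and> upper_unipotent n U \<and> Y = U * V * transpose_mat U)"


section \<open>The fundamental domain\<close>

(* Y = (1 r; 0 I) (v 0; 0 Y1) (1 r; 0 I)^T; here v = v1(Y) is also the first diagonal entry of V
   in Y = U V U^T. *)
definition partial_iwasawa :: "nat \<Rightarrow> real mat \<Rightarrow> real \<Rightarrow> real mat \<Rightarrow> real mat \<Rightarrow> bool" where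
  "partial_iwasawa n Y v r Y1 \<longleftrightarrow> v > 0 \<and> r \<in> carrier_mat 1 n \<and> pos_def n Y1 \<and>
     (let P = four_block_mat (1\<^sub>m 1) r (0\<^sub>m n 1) (1\<^sub>m n)
      in Y = P * blk_diag (v \<cdot>\<^sub>m 1\<^sub>m 1) Y1 * transpose_mat P)"

(* The bound 1/2 is imposed, as in Grenier's recursion, on the unipotent row r split off at each
   step; this row is r = u U1^{-1} if U = (1 u; 0 U1).  For n = 1 every v > 0 is admitted. *)
fun grenier_domain :: "nat \<Rightarrow> real mat set" where
  "grenier_domain 0 = carrier_mat 0 0"
| "grenier_domain (Suc n) = {Y. \<exists>v r Y1. partial_iwasawa n Y v r Y1 \<and>
     (\<forall>B\<in>GLZ (Suc n). \<forall>v' r' Y1'.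
        partial_iwasawa n (B * Y * transpose_mat B) v' r' Y1' \<longrightarrow> v' \<le> v) \<and>
     (\<forall>j<n. \<bar>r $$ (0, j)\<bar> \<le> 1/2) \<and>
     Y1 \<in> grenier_domain n}"

definition siegel_domain :: "nat \<Rightarrow> real mat set" where
  "siegel_domain n = {g \<in> Sp n. \<exists>X Y. iwasawa n g X Y \<and>
     (\<forall>A B C D. A \<in> carrier_mat n n \<and> B \<in> carrier_mat n n \<and> C \<in> carrier_mat n n \<and>
        D \<in> carrier_mat n n \<and> four_block_mat A B C D \<in> SpZ n \<longrightarrow>
        norm (Determinant.det (map_mat complex_of_real C *
            (map_mat complex_of_real X + \<i> \<cdot>\<^sub>m map_mat complex_of_real Y)
          + map_mat complex_of_real D)) \<ge> 1) \<and>
     (\<forall>i<n. \<forall>j<n. \<bar>X $$ (i, j)\<bar> \<le> 1/2) \<and>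
     Y \<in> grenier_domain n}"


section \<open>Schroedinger and Segal--Shale--Weil representations\<close>

type_synonym heis = "real Matrix.vec \<times> real Matrix.vec \<times> real"

definition heisenberg :: "nat \<Rightarrow> heis set" where
  "heisenberg n = carrier_vec n \<times> carrier_vec n \<times> UNIV"

(* Only the underlying set and the action of Sp n enter below; the group law is recorded for
   reference, schroedinger being multiplicative for it. *)
fun heis_mult :: "heis \<Rightarrow> heis \<Rightarrow> heis" where
  "heis_mult (x1, y1, t1) (x2, y2, t2) =
     (x1 + x2, y1 + y2, t1 + t2 + (scalar_prod y1 x2 - scalar_prod x1 y2) / 2)"

fun heis_act :: "nat \<Rightarrow> heis \<Rightarrow> real mat \<Rightarrow> heis" where
  "heis_act n (x, y, t) g =
     (let z = (x @\<^sub>v y) \<^sub>v* g in (vec_first z n, vec_last z n, t))"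

fun schroedinger :: "heis \<Rightarrow> (real Matrix.vec \<Rightarrow> complex) \<Rightarrow> real Matrix.vec \<Rightarrow> complex" where
  "schroedinger (x, y, t) f x0 =
     ee (- t + scalar_prod x y / 2 + scalar_prod x0 y) * f (x0 + x)"

(* A normalized Segal-Shale-Weil representation.  Operators on L^2 are given on functions, with
   identities holding almost everywhere; the isometry and linearity clauses make R g well defined
   on classes.  The clause  intertwines  is W(h^g) = R(g)^{-1} W(h) R(g) with R(g) moved to the
   left.  Two clauses fix choices:
     - continuous_rep: for a Schwartz function f, the class of R(g) f has a continuous
       representative, and R g f is that one, so that it can be evaluated at lattice points;
     - iwasawa_phase: the phase of R is fixed compatibly with n(X) a(Z) k(Q), which is what makes
       the explicit formula of the theta function in Iwasawa coordinates hold exactly. *)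
locale segal_shale_weil =
  fixes n :: nat
    and R :: "real mat \<Rightarrow> (real Matrix.vec \<Rightarrow> complex) \<Rightarrow> real Matrix.vec \<Rightarrow> complex"
  assumes in_L2: "\<lbrakk>g \<in> Sp n; f \<in> L2 n\<rbrakk> \<Longrightarrow> R g f \<in> L2 n"
    and linear: "\<lbrakk>g \<in> Sp n; f \<in> L2 n; f' \<in> L2 n\<rbrakk> \<Longrightarrow>
      ae_eq n (R g (\<lambda>x. a * f x + b * f' x)) (\<lambda>x. a * R g f x + b * R g f' x)"
    and isometric: "\<lbrakk>g \<in> Sp n; f \<in> L2 n\<rbrakk> \<Longrightarrow> L2_norm_sq n (R g f) = L2_norm_sq n f"
    and surjective: "\<lbrakk>g \<in> Sp n; f \<in> L2 n\<rbrakk> \<Longrightarrow> \<exists>f'\<in>L2 n. ae_eq n (R g f') f"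
    and projective: "\<lbrakk>g1 \<in> Sp n; g2 \<in> Sp n\<rbrakk> \<Longrightarrow>
      \<exists>\<rho>. norm \<rho> = 1 \<and> (\<forall>f\<in>L2 n. ae_eq n (R (g1 * g2) f) (\<lambda>x. \<rho> * R g1 (R g2 f) x))"
    and intertwines: "\<lbrakk>g \<in> Sp n; h \<in> heisenberg n; f \<in> L2 n\<rbrakk> \<Longrightarrow>
      ae_eq n (R g (schroedinger (heis_act n h g) f)) (schroedinger h (R g f))"
    and parabolic: "\<lbrakk>A \<in> carrier_mat n n; B \<in> carrier_mat n n;
        g = four_block_mat A B (0\<^sub>m n n) (mat_inv (transpose_mat A)); Determinant.det A \<noteq> 0;
        g \<in> Sp n; f \<in> L2 n\<rbrakk> \<Longrightarrow>
      ae_eq n (R g f) (\<lambda>x. of_real (sqrt \<bar>Determinant.det A\<bar>) *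
        ee (scalar_prod (x \<^sub>v* (A * transpose_mat B)) x / 2) * f (x \<^sub>v* A))"
    and partial_fourier: "\<lbrakk>l \<le> n; schwartz n f\<rbrakk> \<Longrightarrow>
      ae_eq n (R (J_mat n l) f) (\<lambda>x. \<integral>y2. f (vec_first x l @\<^sub>v y2) *
        ee (- scalar_prod (vec_last x (n - l)) y2) \<partial>lborel_vec (n - l))"
    and continuous_rep: "\<lbrakk>g \<in> Sp n; schwartz n f\<rbrakk> \<Longrightarrow> continuous_vec n (R g f)"
    and iwasawa_phase: "\<lbrakk>sym_mat n X; tri_root n Y Z; Q \<in> unitary_mats n; f \<in> L2 n\<rbrakk> \<Longrightarrow>
      ae_eq n (R (n_mat n X * a_mat n Z * k_mat Q) f) (R (n_mat n X * a_mat n Z) (R (k_mat Q) f))"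

definition theta ::
  "nat \<Rightarrow> (real mat \<Rightarrow> (real Matrix.vec \<Rightarrow> complex) \<Rightarrow> real Matrix.vec \<Rightarrow> complex) \<Rightarrow>
   (real Matrix.vec \<Rightarrow> complex) \<Rightarrow> heis \<Rightarrow> real mat \<Rightarrow> complex" where
  "theta n R f h g = (\<Sum>\<^sub>\<infinity>m\<in>int_vecs n. schroedinger h (R g f) m)"


section \<open>The factors of the decomposition with blocks of sizes \<open>l, n - l, l, n - l\<close>\<close>

definition F1 :: "nat \<Rightarrow> nat \<Rightarrow> real mat \<Rightarrow> real mat \<Rightarrow> real mat" where
  "F1 n l T S = four_block_mat (1\<^sub>m n)
     (four_block_mat T S (transpose_mat S) (0\<^sub>m (n - l) (n - l))) (0\<^sub>m n n) (1\<^sub>m n)"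

definition F2 :: "nat \<Rightarrow> nat \<Rightarrow> real mat \<Rightarrow> real mat \<Rightarrow> real mat" where
  "F2 n l U P = four_block_mat
     (four_block_mat U P (0\<^sub>m (n - l) l) (1\<^sub>m (n - l))) (0\<^sub>m n n) (0\<^sub>m n n)
     (four_block_mat (mat_inv (transpose_mat U)) (0\<^sub>m l (n - l))
        (- (transpose_mat P * mat_inv (transpose_mat U))) (1\<^sub>m (n - l)))"

definition F3 :: "nat \<Rightarrow> nat \<Rightarrow> real mat \<Rightarrow> real mat" where
  "F3 n l X = four_block_mat (1\<^sub>m n) (blk_diag (0\<^sub>m l l) X) (0\<^sub>m n n) (1\<^sub>m n)"

(* W and Z are the square roots of V_l and Y_l. *)
definition F4 :: "nat \<Rightarrow> real mat \<Rightarrow> real mat \<Rightarrow> real mat" where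
  "F4 n W Z = blk_diag (blk_diag W Z) (blk_diag (mat_inv W) (mat_inv (transpose_mat Z)))"

end

theory Submission
  imports Defs
begin

text \<open>
  Differentiating the intertwining relation turns multiplication by a coordinate and partial
  differentiation of \<open>R(k) f\<close> into \<open>R(k)\<close> applied to a linear combination of the same operators on \<open>f\<close>,
  with coefficients the entries of \<open>k\<close>. As \<open>R(k)\<close> is isometric and the entries of \<open>k(Q)\<close> are bounded
  by 1, a Sobolev inequality bounds \<open>f\<^sub>Q\<close> by any negative power of \<open>1 + |x|\<^sup>2\<close>, uniformly in \<open>Q\<close>.

  Multiplying out the four factors gives the Iwasawa coordinates of \<open>g\<close>, and the terms of the theta
  series for which the first \<open>l\<close> entries of \<open>m\<close> vanish are exactly the main term. On the fundamental
  domain \<open>v\<^sub>j\<close> is at most a constant times \<open>v\<^sub>i\<close> for \<open>i \<le> j\<close>, the \<open>v\<^sub>i\<close> are bounded below, and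
  the quadratic form \<open>V\<close> is at most a constant times \<open>Y\<close>. As the entries of \<open>x\<close> are at most 1/2 in
  absolute value, every other \<open>m\<close> makes \<open>(m + x) Y (m + x)\<^sup>T\<close> at least a constant times
  \<open>v\<^sub>l + x V x\<^sup>T\<close>, and the decay of \<open>f\<^sub>Q\<close> bounds the sum of these terms.
\<close>

section \<open>Schwartz functions\<close>

text \<open>The assumptions give R(k) f only as a continuous function subject to identities in L^2,
  so its differentiability has to be proved. Difference quotients converge in L^2 only; the relation
  is therefore obtained in integrated form, where both sides are continuous and an L^2 limit forces
  equality at every point, and the fundamental theorem of calculus then returns true partial
  derivatives. Uniformity in Q comes from the fact that k(Q) carries a basic generator to one with
  coefficients in [-1, 1], and that words of bounded length in such generators have bounded L^2 norm
  on a fixed Schwartz function.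

  The decay is used with exponent n + N, where N \<ge> A + n/4. The part with exponent n makes the
  lattice sum converge uniformly in g and h. The surplus n/4 pays for (det Y_l)^(1/4), a factor of
  every term that is absent from the error bound: the squared diagonal entries of the root of Y_l
  are at most a constant times v_l, so this factor is at most a constant times (v_l + x V
  x^T)^(n/4).\<close>

lemma vec_fun_upd:
  "j < n \<Longrightarrow> Matrix.vec n u + s \<cdot>\<^sub>v unit_vec n j = Matrix.vec n (u(j := u j + s :: real))"
  by (intro eq_vecI) (auto simp: unit_vec_def)

lemma vec_of_carrier: "x \<in> carrier_vec n \<Longrightarrow> Matrix.vec n (\<lambda>i. x $ i) = x"
  by auto

lemma scalar_prod_self: "scalar_prod x x = (\<Sum>i<dim_vec x. (x $ i :: real)\<^sup>2)"
  by (simp add: scalar_prod_def power2_eq_square lessThan_atLeast0)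

lemma scalar_prod_self_nonneg [simp]: "0 \<le> scalar_prod x (x :: real Matrix.vec)"
  by (simp add: scalar_prod_self sum_nonneg)

lemma vec_index_sq_le:
  assumes "x \<in> carrier_vec n" "j < n" shows "(x $ j :: real)\<^sup>2 \<le> scalar_prod x x"
  using assms by (auto simp: scalar_prod_self intro!: member_le_sum)

lemma schwartz_continuous: "schwartz n f \<Longrightarrow> continuous_vec n f"
  unfolding schwartz_def by (drule spec[of _ "[]"]) simp

lemma schwartz_along_differentiable:
  "\<lbrakk>schwartz n f; i < n; x \<in> carrier_vec n\<rbrakk> \<Longrightarrow> along n i f x differentiable at 0"
  unfolding schwartz_def by (drule spec[of _ "[]"]) simp

lemma schwartz_decay:
  "schwartz n f \<Longrightarrow> \<exists>c. \<forall>x\<in>carrier_vec n. (1 + scalar_prod x x) ^ k * norm (f x) \<le> c"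
  unfolding schwartz_def by (drule spec[of _ "[]"]) simp

lemma partials_append: "partials n (is @ js) f = partials n is (partials n js f)"
  by (induction "is") auto

lemma schwartz_partial: "\<lbrakk>schwartz n f; i < n\<rbrakk> \<Longrightarrow> schwartz n (partials n [i] f)"
  unfolding schwartz_def partials_append[symmetric] by (metis Un_subset_iff empty_set lessThan_iff list.simps(15) set_append insert_subset empty_subsetI)

lemma along_has_vector_derivative:
  "\<lbrakk>schwartz n f; i < n; x \<in> carrier_vec n\<rbrakk> \<Longrightarrow>
    (along n i f x has_vector_derivative partials n [i] f x) (at 0)"
  using schwartz_along_differentiable[of n f i x] by (simp add: vector_derivative_works[symmetric])

text \<open>A family closed under each single partial derivative contains all iterated ones, so
  continuity, differentiability and decay need to be checked only for a general member. The family
  has to be chosen wide enough to be closed.\<close>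

lemma schwartz_coinduct:
  assumes "P f"
    and "\<And>g. P g \<Longrightarrow> continuous_vec n g"
    and "\<And>g i x. \<lbrakk>P g; i < n; x \<in> carrier_vec n\<rbrakk> \<Longrightarrow> along n i g x differentiable at 0"
    and "\<And>g k. P g \<Longrightarrow> \<exists>c. \<forall>x\<in>carrier_vec n. (1 + scalar_prod x x) ^ k * norm (g x) \<le> c"
    and "\<And>g i. \<lbrakk>P g; i < n\<rbrakk> \<Longrightarrow> P (partials n [i] g)"
  shows "schwartz n f"
proof -
  have "set is \<subseteq> {..<n} \<Longrightarrow> P (partials n is f)" for "is"
  proof (induction "is")
    case Nil then show ?case using assms(1) by simp
  next
    case (Cons i "is")
    then have "P (partials n [i] (partials n is f))" by (intro assms(5)) auto
    then show ?case by simp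
  qed
  then show ?thesis unfolding schwartz_def using assms(2-4) by blast
qed

lemma continuous_vec_cong:
  "(\<And>x. x \<in> carrier_vec n \<Longrightarrow> f x = g x) \<Longrightarrow> continuous_vec n f = continuous_vec n g"
  unfolding continuous_vec_def by (intro continuous_on_cong) auto

lemma along_derivative_lincomb:
  assumes "schwartz n f1" "schwartz n f2" "i < n" "x \<in> carrier_vec n"
    and "\<And>x. x \<in> carrier_vec n \<Longrightarrow> g x = a * f1 x + b * f2 x"
  shows "(along n i g x has_vector_derivative a * partials n [i] f1 x + b * partials n [i] f2 x) (at 0)"
proof -
  have "along n i g x = (\<lambda>s. a * along n i f1 x s + b * along n i f2 x s)"
    using assms(4,5) by (intro ext) (simp add: along_def)
  then show ?thesis
    using assms(1-4)
    by (auto intro!: has_vector_derivative_add has_vector_derivative_mult_right along_has_vector_derivative 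
        simp del: partials.simps)
qed

lemma schwartz_lincomb:
  assumes "schwartz n f1" "schwartz n f2"
    and "\<And>x. x \<in> carrier_vec n \<Longrightarrow> g x = a * f1 x + b * f2 x"
  shows "schwartz n g"
proof (rule schwartz_coinduct[where P = "\<lambda>g. \<exists>f1 f2. schwartz n f1 \<and> schwartz n f2 \<and>
    (\<forall>x\<in>carrier_vec n. g x = a * f1 x + b * f2 x)"])
  show "\<exists>f1 f2. schwartz n f1 \<and> schwartz n f2 \<and> (\<forall>x\<in>carrier_vec n. g x = a * f1 x + b * f2 x)"
    using assms by blast
next
  fix g assume "\<exists>f1 f2. schwartz n f1 \<and> schwartz n f2 \<and> (\<forall>x\<in>carrier_vec n. g x = a * f1 x + b * f2 x)"
  then obtain f1 f2 where f: "schwartz n f1" "schwartz n f2"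
    and g: "\<And>x. x \<in> carrier_vec n \<Longrightarrow> g x = a * f1 x + b * f2 x" by blast
  note der = along_derivative_lincomb[OF f _ _ g]
  show "continuous_vec n g"
    using schwartz_continuous[OF f(1)] schwartz_continuous[OF f(2)]
    by (subst continuous_vec_cong[OF g]) (auto simp: continuous_vec_def intro!: continuous_intros)
  show "along n i g x differentiable at 0" if "i < n" "x \<in> carrier_vec n" for i x
    using der[OF that] by (auto simp: has_vector_derivative_def differentiable_def)
  show "\<exists>c. \<forall>x\<in>carrier_vec n. (1 + scalar_prod x x) ^ k * norm (g x) \<le> c" for k
  proof -
    obtain c1 c2 where c: "\<forall>x\<in>carrier_vec n. (1 + scalar_prod x x) ^ k * norm (f1 x) \<le> c1"
       "\<forall>x\<in>carrier_vec n. (1 + scalar_prod x x) ^ k * norm (f2 x) \<le> c2"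
      using f schwartz_decay by metis
    have "(1 + scalar_prod x x) ^ k * norm (g x) \<le> norm a * c1 + norm b * c2" if x: "x \<in> carrier_vec n" for x
    proof -
      have "(1 + scalar_prod x x) ^ k * norm (g x) \<le> (1 + scalar_prod x x) ^ k * (norm a * norm (f1 x) + norm b * norm (f2 x))"
        unfolding g[OF x] by (intro mult_left_mono order_trans[OF norm_triangle_ineq]) (auto simp: norm_mult)
      also have "\<dots> = norm a * ((1 + scalar_prod x x) ^ k * norm (f1 x)) + norm b * ((1 + scalar_prod x x) ^ k * norm (f2 x))"
        by (simp add: algebra_simps)
      also have "\<dots> \<le> norm a * c1 + norm b * c2" using c x by (intro add_mono mult_left_mono) auto
      finally show ?thesis .
    qed
    then show ?thesis by blast
  qed
  show "\<exists>f1 f2. schwartz n f1 \<and> schwartz n f2 \<and> (\<forall>x\<in>carrier_vec n. partials n [i] g x = a * f1 x + b * f2 x)"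
    if i: "i < n" for i
    using schwartz_partial[OF f(1) i] schwartz_partial[OF f(2) i] vector_derivative_at[OF der[OF i]]
    by (intro exI[of _ "partials n [i] f1"] exI[of _ "partials n [i] f2"]) simp
qed

lemma schwartz_scale: "schwartz n f \<Longrightarrow> schwartz n (\<lambda>x. a * f x)"
  using schwartz_lincomb[of n f f "\<lambda>x. a * f x" a 0] by simp

lemma schwartz_add: "schwartz n f \<Longrightarrow> schwartz n g \<Longrightarrow> schwartz n (\<lambda>x. f x + g x)"
  using schwartz_lincomb[of n f g "\<lambda>x. f x + g x" 1 1] by simp

lemma schwartz_sum:
  assumes "finite I" "\<And>i. i \<in> I \<Longrightarrow> schwartz n (f i)" "schwartz n f0"
  shows "schwartz n (\<lambda>x. f0 x + (\<Sum>i\<in>I. f i x))"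
  using assms
proof (induction I)
  case empty then show ?case by simp
next
  case (insert i I)
  then have "schwartz n (\<lambda>x. (f0 x + (\<Sum>i\<in>I. f i x)) + f i x)"
    by (intro schwartz_add[of n "\<lambda>x. f0 x + (\<Sum>i\<in>I. f i x)" "f i"]) auto
  moreover have "(\<lambda>x. (f0 x + (\<Sum>i\<in>I. f i x)) + f i x) = (\<lambda>x. f0 x + (\<Sum>i\<in>insert i I. f i x))"
    using insert(1,2) by (simp add: add_ac)
  ultimately show ?case by simp
qed

lemma along_derivative_mult_coord:
  assumes "schwartz n f1" "schwartz n f2" "i < n" "j < n" "x \<in> carrier_vec n"
    and "\<And>x. x \<in> carrier_vec n \<Longrightarrow> g x = complex_of_real (x $ j) * f1 x + f2 x"
  shows "(along n i g x has_vector_derivative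
     complex_of_real (x $ j) * partials n [i] f1 x + ((if i = j then 1 else 0) * f1 x + partials n [i] f2 x)) (at 0)"
proof -
  have eq: "along n i g x = (\<lambda>s. complex_of_real (x $ j + s * (if i = j then 1 else 0)) * along n i f1 x s + along n i f2 x s)"
    using assms(3-6) by (intro ext) (auto simp add: along_def unit_vec_def)
  have [simp]: "x + 0 \<cdot>\<^sub>v unit_vec n i = x" using assms(5) by (intro eq_vecI) auto
  have 1: "((\<lambda>s. complex_of_real (x $ j + s * (if i = j then 1 else 0))) has_vector_derivative (if i = j then 1 else 0)) (at 0)"
    by (auto intro!: derivative_eq_intros)
  have "((\<lambda>s. complex_of_real (x $ j + s * (if i = j then 1 else 0)) * along n i f1 x s + along n i f2 x s)
     has_vector_derivative (complex_of_real (x $ j + 0 * (if i = j then 1 else 0)) * partials n [i] f1 x + (if i = j then 1 else 0) * along n i f1 x 0)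
       + partials n [i] f2 x) (at 0)"
    by (intro has_vector_derivative_add has_vector_derivative_mult 1 along_has_vector_derivative assms)
  then show ?thesis unfolding eq by (simp add: along_def add.assoc)
qed

text \<open>Products x_j f1 alone are not closed under differentiation, but the sums x_j f1 + f2
  are: the derivative in direction i is x_j times that of f1, plus a Schwartz function that collects
  the derivative of f2 and, for i = j, f1 itself.\<close>

lemma schwartz_mult_coord:
  assumes "schwartz n f1" "j < n"
  shows "schwartz n (\<lambda>x. complex_of_real (x $ j) * f1 x)"
proof (rule schwartz_coinduct[where P = "\<lambda>g. \<exists>f1 f2. schwartz n f1 \<and> schwartz n f2 \<and>
    (\<forall>x\<in>carrier_vec n. g x = complex_of_real (x $ j) * f1 x + f2 x)"])
  show "\<exists>h1 h2. schwartz n h1 \<and> schwartz n h2 \<and> (\<forall>x\<in>carrier_vec n. complex_of_real (x $ j) * f1 x = complex_of_real (x $ j) * h1 x + h2 x)"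
    using assms schwartz_scale[OF assms(1), of 0] by (intro exI[of _ f1] exI[of _ "\<lambda>x. 0"]) simp
next
  fix g assume "\<exists>f1 f2. schwartz n f1 \<and> schwartz n f2 \<and> (\<forall>x\<in>carrier_vec n. g x = complex_of_real (x $ j) * f1 x + f2 x)"
  then obtain f1 f2 where f: "schwartz n f1" "schwartz n f2"
    and g: "\<And>x. x \<in> carrier_vec n \<Longrightarrow> g x = complex_of_real (x $ j) * f1 x + f2 x" by blast
  note der = along_derivative_mult_coord[OF f _ assms(2) _ g]
  show "continuous_vec n g"
    using schwartz_continuous[OF f(1)] schwartz_continuous[OF f(2)] assms(2)
    by (subst continuous_vec_cong[OF g]) (auto simp: continuous_vec_def continuous_on_product_coordinates intro!: continuous_intros)
  show "along n i g x differentiable at 0" if "i < n" "x \<in> carrier_vec n" for i x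
    using der[OF that] by (auto simp: has_vector_derivative_def differentiable_def)
  show "\<exists>c. \<forall>x\<in>carrier_vec n. (1 + scalar_prod x x) ^ k * norm (g x) \<le> c" for k
  proof -
    \<comment> \<open>One additional power of 1 + |x|^2 for f1 absorbs the factor |x_j|.\<close>
    obtain c1 c2 where c: "\<forall>x\<in>carrier_vec n. (1 + scalar_prod x x) ^ (Suc k) * norm (f1 x) \<le> c1"
       "\<forall>x\<in>carrier_vec n. (1 + scalar_prod x x) ^ k * norm (f2 x) \<le> c2"
      using f schwartz_decay by metis
    have "(1 + scalar_prod x x) ^ k * norm (g x) \<le> c1 + c2" if x: "x \<in> carrier_vec n" for x
    proof -
      have "\<bar>x $ j\<bar> \<le> 1 + (x $ j)\<^sup>2"
        using sum_squares_bound[of "\<bar>x $ j\<bar>" 1] by (simp add: power2_eq_square)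
      then have xj: "\<bar>x $ j\<bar> \<le> 1 + scalar_prod x x"
        using vec_index_sq_le[OF x assms(2)] by linarith
      have "(1 + scalar_prod x x) ^ k * norm (g x) \<le> (1 + scalar_prod x x) ^ k * ((1 + scalar_prod x x) * norm (f1 x) + norm (f2 x))"
        unfolding g[OF x] using xj
        by (intro mult_left_mono order_trans[OF norm_triangle_ineq] add_mono) (auto simp: norm_mult intro!: mult_right_mono)
      also have "\<dots> = (1 + scalar_prod x x) ^ Suc k * norm (f1 x) + (1 + scalar_prod x x) ^ k * norm (f2 x)"
        by (simp add: algebra_simps)
      also have "\<dots> \<le> c1 + c2" using c x by (intro add_mono) auto
      finally show ?thesis .
    qed
    then show ?thesis by blast
  qed
  show "\<exists>f1 f2. schwartz n f1 \<and> schwartz n f2 \<and> (\<forall>x\<in>carrier_vec n. partials n [i] g x = complex_of_real (x $ j) * f1 x + f2 x)"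
    if i: "i < n" for i
  proof (intro exI conjI ballI)
    show "schwartz n (partials n [i] f1)" using f i by (intro schwartz_partial)
    show "schwartz n (\<lambda>x. (if i = j then 1 else 0) * f1 x + partials n [i] f2 x)" 
      using f i by (intro schwartz_add schwartz_scale schwartz_partial)
    show "partials n [i] g x = complex_of_real (x $ j) * partials n [i] f1 x + ((if i = j then 1 else 0) * f1 x + partials n [i] f2 x)"
      if "x \<in> carrier_vec n" for x
      using vector_derivative_at[OF der[OF i that]] by simp
  qed
qed

text \<open>The infinitesimal generator of the unitary group \<open>s \<mapsto> W(s a, s b, 0)\<close>.\<close>

definition gen :: "nat \<Rightarrow> real Matrix.vec \<times> real Matrix.vec \<Rightarrow> (real Matrix.vec \<Rightarrow> complex) \<Rightarrow> real Matrix.vec \<Rightarrow> complex" where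
  "gen n h f x = (\<Sum>j<n. of_real (fst h $ j) * partials n [j] f x)
     + (\<Sum>j<n. of_real (snd h $ j) * (2 * pi * \<i> * (of_real (x $ j) * f x)))"

lemma schwartz_gen:
  assumes "schwartz n f" shows "schwartz n (gen n h f)"
proof -
  have z: "schwartz n (\<lambda>x. 0)" using schwartz_scale[OF assms, of 0] by simp
  have "schwartz n (\<lambda>x. (0 + (\<Sum>j<n. of_real (fst h $ j) * partials n [j] f x))
     + (\<Sum>j<n. of_real (snd h $ j) * (2 * pi * \<i> * (of_real (x $ j) * f x))))"
    by (intro schwartz_sum z schwartz_scale schwartz_mult_coord schwartz_partial assms) auto
  then show ?thesis unfolding gen_def[abs_def] by simp
qed

section \<open>The generators of the Schroedinger representation\<close>

text \<open>The chain rule along a line, from continuous partial derivatives, setting one further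
  coordinate in motion at each induction step.\<close>

lemma directional_derivative:
  fixes \<phi> :: "(nat \<Rightarrow> real) \<Rightarrow> complex" and a :: "nat \<Rightarrow> real"
  assumes cont: "\<And>j. j < n \<Longrightarrow> continuous_on UNIV (\<phi>' j)"
    and der: "\<And>j u r. j < n \<Longrightarrow> ((\<lambda>r. \<phi> (u(j := r))) has_vector_derivative \<phi>' j (u(j := r))) (at r)"
  shows "k \<le> n \<Longrightarrow> ((\<lambda>s. \<phi> (\<lambda>i. if i < k then u i + s * a i else u i)) has_vector_derivative
    (\<Sum>j<k. a j *\<^sub>R \<phi>' j (\<lambda>i. if i < k then u i + s * a i else u i))) (at s)"
proof (induction k arbitrary: u s)
  case 0
  then show ?case by simp
next
  case (Suc k)
  \<comment> \<open>Coordinates below k move with s, while coordinate k is an independent variable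
    r. The induction hypothesis then supplies the derivative in s and \<open>der\<close> the one in
    r, and continuity of the latter combines them into a total derivative. The curve wanted is s
    \<mapsto> (s, u k + s * a k).\<close>
  define e where "e = (\<lambda>(s, r) i. if i < k then u i + s * a i else if i = k then r else u i :: real)"
  have econt: "continuous_on UNIV e"
  proof (rule continuous_on_coordinatewise_then_product)
    fix i
    have "(\<lambda>x. e x i) = (if i < k then (\<lambda>x. u i + fst x * a i) else if i = k then snd else (\<lambda>x. u i))"
      by (auto simp: e_def fun_eq_iff)
    then show "continuous_on UNIV (\<lambda>x. e x i)"
      by (simp only:) (auto intro!: continuous_intros simp: continuous_on_snd[OF continuous_on_id, unfolded id_def])
  qed
  define r0 where "r0 = u k + s * a k"
  have IH: "((\<lambda>s. \<phi> (e (s, r))) has_vector_derivative (\<Sum>j<k. a j *\<^sub>R \<phi>' j (e (s, r)))) (at s)" for s r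
  proof -
    have "e (s, r) = (\<lambda>i. if i < k then (u(k := r)) i + s * a i else (u(k := r)) i)" for s
      by (auto simp: e_def)
    then show ?thesis using Suc.IH[of "u(k := r)" s] Suc.prems by simp
  qed
  have 1: "((\<lambda>(s, r). \<phi> (e (s, r))) has_derivative
      (\<lambda>(ts, tr). ts *\<^sub>R (\<Sum>j<k. a j *\<^sub>R \<phi>' j (e (s, r0))) +
         blinfun_apply (blinfun_scaleR_left (\<phi>' k (e (s, r0)))) tr)) (at (s, r0) within UNIV \<times> UNIV)"
  proof (rule has_derivative_partialsI)
    show "((\<lambda>x. \<phi> (e (x, r0))) has_derivative (\<lambda>ts. ts *\<^sub>R (\<Sum>j<k. a j *\<^sub>R \<phi>' j (e (s, r0))))) (at s)"
      using IH by (simp add: has_vector_derivative_def)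
    show "((\<lambda>y. \<phi> (e (x, y))) has_derivative blinfun_apply (blinfun_scaleR_left (\<phi>' k (e (x, y))))) (at y)"
      for x y
    proof -
      have "e (x, y) = (\<lambda>i. if i < k then u i + x * a i else u i)(k := y)" for y
        by (auto simp: e_def)
      then show ?thesis using der[of k "\<lambda>i. if i < k then u i + x * a i else u i" y] Suc.prems
        by (simp add: has_vector_derivative_def blinfun_scaleR_left.rep_eq)
    qed
    have "continuous_on UNIV (\<lambda>z. blinfun_scaleR_left (\<phi>' k (e z)) :: real \<Rightarrow>\<^sub>L complex)"
      using Suc.prems
      by (intro bounded_linear.continuous_on[OF bounded_linear_blinfun_scaleR_left] continuous_on_compose2[OF cont econt]) auto
    then show "continuous (at (s, r0) within UNIV \<times> UNIV) (\<lambda>(x, y). blinfun_scaleR_left (\<phi>' k (e (x, y))) :: real \<Rightarrow>\<^sub>L complex)"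
      by (simp add: continuous_on_eq_continuous_within case_prod_unfold)
  qed auto
  have 2: "((\<lambda>s. (s, u k + s * a k)) has_derivative (\<lambda>t. (t, t * a k))) (at s)"
    by (auto intro!: derivative_eq_intros)
  have 3: "((\<lambda>s. \<phi> (e (s, u k + s * a k))) has_derivative
     (\<lambda>t. t *\<^sub>R (\<Sum>j<k. a j *\<^sub>R \<phi>' j (e (s, r0))) + (t * a k) *\<^sub>R \<phi>' k (e (s, r0)))) (at s)"
    using has_derivative_compose[OF 2, OF 1[unfolded r0_def, simplified]]
    by (simp add: r0_def blinfun_scaleR_left.rep_eq)
  have 4: "e (s, u k + s * a k) = (\<lambda>i. if i < Suc k then u i + s * a i else u i)" for s
    by (auto simp: e_def less_Suc_eq)
  show ?case using 3 unfolding 4 r0_def has_vector_derivative_def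
    by (simp add: scaleR_add_right)
qed

lemma schwartz_directional_derivative:
  assumes "schwartz n f" "x \<in> carrier_vec n" "a \<in> carrier_vec n"
  shows "((\<lambda>s. f (x + s \<cdot>\<^sub>v a)) has_vector_derivative
    (\<Sum>j<n. of_real (a $ j) * partials n [j] f (x + s \<cdot>\<^sub>v a))) (at s)"
proof -
  have der: "((\<lambda>r. f (Matrix.vec n (u(j := r)))) has_vector_derivative partials n [j] f (Matrix.vec n (u(j := r)))) (at r)"
    if "j < n" for j u r
  proof -
    have eq: "along n j f (Matrix.vec n (u(j := r))) = (\<lambda>s. f (Matrix.vec n (u(j := r + s))))"
      using that by (intro ext) (simp add: along_def vec_fun_upd)
    have "((\<lambda>s. f (Matrix.vec n (u(j := r + s)))) has_vector_derivative partials n [j] f (Matrix.vec n (u(j := r)))) (at 0)"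
      using along_has_vector_derivative[OF assms(1) that, of "Matrix.vec n (u(j := r))"] unfolding eq by auto
    then have "(((\<lambda>s. f (Matrix.vec n (u(j := r + s)))) \<circ> (\<lambda>t. t - r)) has_vector_derivative 1 *\<^sub>R partials n [j] f (Matrix.vec n (u(j := r)))) (at r)"
      by (intro vector_diff_chain_at) (auto intro!: derivative_eq_intros)
    then show ?thesis by (simp add: o_def)
  qed
  have cont: "continuous_on UNIV (\<lambda>u. partials n [j] f (Matrix.vec n u))" if "j < n" for j
    using schwartz_continuous[OF schwartz_partial[OF assms(1) that]] by (simp add: continuous_vec_def)
  have eq: "Matrix.vec n (\<lambda>i. if i < n then x $ i + s * a $ i else x $ i) = x + s \<cdot>\<^sub>v a" for s
    using assms(2,3) by (intro eq_vecI) auto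
  show ?thesis
    using directional_derivative[where \<phi> = "\<lambda>u. f (Matrix.vec n u)" and \<phi>' = "\<lambda>j u. partials n [j] f (Matrix.vec n u)"
        and n = n and k = n and u = "\<lambda>i. x $ i" and a = "\<lambda>i. a $ i", OF cont der]
    unfolding eq by (simp add: scaleR_conv_of_real)
qed

section \<open>One-parameter groups of the Schroedinger representation and their Taylor
  expansion\<close>

lemma ee_add: "ee (s + t) = ee s * ee t"
  by (simp add: ee_def exp_add[symmetric] algebra_simps)

lemma norm_ee [simp]: "norm (ee s) = 1"
proof -
  have "2 * complex_of_real pi * \<i> * complex_of_real s = \<i> * complex_of_real (2 * pi * s)" by simp
  then show ?thesis unfolding ee_def by (metis norm_exp_i_times)
qed

lemma ee_0 [simp]: "ee 0 = 1"
  by (simp add: ee_def)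

lemma continuous_on_ee [continuous_intros]:
  "continuous_on S g \<Longrightarrow> continuous_on S (\<lambda>x. ee (g x))"
  unfolding ee_def by (intro continuous_intros)

lemma ee_has_vector_derivative:
  assumes "(g has_real_derivative d) (at s)"
  shows "((\<lambda>s. ee (g s)) has_vector_derivative 2 * pi * \<i> * of_real d * ee (g s)) (at s)"
proof -
  have 1: "((\<lambda>s. 2 * complex_of_real pi * \<i> * complex_of_real (g s)) has_vector_derivative 2 * complex_of_real pi * \<i> * complex_of_real d) (at s)"
    using assms by (intro has_vector_derivative_mult_right has_vector_derivative_of_real) (simp add: has_real_derivative_iff_has_vector_derivative)
  show ?thesis
    unfolding ee_def using field_vector_diff_chain_at[OF 1 DERIV_exp] by (simp add: o_def mult_ac)
qed

text \<open>A one-parameter group: the bilinear term of \<open>heis_mult\<close> vanishes on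
  multiples of one vector, so the central coordinate stays 0.\<close>

abbreviation sch :: "real Matrix.vec \<times> real Matrix.vec \<Rightarrow> real \<Rightarrow> (real Matrix.vec \<Rightarrow> complex) \<Rightarrow> real Matrix.vec \<Rightarrow> complex" where
  "sch h s f \<equiv> schroedinger (s \<cdot>\<^sub>v fst h, s \<cdot>\<^sub>v snd h, 0) f"

lemma sch_eq:
  assumes "a \<in> carrier_vec n" "b \<in> carrier_vec n" "x \<in> carrier_vec n"
  shows "sch (a, b) s f x = ee (s\<^sup>2 * scalar_prod a b / 2 + s * scalar_prod x b) * f (x + s \<cdot>\<^sub>v a)"
  using assms by (simp add: power2_eq_square mult.assoc)

lemma gen_eq:
  assumes "x \<in> carrier_vec n" "b \<in> carrier_vec n"
  shows "gen n (a, b) f x = (\<Sum>j<n. of_real (a $ j) * partials n [j] f x) + 2 * pi * \<i> * of_real (scalar_prod x b) * f x"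
proof -
  have "(\<Sum>j<n. of_real (b $ j) * (2 * pi * \<i> * (of_real (x $ j) * f x))) = 2 * pi * \<i> * of_real (scalar_prod x b) * f x"
    using assms by (simp add: scalar_prod_def lessThan_atLeast0 sum_distrib_left sum_distrib_right mult_ac)
  then show ?thesis by (simp add: gen_def)
qed

lemma sch_has_vector_derivative:
  assumes f: "schwartz n f" and x: "x \<in> carrier_vec n" and a: "a \<in> carrier_vec n" and b: "b \<in> carrier_vec n"
  shows "((\<lambda>s. sch (a, b) s f x) has_vector_derivative sch (a, b) s (gen n (a, b) f) x) (at s)"
proof -
  have x': "x + s \<cdot>\<^sub>v a \<in> carrier_vec n" using x a by auto
  have 1: "((\<lambda>s. s\<^sup>2 * scalar_prod a b / 2 + s * scalar_prod x b) has_real_derivative s * scalar_prod a b + scalar_prod x b) (at s)"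
    by (auto intro!: derivative_eq_intros)
  \<comment> \<open>The summand s a b^T, which arises from the quadratic phase, is exactly what
    places the multiplication operator of \<open>gen\<close> at the translated point x + s
    a.\<close>
  have 2: "scalar_prod (x + s \<cdot>\<^sub>v a) b = s * scalar_prod a b + scalar_prod x b"
    using x a b by (simp add: add_scalar_prod_distrib[of _ n])
  show ?thesis
    unfolding sch_eq[OF a b x] gen_eq[OF x' b] 2
    using has_vector_derivative_mult[OF ee_has_vector_derivative[OF 1] schwartz_directional_derivative[OF f x a]]
    by (simp add: algebra_simps)
qed

text \<open>Peetre's inequality: a translation of bounded length changes the weight 1 + |x|^2 by at
  most a constant factor.\<close>

lemma one_plus_norm_shift:
  assumes x: "x \<in> carrier_vec n" and a: "a \<in> carrier_vec n" and u: "\<bar>u\<bar> \<le> (1::real)"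
  shows "1 + scalar_prod x x \<le> 2 * (1 + scalar_prod a a) * (1 + scalar_prod (x + u \<cdot>\<^sub>v a) (x + u \<cdot>\<^sub>v a))"
proof -
  have "scalar_prod x x \<le> (\<Sum>i<n. 2 * (x $ i + u * a $ i)\<^sup>2 + 2 * (a $ i)\<^sup>2)"
    using x unfolding scalar_prod_self carrier_vecD[OF x]
  proof (intro sum_mono)
    fix i
    have "(u * a $ i)\<^sup>2 \<le> (a $ i)\<^sup>2"
      using u by (simp add: power_mult_distrib mult_left_le_one_le abs_square_le_1)
    moreover have "(x $ i)\<^sup>2 \<le> 2 * (x $ i + u * a $ i)\<^sup>2 + 2 * (u * a $ i)\<^sup>2"
      using zero_le_power2[of "x $ i + 2 * (u * a $ i)"] by (simp add: power2_eq_square algebra_simps)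
    ultimately show "(x $ i)\<^sup>2 \<le> 2 * (x $ i + u * a $ i)\<^sup>2 + 2 * (a $ i)\<^sup>2" by linarith
  qed
  also have "\<dots> = 2 * scalar_prod (x + u \<cdot>\<^sub>v a) (x + u \<cdot>\<^sub>v a) + 2 * scalar_prod a a"
    using x a by (simp add: scalar_prod_self sum.distrib sum_distrib_left)
  finally have 1: "scalar_prod x x \<le> 2 * scalar_prod (x + u \<cdot>\<^sub>v a) (x + u \<cdot>\<^sub>v a) + 2 * scalar_prod a a" .
  have "0 \<le> scalar_prod a a * scalar_prod (x + u \<cdot>\<^sub>v a) (x + u \<cdot>\<^sub>v a)" by simp
  moreover have "2 * (1 + scalar_prod a a) * (1 + scalar_prod (x + u \<cdot>\<^sub>v a) (x + u \<cdot>\<^sub>v a)) =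
    2 + 2 * scalar_prod a a + 2 * scalar_prod (x + u \<cdot>\<^sub>v a) (x + u \<cdot>\<^sub>v a)
      + 2 * (scalar_prod a a * scalar_prod (x + u \<cdot>\<^sub>v a) (x + u \<cdot>\<^sub>v a))"
    by (simp add: algebra_simps)
  ultimately show ?thesis using 1 by linarith
qed

lemma schwartz_shift_bound:
  assumes f: "schwartz n f" and a: "a \<in> carrier_vec n"
  obtains c where "c \<ge> 0" "\<And>x u. x \<in> carrier_vec n \<Longrightarrow> \<bar>u\<bar> \<le> 1 \<Longrightarrow> norm (f (x + u \<cdot>\<^sub>v a)) \<le> c / (1 + scalar_prod x x) ^ k"
proof -
  obtain c where c: "\<And>x. x \<in> carrier_vec n \<Longrightarrow> (1 + scalar_prod x x) ^ k * norm (f x) \<le> c"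
    using schwartz_decay[OF f] by metis
  show ?thesis
  proof
    show "0 \<le> (2 * (1 + scalar_prod a a)) ^ k * \<bar>c\<bar>"
      by (intro mult_nonneg_nonneg zero_le_power) (auto intro: add_nonneg_nonneg)
    fix x :: "real Matrix.vec" and u assume x: "x \<in> carrier_vec n" and u: "\<bar>u\<bar> \<le> (1::real)"
    let ?y = "x + u \<cdot>\<^sub>v a"
    have y: "?y \<in> carrier_vec n" using x a by auto
    have "(1 + scalar_prod x x) ^ k * norm (f ?y) \<le> (2 * (1 + scalar_prod a a) * (1 + scalar_prod ?y ?y)) ^ k * norm (f ?y)"
      using one_plus_norm_shift[OF x a u] by (intro mult_right_mono power_mono) auto
    also have "\<dots> = (2 * (1 + scalar_prod a a)) ^ k * ((1 + scalar_prod ?y ?y) ^ k * norm (f ?y))"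
      by (simp add: power_mult_distrib)
    also have "\<dots> \<le> (2 * (1 + scalar_prod a a)) ^ k * \<bar>c\<bar>"
      using c[OF y] by (intro mult_left_mono zero_le_power) (auto intro: add_nonneg_nonneg)
    finally show "norm (f ?y) \<le> (2 * (1 + scalar_prod a a)) ^ k * \<bar>c\<bar> / (1 + scalar_prod x x) ^ k"
      by (simp add: field_simps add_pos_nonneg)
  qed
qed

text \<open>The second derivative in s is the group applied to \<open>gen\<close> of
  \<open>gen\<close> of f, again a translate of a Schwartz function up to a phase. Its decay is
  uniform for |s| \<le> 1, which makes the remainder small in L^2 and not merely at each
  point.\<close>

lemma sch_taylor:
  assumes f: "schwartz n f" and a: "a \<in> carrier_vec n" and b: "b \<in> carrier_vec n"
  obtains c where "c \<ge> 0" "\<And>x s. x \<in> carrier_vec n \<Longrightarrow> \<bar>s\<bar> \<le> 1 \<Longrightarrow>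
    norm (sch (a, b) s f x - f x - of_real s * gen n (a, b) f x) \<le> s\<^sup>2 * c / (1 + scalar_prod x x) ^ k"
proof -
  let ?g = "gen n (a, b) f"
  let ?g2 = "gen n (a, b) ?g"
  have g: "schwartz n ?g" and g2: "schwartz n ?g2" using f by (auto intro: schwartz_gen)
  obtain c where c: "c \<ge> 0" "\<And>x u. x \<in> carrier_vec n \<Longrightarrow> \<bar>u\<bar> \<le> 1 \<Longrightarrow> norm (?g2 (x + u \<cdot>\<^sub>v a)) \<le> c / (1 + scalar_prod x x) ^ k"
    using schwartz_shift_bound[OF g2 a] by blast
  show ?thesis
  proof (rule that[OF c(1)])
    fix x :: "real Matrix.vec" and s :: real assume x: "x \<in> carrier_vec n" and s: "\<bar>s\<bar> \<le> 1"
    define B where "B = c / (1 + scalar_prod x x) ^ k"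
    have B: "B \<ge> 0" unfolding B_def using c(1) by (intro divide_nonneg_nonneg zero_le_power) (auto intro: add_nonneg_nonneg)
    have seg: "\<bar>u\<bar> \<le> \<bar>s\<bar>" if "u \<in> closed_segment 0 s" for u
      using that by (auto simp: closed_segment_eq_real_ivl split: if_splits)
    have "x + 0 \<cdot>\<^sub>v a = x" using x a by (intro eq_vecI) auto
    then have z: "sch (a, b) 0 h x = h x" for h unfolding sch_eq[OF a b x] by simp
    \<comment> \<open>The mean value inequality is used twice: here it bounds the variation of the
      first derivative, and below this variation bounds the error of the linearization.\<close>
    have d1: "norm (sch (a, b) u ?g x - ?g x) \<le> \<bar>s\<bar> * B" if u: "u \<in> closed_segment 0 s" for u
    proof -
      have "norm (sch (a, b) u ?g x - sch (a, b) 0 ?g x) \<le> B * norm (u - 0)"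
      proof (rule differentiable_bound[of "closed_segment 0 s" _ "\<lambda>v h. h *\<^sub>R sch (a, b) v ?g2 x"])
        show "((\<lambda>u. sch (a, b) u ?g x) has_derivative (\<lambda>h. h *\<^sub>R sch (a, b) v ?g2 x)) (at v within closed_segment 0 s)" for v
          using sch_has_vector_derivative[OF g x a b, of v]
          unfolding has_vector_derivative_def by (rule has_derivative_at_withinI)
        show "onorm (\<lambda>h. h *\<^sub>R sch (a, b) v ?g2 x) \<le> B" if "v \<in> closed_segment 0 s" for v
        proof -
          have "norm (sch (a, b) v ?g2 x) \<le> B"
            unfolding sch_eq[OF a b x] B_def norm_mult norm_ee using c(2)[OF x, of v] seg[OF that] s by simp
          then show ?thesis
            by (intro onorm_le) (metis abs_ge_zero mult.commute mult_right_mono norm_scaleR real_norm_def)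
        qed
      qed (use u in auto)
      also have "\<dots> \<le> B * \<bar>s\<bar>" using seg[OF u] B by (simp add: mult_left_mono)
      finally show ?thesis using z by (simp add: mult.commute)
    qed
    have "norm (sch (a, b) s f x - sch (a, b) 0 f x - (s - 0) *\<^sub>R sch (a, b) 0 ?g x) \<le> norm (s - 0) * (\<bar>s\<bar> * B)"
    proof (rule vector_differentiable_bound_linearization[where S = "closed_segment 0 s" and f = "\<lambda>v. sch (a, b) v f x"
        and f' = "\<lambda>v. sch (a, b) v ?g x" and ?x0.0 = 0])
      show "((\<lambda>v. sch (a, b) v f x) has_vector_derivative sch (a, b) v ?g x) (at v within closed_segment 0 s)" for v
        by (rule has_vector_derivative_at_within[OF sch_has_vector_derivative[OF f x a b]])
      show "norm (sch (a, b) v ?g x - sch (a, b) 0 ?g x) \<le> \<bar>s\<bar> * B" if "v \<in> closed_segment 0 s" for v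
        using d1[OF that] z by simp
    qed auto
    then show "norm (sch (a, b) s f x - f x - of_real s * ?g x) \<le> s\<^sup>2 * c / (1 + scalar_prod x x) ^ k"
      unfolding z B_def by (simp add: scaleR_conv_of_real power2_eq_square abs_mult_self_eq mult.assoc[symmetric])
  qed
qed

section \<open>Square norms and Lebesgue measure on vectors\<close>

lemma measurable_vec: "Matrix.vec n \<in> measurable (Pi\<^sub>M {..<n} (\<lambda>_. lborel)) (borel_vec n)"
  unfolding borel_vec_def
proof (rule measurable_vimage_algebra2)
  have "(\<lambda>u. \<lambda>i\<in>{..<n}. u i) \<in> measurable (Pi\<^sub>M {..<n} (\<lambda>_. lborel)) (Pi\<^sub>M {..<n} (\<lambda>_. borel :: real measure))"
    by (intro measurable_restrict) measurable
  moreover have "(\<lambda>u :: nat \<Rightarrow> real. \<lambda>i\<in>{..<n}. u i) = (\<lambda>u. \<lambda>i\<in>{..<n}. Matrix.vec n u $ i)"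
    by (auto simp: fun_eq_iff restrict_def)
  ultimately show "(\<lambda>u. \<lambda>i\<in>{..<n}. Matrix.vec n u $ i) \<in> measurable (Pi\<^sub>M {..<n} (\<lambda>_. lborel)) (Pi\<^sub>M {..<n} (\<lambda>_. borel :: real measure))"
    by simp
qed auto

lemma space_lborel_vec [simp]: "space (lborel_vec n) = carrier_vec n"
  by (simp add: lborel_vec_def borel_vec_def)

lemma sets_lborel_vec [simp, measurable_cong]: "sets (lborel_vec n) = sets (borel_vec n)"
  by (simp add: lborel_vec_def)

lemma space_borel_vec [simp]: "space (borel_vec n) = carrier_vec n"
  by (simp add: borel_vec_def)

lemma continuous_vec_measurable:
  assumes "continuous_vec n f" shows "f \<in> borel_measurable (borel_vec n)"
proof -
  define \<phi> where "\<phi> = (\<lambda>u. f (Matrix.vec n u))"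
  have \<phi>: "\<phi> \<in> borel_measurable borel"
    using assms unfolding continuous_vec_def \<phi>_def by (rule borel_measurable_continuous_onI)
  \<comment> \<open>Continuity refers to all sequences, the sigma-algebra to n coordinates;
    extension by zero carries the latter into the former measurably.\<close>
  have ext: "(\<lambda>u i. if i < n then u i else 0) \<in> borel_measurable (Pi\<^sub>M {..<n} (\<lambda>_. borel :: real measure))"
  proof (rule measurable_coordinatewise_then_product)
    fix i :: nat
    show "(\<lambda>u. if i < n then u i else 0) \<in> borel_measurable (Pi\<^sub>M {..<n} (\<lambda>_. borel :: real measure))"
      using measurable_component_singleton[of i "{..<n}" "\<lambda>_. borel :: real measure"] by (cases "i < n") auto
  qed
  have g: "(\<lambda>x. \<lambda>i\<in>{..<n}. x $ i) \<in> measurable (borel_vec n) (Pi\<^sub>M {..<n} (\<lambda>_. borel :: real measure))"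
    unfolding borel_vec_def by (rule measurable_vimage_algebra1) (auto simp: space_PiM)
  have "(\<lambda>x. \<phi> ((\<lambda>u i. if i < n then u i else 0) (\<lambda>i\<in>{..<n}. x $ i))) \<in> borel_measurable (borel_vec n)"
    using measurable_compose[OF measurable_compose[OF g ext] \<phi>] .
  moreover have "\<phi> ((\<lambda>u i. if i < n then u i else 0) (\<lambda>i\<in>{..<n}. x $ i)) = f x" if "x \<in> carrier_vec n" for x
  proof -
    have "Matrix.vec n ((\<lambda>u i. if i < n then u i else 0) (\<lambda>i\<in>{..<n}. x $ i)) = x" using that by (intro eq_vecI) auto
    then show ?thesis by (simp add: \<phi>_def)
  qed
  ultimately show ?thesis by (subst measurable_cong[where g = "\<lambda>x. \<phi> ((\<lambda>u i. if i < n then u i else 0) (\<lambda>i\<in>{..<n}. x $ i))"]) auto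
qed

lemma nn_integral_lborel_vec:
  assumes "\<Phi> \<in> borel_measurable (borel_vec n)"
  shows "(\<integral>\<^sup>+x. \<Phi> x \<partial>lborel_vec n) = (\<integral>\<^sup>+u. \<Phi> (Matrix.vec n u) \<partial>Pi\<^sub>M {..<n} (\<lambda>_. lborel))"
  unfolding lborel_vec_def using assms by (intro nn_integral_distr measurable_vec) auto

lemma emeasure_lborel_open_pos:
  assumes "open S" "x \<in> S" shows "emeasure lborel (S :: real set) \<noteq> 0"
proof -
  obtain e where e: "e > 0" "cball x e \<subseteq> S" using assms open_contains_cball by blast
  have "emeasure lborel (cball x e) \<le> emeasure lborel S" using e assms by (intro emeasure_mono) auto
  moreover have "emeasure lborel (cball x e) > 0"
    using e by (simp add: cball_eq_atLeastAtMost)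
  ultimately show ?thesis by auto
qed

text \<open>A point of disagreement has an open box of disagreement around it, and a nonempty open
  box has positive measure. This is how an identity in L^2 becomes one that can be evaluated at
  lattice points.\<close>

lemma ae_eq_continuous_vec:
  assumes f: "continuous_vec n f" and g: "continuous_vec n g" and "ae_eq n f g" and x: "x \<in> carrier_vec n"
  shows "f x = g x"
proof (rule ccontr)
  assume neq: "f x \<noteq> g x"
  interpret product_sigma_finite "\<lambda>_::nat. lborel :: real measure" by standard
  let ?M = "Pi\<^sub>M {..<n} (\<lambda>_. lborel :: real measure)"
  define S where "S = {u. f (Matrix.vec n u) \<noteq> g (Matrix.vec n u)}"
  have "open S" unfolding S_def using f g unfolding continuous_vec_def
    by (intro open_Collect_neq)
  moreover have "(\<lambda>i. x $ i) \<in> S" using neq x by (simp add: S_def vec_of_carrier)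
  ultimately have "\<exists>X. (\<lambda>i. x $ i) \<in> (\<Pi>\<^sub>E i\<in>UNIV. X i) \<and> (\<forall>i. openin euclidean (X i)) \<and>
      finite {i. X i \<noteq> topspace euclidean} \<and> (\<Pi>\<^sub>E i\<in>UNIV. X i) \<subseteq> S"
    unfolding open_fun_def by (rule product_topology_open_contains_basis)
  then obtain X where X: "\<And>i. x $ i \<in> X i" "\<And>i. open (X i)" "(\<Pi>\<^sub>E i\<in>UNIV. X i) \<subseteq> S"
    by (auto simp: PiE_iff)
  have "AE u in ?M. f (Matrix.vec n u) = g (Matrix.vec n u)"
    using assms(3) unfolding ae_eq_def lborel_vec_def by (rule AE_distrD[OF measurable_vec])
  then obtain N where N: "{u \<in> space ?M. f (Matrix.vec n u) \<noteq> g (Matrix.vec n u)} \<subseteq> N" "emeasure ?M N = 0" "N \<in> sets ?M"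
    by (rule AE_E)
  have "(\<Pi>\<^sub>E i\<in>{..<n}. X i) \<subseteq> N"
  proof
    fix u assume u: "u \<in> (\<Pi>\<^sub>E i\<in>{..<n}. X i)"
    \<comment> \<open>Coordinates from n on are filled with those of the base point, which lie in
      the sets X i; \<open>vec n\<close> does not see them.\<close>
    have "(\<lambda>i. if i < n then u i else x $ i) \<in> (\<Pi>\<^sub>E i\<in>UNIV. X i)" using u X(1) by (auto simp: PiE_iff)
    then have "(\<lambda>i. if i < n then u i else x $ i) \<in> S" using X(3) by blast
    moreover have "Matrix.vec n (\<lambda>i. if i < n then u i else x $ i) = Matrix.vec n u" by (intro eq_vecI) auto
    ultimately have "f (Matrix.vec n u) \<noteq> g (Matrix.vec n u)" by (simp add: S_def)
    moreover have "u \<in> space ?M" using u by (auto simp: space_PiM PiE_iff)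
    ultimately show "u \<in> N" using N(1) by auto
  qed
  then have "emeasure ?M (\<Pi>\<^sub>E i\<in>{..<n}. X i) = 0" using N(2,3) by (metis emeasure_eq_0)
  moreover have "emeasure ?M (\<Pi>\<^sub>E i\<in>{..<n}. X i) = (\<Prod>i<n. emeasure lborel (X i))"
    using X(2) by (intro emeasure_PiM) auto
  ultimately obtain i where "emeasure lborel (X i) = 0" by auto
  then show False using emeasure_lborel_open_pos[OF X(2) X(1)] by blast
qed

text \<open>An extended real, so that the theorems of Tonelli and Fatou apply before integrability
  is known.\<close>

definition N2 :: "nat \<Rightarrow> (real Matrix.vec \<Rightarrow> complex) \<Rightarrow> ennreal" where
  "N2 n f = (\<integral>\<^sup>+x. ennreal ((norm (f x))\<^sup>2) \<partial>lborel_vec n)"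

lemma N2_eq_PiM:
  assumes "f \<in> borel_measurable (borel_vec n)"
  shows "N2 n f = (\<integral>\<^sup>+u. ennreal ((norm (f (Matrix.vec n u)))\<^sup>2) \<partial>Pi\<^sub>M {..<n} (\<lambda>_. lborel))"
  unfolding N2_def using assms by (intro nn_integral_lborel_vec) measurable

text \<open>Tonelli's theorem with coordinate j split off reduces the claim to translation
  invariance of Lebesgue measure on the line.\<close>

lemma N2_translate:
  assumes f[measurable]: "f \<in> borel_measurable (borel_vec n)" and j: "j < n"
  shows "N2 n (\<lambda>x. f (x + s \<cdot>\<^sub>v unit_vec n j)) = N2 n f"
proof -
  interpret product_sigma_finite "\<lambda>_::nat. lborel :: real measure" by standard
  define I where "I = {..<n} - {j}"
  have I: "{..<n} = insert j I" "finite I" "j \<notin> I" using j by (auto simp: I_def)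
  define \<psi> where "\<psi> = (\<lambda>u. ennreal ((norm (f (Matrix.vec n u)))\<^sup>2))"
  have m: "\<psi> \<in> borel_measurable (Pi\<^sub>M (insert j I) (\<lambda>_. lborel))"
    unfolding \<psi>_def I(1)[symmetric] using measurable_compose[OF measurable_vec f] by measurable
  have mt: "(\<lambda>u. u(j := u j + s)) \<in> measurable (Pi\<^sub>M {..<n} (\<lambda>_. lborel)) (Pi\<^sub>M {..<n} (\<lambda>_. lborel :: real measure))"
  proof (rule measurable_PiM_single')
    fix i assume i: "i \<in> {..<n}"
    have c: "(\<lambda>u. u i) \<in> borel_measurable (Pi\<^sub>M {..<n} (\<lambda>_. lborel :: real measure))" if "i < n" for i
      using measurable_component_singleton[of i "{..<n}" "\<lambda>_. lborel :: real measure"] that by simp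
    show "(\<lambda>u. (u(j := u j + s)) i) \<in> measurable (Pi\<^sub>M {..<n} (\<lambda>_. lborel :: real measure)) lborel"
      using i j by (cases "i = j") (auto intro!: borel_measurable_add c)
  qed (use j in \<open>auto simp: space_PiM PiE_iff extensional_def\<close>)
  have tm: "(\<lambda>x. f (x + s \<cdot>\<^sub>v unit_vec n j)) \<in> borel_measurable (borel_vec n)"
  proof -
    have "(\<lambda>x. x + s \<cdot>\<^sub>v unit_vec n j) \<in> measurable (borel_vec n) (borel_vec n)"
      unfolding borel_vec_def[of n]
    proof (rule measurable_vimage_algebra2)
      have g: "(\<lambda>x. \<lambda>i\<in>{..<n}. x $ i) \<in> measurable (borel_vec n) (Pi\<^sub>M {..<n} (\<lambda>_. borel :: real measure))"
        unfolding borel_vec_def by (rule measurable_vimage_algebra1) (auto simp: space_PiM)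
      have c: "(\<lambda>x. x $ i) \<in> borel_measurable (borel_vec n)" if "i < n" for i
        using measurable_compose[OF g measurable_component_singleton[of i]] that by simp
      have "(\<lambda>x. \<lambda>i\<in>{..<n}. x $ i + s * unit_vec n j $ i) \<in> measurable (borel_vec n) (Pi\<^sub>M {..<n} (\<lambda>_. borel :: real measure))"
        using c by (intro measurable_restrict borel_measurable_add) auto
      then show "(\<lambda>x. \<lambda>i\<in>{..<n}. (x + s \<cdot>\<^sub>v unit_vec n j) $ i) \<in> measurable (vimage_algebra (carrier_vec n) (\<lambda>x. \<lambda>i\<in>{..<n}. x $ i) (Pi\<^sub>M {..<n} (\<lambda>_. borel)))
         (Pi\<^sub>M {..<n} (\<lambda>_. borel :: real measure))"
        unfolding borel_vec_def[symmetric] by (rule measurable_cong[THEN iffD1, rotated]) (auto simp: restrict_def fun_eq_iff)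
    qed auto
    then show ?thesis using f by (rule measurable_compose)
  qed
  have "N2 n (\<lambda>x. f (x + s \<cdot>\<^sub>v unit_vec n j)) = (\<integral>\<^sup>+u. \<psi> (u(j := u j + s)) \<partial>Pi\<^sub>M {..<n} (\<lambda>_. lborel))"
    unfolding N2_eq_PiM[OF tm] \<psi>_def using j by (simp add: vec_fun_upd)
  also have "\<dots> = (\<integral>\<^sup>+ x. (\<integral>\<^sup>+ y. \<psi> ((x(j := y))(j := y + s)) \<partial>lborel) \<partial>Pi\<^sub>M I (\<lambda>_. lborel))"
    using measurable_compose[OF mt m[folded I(1)]] unfolding I(1)
    by (subst product_nn_integral_insert[OF I(2,3)]) auto
  also have "\<dots> = (\<integral>\<^sup>+ x. (\<integral>\<^sup>+ y. \<psi> (x(j := y)) \<partial>lborel) \<partial>Pi\<^sub>M I (\<lambda>_. lborel))"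
  proof (rule nn_integral_cong)
    fix x assume x: "x \<in> space (Pi\<^sub>M I (\<lambda>_. lborel :: real measure))"
    have "(\<lambda>y. x(j := y)) \<in> measurable lborel (Pi\<^sub>M (insert j I) (\<lambda>_. lborel :: real measure))"
      using x by (intro measurable_fun_upd[where J = I]) auto
    from measurable_compose[OF this m] have "(\<lambda>y. \<psi> (x(j := y))) \<in> borel_measurable borel" by simp
    then show "(\<integral>\<^sup>+ y. \<psi> ((x(j := y))(j := y + s)) \<partial>lborel) = (\<integral>\<^sup>+ y. \<psi> (x(j := y)) \<partial>lborel)"
      using nn_integral_real_affine[of "\<lambda>y. \<psi> (x(j := y))" 1 s] by (simp add: add.commute)
  qed
  also have "\<dots> = (\<integral>\<^sup>+u. \<psi> u \<partial>Pi\<^sub>M {..<n} (\<lambda>_. lborel))"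
    unfolding I(1) by (subst product_nn_integral_insert[OF I(2,3) m]) auto
  also have "\<dots> = N2 n f" unfolding N2_eq_PiM[OF f] \<psi>_def ..
  finally show ?thesis .
qed

section \<open>Decay that implies square integrability\<close>

lemma nn_integral_inverse_one_plus_square: "(\<integral>\<^sup>+x. ennreal (1 / (1 + x\<^sup>2)) \<partial>lborel) < \<infinity>"
proof -
  have A: "(\<integral>\<^sup>+x. ennreal (1 / (1 + x\<^sup>2)) * indicator {0..} x \<partial>lborel) = ennreal (pi / 2 - arctan 0)"
    by (rule nn_integral_FTC_atLeast)
       (auto intro!: derivative_eq_intros tendsto_arctan_at_top simp: inverse_eq_divide)
  have B: "(\<integral>\<^sup>+x. ennreal (1 / (1 + x\<^sup>2)) * indicator {..0} x \<partial>lborel) = (\<integral>\<^sup>+x. ennreal (1 / (1 + x\<^sup>2)) * indicator {0..} x \<partial>lborel)"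
    by (subst nn_integral_real_affine[of _ "-1" 0]) (auto intro!: nn_integral_cong simp: indicator_def)
  have "(\<integral>\<^sup>+x. ennreal (1 / (1 + x\<^sup>2)) \<partial>lborel) \<le>
     (\<integral>\<^sup>+x. ennreal (1 / (1 + x\<^sup>2)) * indicator {0..} x + ennreal (1 / (1 + x\<^sup>2)) * indicator {..0} x \<partial>lborel)"
    by (intro nn_integral_mono) (auto simp: indicator_def)
  also have "\<dots> = ennreal (pi / 2) + ennreal (pi / 2)"
    by (subst nn_integral_add) (auto simp: A B)
  also have "\<dots> < \<infinity>" by (simp add: ennreal_plus[symmetric] del: ennreal_plus)
  finally show ?thesis .
qed

text \<open>Replaces the radial weight by a product weight, whose integral factorizes over the
  coordinates.\<close>

lemma prod_le_one_plus_norm: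
  assumes "x \<in> carrier_vec n" shows "(\<Prod>i<n. 1 + (x $ i :: real)\<^sup>2) \<le> (1 + scalar_prod x x) ^ n"
proof -
  have "(\<Prod>i<n. 1 + (x $ i)\<^sup>2) \<le> (\<Prod>i<n. 1 + scalar_prod x x)"
    using vec_index_sq_le[OF assms] by (intro prod_mono) auto
  then show ?thesis by simp
qed

definition weight_integral :: "nat \<Rightarrow> ennreal" where
  "weight_integral n = (\<integral>\<^sup>+u. (\<Prod>i<n. ennreal (1 / (1 + (u i)\<^sup>2))) \<partial>Pi\<^sub>M {..<n} (\<lambda>_. lborel))"

lemma weight_integral_finite: "weight_integral n < \<infinity>"
proof -
  interpret product_sigma_finite "\<lambda>_::nat. lborel :: real measure" by standard
  have "weight_integral n = (\<Prod>i<n. \<integral>\<^sup>+x. ennreal (1 / (1 + x\<^sup>2)) \<partial>lborel)"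
    unfolding weight_integral_def by (intro product_nn_integral_prod) auto
  also have "\<dots> < \<infinity>" using nn_integral_inverse_one_plus_square by (simp add: power_less_top_ennreal)
  finally show ?thesis .
qed

text \<open>Just enough decay on R^n for membership in L^2. The class takes in
  \<open>sch (a, b) s f\<close> for Schwartz f from a bound on translates of f alone.\<close>

definition rapid :: "nat \<Rightarrow> (real Matrix.vec \<Rightarrow> complex) \<Rightarrow> bool" where
  "rapid n f \<longleftrightarrow> continuous_vec n f \<and> (\<exists>c. \<forall>x\<in>carrier_vec n. norm (f x) \<le> c / (1 + scalar_prod x x) ^ n)"

lemma N2_bound:
  assumes "continuous_vec n f" "\<And>x. x \<in> carrier_vec n \<Longrightarrow> norm (f x) \<le> c / (1 + scalar_prod x x) ^ n"
  shows "N2 n f \<le> ennreal (c\<^sup>2) * weight_integral n"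
proof -
  have "N2 n f \<le> (\<integral>\<^sup>+u. ennreal (c\<^sup>2) * (\<Prod>i<n. ennreal (1 / (1 + (u i)\<^sup>2))) \<partial>Pi\<^sub>M {..<n} (\<lambda>_. lborel))"
    unfolding N2_eq_PiM[OF continuous_vec_measurable[OF assms(1)]]
  proof (rule nn_integral_mono)
    fix u :: "nat \<Rightarrow> real"
    let ?x = "Matrix.vec n u" let ?q = "\<Prod>i<n. 1 + (u i)\<^sup>2"
    have q1: "1 \<le> ?q" by (intro prod_ge_1) auto
    have q: "?q \<le> (1 + scalar_prod ?x ?x) ^ n" using prod_le_one_plus_norm[of ?x n] by simp
    have "norm (f ?x) \<le> c / (1 + scalar_prod ?x ?x) ^ n" by (rule assms(2)) auto
    then have "(norm (f ?x))\<^sup>2 \<le> (c / (1 + scalar_prod ?x ?x) ^ n)\<^sup>2" by (intro power_mono) auto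
    also have "\<dots> = c\<^sup>2 / ((1 + scalar_prod ?x ?x) ^ n)\<^sup>2" by (simp add: power_divide)
    also have "\<dots> \<le> c\<^sup>2 / ?q"
    proof (rule divide_left_mono)
      \<comment> \<open>The squared decay provides the square of the product weight; as ?q is at
        least 1, one factor can be given away.\<close>
      have "?q \<le> ?q * ?q" using q1 by (simp add: mult_le_cancel_left1)
      also have "\<dots> \<le> ((1 + scalar_prod ?x ?x) ^ n)\<^sup>2" unfolding power2_eq_square[of "(1 + scalar_prod ?x ?x) ^ n"] using q q1 by (intro mult_mono) auto
      finally show "?q \<le> ((1 + scalar_prod ?x ?x) ^ n)\<^sup>2" .
      then show "0 < ((1 + scalar_prod ?x ?x) ^ n)\<^sup>2 * ?q" using q1 add_pos_nonneg[of 1 "scalar_prod ?x ?x"]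
        by (intro mult_pos_pos zero_less_power) auto
    qed simp
    finally have "ennreal ((norm (f ?x))\<^sup>2) \<le> ennreal (c\<^sup>2 * (\<Prod>i<n. 1 / (1 + (u i)\<^sup>2)))"
      by (intro ennreal_leI) (simp add: prod_dividef)
    then show "ennreal ((norm (f ?x))\<^sup>2) \<le> ennreal (c\<^sup>2) * (\<Prod>i<n. ennreal (1 / (1 + (u i)\<^sup>2)))"
      by (subst (asm) ennreal_mult) (auto simp: prod_ennreal intro!: prod_nonneg)
  qed
  also have "\<dots> = ennreal (c\<^sup>2) * weight_integral n"
    unfolding weight_integral_def by (intro nn_integral_cmult) measurable
  finally show ?thesis .
qed

lemma rapid_N2_finite: "rapid n f \<Longrightarrow> N2 n f < \<infinity>"
proof -
  assume "rapid n f"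
  then obtain c where "continuous_vec n f" "\<And>x. x \<in> carrier_vec n \<Longrightarrow> norm (f x) \<le> c / (1 + scalar_prod x x) ^ n"
    unfolding rapid_def by blast
  then have "N2 n f \<le> ennreal (c\<^sup>2) * weight_integral n" by (rule N2_bound)
  then show ?thesis
    by (rule le_less_trans) (use weight_integral_finite[of n] in \<open>simp add: ennreal_mult_less_top\<close>)
qed

lemma rapid_L2: "rapid n f \<Longrightarrow> f \<in> L2 n"
proof -
  assume f: "rapid n f"
  then have [measurable]: "f \<in> borel_measurable (borel_vec n)" by (auto simp: rapid_def continuous_vec_measurable)
  have "integrable (lborel_vec n) (\<lambda>x. (norm (f x))\<^sup>2)"
    using rapid_N2_finite[OF f] by (intro integrableI_bounded) (auto simp: N2_def)
  then show ?thesis by (simp add: L2_def measurable_cong_sets[OF sets_lborel_vec refl])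
qed

lemma N2_L2: "f \<in> L2 n \<Longrightarrow> N2 n f = ennreal (L2_norm_sq n f)"
  unfolding N2_def L2_norm_sq_def L2_def by (intro nn_integral_eq_integral) auto

lemma rapid_lincomb:
  assumes "rapid n f" "rapid n g" shows "rapid n (\<lambda>x. a * f x + b * g x)"
proof -
  obtain c d where c: "\<And>x. x \<in> carrier_vec n \<Longrightarrow> norm (f x) \<le> c / (1 + scalar_prod x x) ^ n"
    and d: "\<And>x. x \<in> carrier_vec n \<Longrightarrow> norm (g x) \<le> d / (1 + scalar_prod x x) ^ n"
    using assms unfolding rapid_def by blast
  have "norm (a * f x + b * g x) \<le> (norm a * c + norm b * d) / (1 + scalar_prod x x) ^ n" if x: "x \<in> carrier_vec n" for x
  proof -
    have "norm (a * f x + b * g x) \<le> norm a * norm (f x) + norm b * norm (g x)"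
      by (metis norm_mult norm_triangle_ineq)
    also have "\<dots> \<le> norm a * (c / (1 + scalar_prod x x) ^ n) + norm b * (d / (1 + scalar_prod x x) ^ n)"
      using c[OF x] d[OF x] by (intro add_mono mult_left_mono) auto
    finally show ?thesis by (simp add: add_divide_distrib)
  qed
  then show ?thesis using assms unfolding rapid_def continuous_vec_def by (auto intro!: continuous_intros)
qed

lemma schwartz_rapid:
  assumes "schwartz n f" shows "rapid n f"
proof -
  obtain c where c: "\<forall>x\<in>carrier_vec n. (1 + scalar_prod x x) ^ n * norm (f x) \<le> c"
    using schwartz_decay[OF assms] by blast
  have "norm (f x) \<le> c / (1 + scalar_prod x x) ^ n" if "x \<in> carrier_vec n" for x
    using c that by (simp add: field_simps add_pos_nonneg)
  then show ?thesis using schwartz_continuous[OF assms] unfolding rapid_def by blast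
qed

text \<open>By Fatou's lemma the L^2 norm of the pointwise limit is 0, and a continuous function of
  norm 0 vanishes everywhere. This identifies the pointwise limit of difference quotients with their
  L^2 limit.\<close>

lemma N2_fatou:
  assumes H: "continuous_vec n H" and HN: "\<And>N. continuous_vec n (HN N)"
    and lim: "\<And>x. x \<in> carrier_vec n \<Longrightarrow> (\<lambda>N. HN N x) \<longlonglongrightarrow> H x"
    and N2: "(\<lambda>N. N2 n (HN N)) \<longlonglongrightarrow> 0" and x: "x \<in> carrier_vec n"
  shows "H x = 0"
proof -
  note [measurable] = continuous_vec_measurable[OF H] continuous_vec_measurable[OF HN]
  have "N2 n H = (\<integral>\<^sup>+x. liminf (\<lambda>N. ennreal ((norm (HN N x))\<^sup>2)) \<partial>lborel_vec n)"
    unfolding N2_def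
  proof (rule nn_integral_cong)
    fix x assume "x \<in> space (lborel_vec n)"
    then have "(\<lambda>N. HN N x) \<longlonglongrightarrow> H x" using lim by simp
    then have "(\<lambda>N. ennreal ((norm (HN N x))\<^sup>2)) \<longlonglongrightarrow> ennreal ((norm (H x))\<^sup>2)"
      by (intro tendsto_ennrealI tendsto_intros)
    then show "ennreal ((norm (H x))\<^sup>2) = liminf (\<lambda>N. ennreal ((norm (HN N x))\<^sup>2))"
      by (metis lim_imp_Liminf trivial_limit_sequentially)
  qed
  also have "\<dots> \<le> liminf (\<lambda>N. N2 n (HN N))" unfolding N2_def
    by (rule nn_integral_liminf) measurable
  also have "\<dots> = 0" using N2 by (simp add: lim_imp_Liminf)
  finally have "N2 n H = 0" by simp
  then have "AE x in lborel_vec n. ennreal ((norm (H x))\<^sup>2) = 0" unfolding N2_def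
    by (subst (asm) nn_integral_0_iff_AE) auto
  then have "ae_eq n H (\<lambda>x. 0)" unfolding ae_eq_def by eventually_elim auto
  then show ?thesis using ae_eq_continuous_vec[OF H _ _ x, of "\<lambda>x. 0"] by (simp add: continuous_vec_def)
qed

section \<open>Intertwining of the generators\<close>

text \<open>Each summand is compared with the increment of a primitive over its subinterval. The use
  of N + 2 intervals keeps the mesh at most 1 whenever t \<le> 2, the range in which difference
  quotients are controlled.\<close>

lemma riemann_sum_tendsto:
  fixes \<phi> :: "real \<Rightarrow> complex"
  assumes cont: "continuous_on {0..t} \<phi>" and t: "0 \<le> t"
  shows "(\<lambda>N. \<Sum>i<N + 2. of_real (t / real (N + 2)) * \<phi> (real i * (t / real (N + 2)))) \<longlonglongrightarrow> integral {0..t} \<phi>"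
proof (rule LIMSEQ_I)
  fix r :: real assume r: "0 < r"
  \<comment> \<open>The errors add up to t * \<epsilon>, which is below r; the summand 1 covers t =
    0.\<close>
  define \<epsilon> where "\<epsilon> = r / (2 * (t + 1))"
  have \<epsilon>: "\<epsilon> > 0" using r t by (simp add: \<epsilon>_def)
  have "uniformly_continuous_on {0..t} \<phi>" using cont by (intro compact_uniformly_continuous) auto
  then obtain d where d: "d > 0" "\<And>x y. x \<in> {0..t} \<Longrightarrow> y \<in> {0..t} \<Longrightarrow> dist x y < d \<Longrightarrow> dist (\<phi> x) (\<phi> y) < \<epsilon>"
    using \<epsilon> unfolding uniformly_continuous_on_def by (metis dist_commute)
  obtain N0 :: nat where N0: "t / d < real N0" using reals_Archimedean2 by blast
  define \<Phi> where "\<Phi> = (\<lambda>s. integral {0..s} \<phi>)"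
  have \<Phi>: "(\<Phi> has_vector_derivative \<phi> s) (at s within {0..t})" if "s \<in> {0..t}" for s
    unfolding \<Phi>_def using integral_has_vector_derivative[OF cont that] .
  show "\<exists>no. \<forall>N\<ge>no. norm ((\<Sum>i<N + 2. of_real (t / real (N + 2)) * \<phi> (real i * (t / real (N + 2)))) - integral {0..t} \<phi>) < r"
  proof (intro exI allI impI)
    fix N assume N: "N0 \<le> N"
    define M where "M = N + 2"
    define h where "h = t / real M"
    have h0: "h \<ge> 0" using t by (simp add: h_def)
    have hd: "h < d"
    proof -
      have "t / d < real M" using N0 N by (simp add: M_def)
      then show ?thesis using d(1) by (simp add: h_def field_simps M_def)
    qed
    have Mh: "real M * h = t" by (simp add: h_def M_def)
    have tele: "(\<Sum>i<M. \<Phi> (real (Suc i) * h) - \<Phi> (real i * h)) = integral {0..t} \<phi>"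
      by (subst sum_lessThan_telescope) (simp add: \<Phi>_def Mh)
    have each: "norm (\<Phi> (real (Suc i) * h) - \<Phi> (real i * h) - of_real h * \<phi> (real i * h)) \<le> h * \<epsilon>" if i: "i < M" for i
    proof -
      let ?a = "real i * h" and ?b = "real (Suc i) * h"
      have ab: "?a \<le> ?b" using h0 by (simp add: mult_right_mono)
      have "?b \<le> real M * h" using i h0 by (intro mult_right_mono) auto
      then have sub: "{?a..?b} \<subseteq> {0..t}" using Mh h0 by auto
      have "norm (\<Phi> ?b - \<Phi> ?a - (?b - ?a) *\<^sub>R \<phi> ?a) \<le> norm (?b - ?a) * \<epsilon>"
      proof (rule vector_differentiable_bound_linearization[where S = "{?a..?b}" and f = \<Phi> and f' = \<phi> and ?x0.0 = "?a"])
        show "(\<Phi> has_vector_derivative \<phi> x) (at x within {?a..?b})" if "x \<in> {?a..?b}" for x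
          using \<Phi> that sub by (meson has_vector_derivative_within_subset subset_eq)
        show "norm (\<phi> x - \<phi> ?a) \<le> \<epsilon>" if x: "x \<in> {?a..?b}" for x
        proof -
          have "dist x ?a < d" using x hd by (auto simp: dist_real_def algebra_simps)
          then have "dist (\<phi> x) (\<phi> ?a) < \<epsilon>" using d(2)[of x ?a] x sub ab by auto
          then show ?thesis by (simp add: dist_norm)
        qed
      qed (use ab in \<open>auto simp: closed_segment_eq_real_ivl\<close>)
      moreover have e: "?b - ?a = h" by (simp add: algebra_simps)
      ultimately show ?thesis using h0 unfolding e by (simp add: scaleR_conv_of_real)
    qed
    have "norm ((\<Sum>i<M. of_real h * \<phi> (real i * h)) - integral {0..t} \<phi>)
       = norm (\<Sum>i<M. (\<Phi> (real (Suc i) * h) - \<Phi> (real i * h)) - of_real h * \<phi> (real i * h))"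
      unfolding tele[symmetric] by (subst norm_minus_commute) (simp only: sum_subtractf)
    also have "\<dots> \<le> (\<Sum>i<M. h * \<epsilon>)"
      by (intro order_trans[OF norm_sum] sum_mono each) auto
    also have "\<dots> = t * \<epsilon>" using Mh by simp
    also have "\<dots> < r"
    proof -
      have "t * r < r * (2 * (t + 1))" using r t by (simp add: algebra_simps add_strict_increasing)
      then show ?thesis using t by (simp add: \<epsilon>_def divide_simps)
    qed
    finally show "norm ((\<Sum>i<N + 2. of_real (t / real (N + 2)) * \<phi> (real i * (t / real (N + 2)))) - integral {0..t} \<phi>) < r"
      unfolding h_def M_def .
  qed
qed

lemma continuous_on_fun_upd_affine:
  "continuous_on S (\<lambda>t :: real. (u :: nat \<Rightarrow> real)(j := c + t))"
proof (rule continuous_on_coordinatewise_then_product)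
  fix i show "continuous_on S (\<lambda>t. (u(j := c + t)) i)"
    by (cases "i = j") (auto intro!: continuous_intros)
qed

lemma continuous_vec_shift:
  assumes "continuous_vec n f" "a \<in> carrier_vec n"
  shows "continuous_vec n (\<lambda>x. f (x + s \<cdot>\<^sub>v a))"
proof -
  have eq: "Matrix.vec n u + s \<cdot>\<^sub>v a = Matrix.vec n (\<lambda>i. u i + s * a $ i)" for u
    using assms(2) by (intro eq_vecI) auto
  have c: "continuous_on UNIV (\<lambda>u i. u i + s * a $ i)"
  proof (rule continuous_on_coordinatewise_then_product)
    fix i show "continuous_on UNIV (\<lambda>u :: nat \<Rightarrow> real. u i + s * a $ i)"
      by (intro continuous_on_add continuous_on_const continuous_on_product_coordinates)
  qed
  show ?thesis unfolding continuous_vec_def eq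
    by (rule continuous_on_compose2[OF assms(1)[unfolded continuous_vec_def] c]) simp
qed

lemma continuous_vec_sch:
  assumes "continuous_vec n f" "a \<in> carrier_vec n" "b \<in> carrier_vec n"
  shows "continuous_vec n (sch (a, b) s f)"
proof -
  have "continuous_on UNIV (\<lambda>u. scalar_prod (Matrix.vec n u) b)"
    using assms(3) unfolding scalar_prod_def
    by (auto intro!: continuous_intros continuous_on_product_coordinates)
  then have "continuous_vec n (\<lambda>x. ee (s\<^sup>2 * scalar_prod a b / 2 + s * scalar_prod x b) * f (x + s \<cdot>\<^sub>v a))"
    using continuous_vec_shift[OF assms(1,2), of s] unfolding continuous_vec_def
    by (intro continuous_intros) auto
  then show ?thesis by (subst continuous_vec_cong[OF sch_eq[OF assms(2,3)]])
qed

lemma rapid_sch: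
  assumes f: "schwartz n f" and a: "a \<in> carrier_vec n" and b: "b \<in> carrier_vec n" and s: "\<bar>s\<bar> \<le> 1"
  shows "rapid n (sch (a, b) s f)"
proof -
  obtain c where c: "\<And>x u. x \<in> carrier_vec n \<Longrightarrow> \<bar>u\<bar> \<le> 1 \<Longrightarrow> norm (f (x + u \<cdot>\<^sub>v a)) \<le> c / (1 + scalar_prod x x) ^ n"
    using schwartz_shift_bound[OF f a] by blast
  have "norm (sch (a, b) s f x) \<le> c / (1 + scalar_prod x x) ^ n" if "x \<in> carrier_vec n" for x
    unfolding sch_eq[OF a b that] norm_mult norm_ee using c[OF that s] by simp
  then show ?thesis using continuous_vec_sch[OF schwartz_continuous[OF f] a b] unfolding rapid_def by blast
qed

lemma N2_cong_ae: "ae_eq n f g \<Longrightarrow> N2 n f = N2 n g"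
  unfolding ae_eq_def N2_def by (rule nn_integral_cong_AE) (auto elim: eventually_mono)

lemma ae_eq_trans: "ae_eq n f g \<Longrightarrow> ae_eq n g h \<Longrightarrow> ae_eq n f h"
  unfolding ae_eq_def by (elim eventually_elim2) auto

text \<open>The action \<open>heis_act\<close> with the central coordinate, which it fixes, left
  out.\<close>

definition act :: "nat \<Rightarrow> real mat \<Rightarrow> real Matrix.vec \<times> real Matrix.vec \<Rightarrow> real Matrix.vec \<times> real Matrix.vec" where
  "act n k h = (let z = (fst h @\<^sub>v snd h) \<^sub>v* k in (vec_first z n, vec_last z n))"

lemma act_carrier:
  assumes "k \<in> carrier_mat (n + n) (n + n)" "act n k h = (a, b)"
  shows "a \<in> carrier_vec n" "b \<in> carrier_vec n"
  using assms by (auto simp: act_def Let_def)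

text \<open>The action is linear, hence carries a one-parameter group to a one-parameter
  group.\<close>

lemma heis_act_smult:
  assumes k: "k \<in> carrier_mat (n + n) (n + n)" and p: "p \<in> carrier_vec n" and q: "q \<in> carrier_vec n"
    and act: "act n k (p, q) = (a, b)"
  shows "heis_act n (s \<cdot>\<^sub>v p, s \<cdot>\<^sub>v q, 0) k = (s \<cdot>\<^sub>v a, s \<cdot>\<^sub>v b, 0)"
proof -
  have 1: "(s \<cdot>\<^sub>v p) @\<^sub>v (s \<cdot>\<^sub>v q) = s \<cdot>\<^sub>v (p @\<^sub>v q)" using p q by (intro eq_vecI) auto
  have pq: "p @\<^sub>v q \<in> carrier_vec (n + n)" using p q by auto
  have 2: "(s \<cdot>\<^sub>v (p @\<^sub>v q)) \<^sub>v* k = s \<cdot>\<^sub>v ((p @\<^sub>v q) \<^sub>v* k)"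
    unfolding row_mult_def using k pq by (intro mult_mat_vec[of _ "n + n" "n + n"]) auto
  have 3: "(p @\<^sub>v q) \<^sub>v* k \<in> carrier_vec (n + n)" using k pq by (auto simp: row_mult_def)
  have "vec_first (s \<cdot>\<^sub>v ((p @\<^sub>v q) \<^sub>v* k)) n = s \<cdot>\<^sub>v vec_first ((p @\<^sub>v q) \<^sub>v* k) n"
    using 3 by (intro eq_vecI) (auto simp: vec_first_def)
  moreover have "vec_last (s \<cdot>\<^sub>v ((p @\<^sub>v q) \<^sub>v* k)) n = s \<cdot>\<^sub>v vec_last ((p @\<^sub>v q) \<^sub>v* k) n"
    using 3 by (intro eq_vecI) (auto simp: vec_last_def)
  ultimately show ?thesis using act by (simp add: 1 2 act_def Let_def)
qed

lemma Sp_carrier: "k \<in> Sp n \<Longrightarrow> k \<in> carrier_mat (n + n) (n + n)"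
  by (simp add: Sp_def)

context segal_shale_weil
begin

lemma R_isometric_N2: "\<lbrakk>k \<in> Sp n; f \<in> L2 n\<rbrakk> \<Longrightarrow> N2 n (R k f) = N2 n f"
  by (simp add: N2_L2 in_L2 isometric)

text \<open>The difference quotients of \<open>R(k) f\<close> along \<open>h\<close> are the images of those of \<open>f\<close> along \<open>h\<^sup>k\<close>.\<close>

lemma R_difference:
  assumes k: "k \<in> Sp n" and f: "schwartz n f" and p: "p \<in> carrier_vec n" and q: "q \<in> carrier_vec n"
    and act: "act n k (p, q) = (a, b)" and s: "\<bar>s\<bar> \<le> 1"
  shows "N2 n (\<lambda>x. of_real (1 / s) * sch (p, q) s (R k f) x + of_real (- 1 / s) * R k f x - R k (gen n (a, b) f) x)
       = N2 n (\<lambda>x. of_real (1 / s) * sch (a, b) s f x + of_real (- 1 / s) * f x - gen n (a, b) f x)"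
proof -
  note kc = Sp_carrier[OF k]
  note ab = act_carrier[OF kc act]
  let ?A = "sch (a, b) s f" and ?g = "gen n (a, b) f"
  define B where "B = (\<lambda>x. of_real (1 / s) * ?A x + of_real (- 1 / s) * f x)"
  have rA: "rapid n ?A" by (rule rapid_sch[OF f ab s])
  have rf: "rapid n f" by (rule schwartz_rapid[OF f])
  have rg: "rapid n ?g" by (rule schwartz_rapid[OF schwartz_gen[OF f]])
  have rB: "rapid n B" unfolding B_def by (rule rapid_lincomb[OF rA rf])
  have "ae_eq n (R k (schroedinger (heis_act n (s \<cdot>\<^sub>v p, s \<cdot>\<^sub>v q, 0) k) f)) (schroedinger (s \<cdot>\<^sub>v p, s \<cdot>\<^sub>v q, 0) (R k f))"
    using p q by (intro intertwines[OF k _ rapid_L2[OF rf]]) (simp add: heisenberg_def)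
  then have 1: "ae_eq n (R k ?A) (sch (p, q) s (R k f))"
    unfolding heis_act_smult[OF kc p q act] by simp
  have 2: "ae_eq n (R k B) (\<lambda>x. of_real (1 / s) * R k ?A x + of_real (- 1 / s) * R k f x)"
    unfolding B_def by (intro linear k rapid_L2 rA rf)
  have 3: "ae_eq n (R k (\<lambda>x. 1 * B x + (-1) * ?g x)) (\<lambda>x. 1 * R k B x + (-1) * R k ?g x)"
    by (intro linear k rapid_L2 rB rg)
  have "ae_eq n (R k (\<lambda>x. 1 * B x + (-1) * ?g x))
     (\<lambda>x. of_real (1 / s) * sch (p, q) s (R k f) x + of_real (- 1 / s) * R k f x - R k ?g x)"
    using 1 2 3 unfolding ae_eq_def by eventually_elim simp
  then have "N2 n (\<lambda>x. of_real (1 / s) * sch (p, q) s (R k f) x + of_real (- 1 / s) * R k f x - R k ?g x)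
     = N2 n (R k (\<lambda>x. 1 * B x + (-1) * ?g x))" by (rule N2_cong_ae[symmetric])
  also have "\<dots> = N2 n (\<lambda>x. 1 * B x + (-1) * ?g x)"
    by (intro R_isometric_N2 k rapid_L2 rapid_lincomb rB rg)
  finally show ?thesis by (simp add: B_def)
qed

text \<open>The isometry moves the estimate from R(k) f, about whose smoothness nothing is known
  yet, to the Schwartz function f. There the Taylor remainder of order s^2, divided by s, has
  squared norm of order s^2.\<close>

lemma R_difference_bound:
  assumes k: "k \<in> Sp n" and f: "schwartz n f" and p: "p \<in> carrier_vec n" and q: "q \<in> carrier_vec n"
    and act: "act n k (p, q) = (a, b)"
  obtains C where "C \<ge> 0" "\<And>s. 0 < s \<Longrightarrow> s \<le> 1 \<Longrightarrow>
    N2 n (\<lambda>x. of_real (1 / s) * sch (p, q) s (R k f) x + of_real (- 1 / s) * R k f x - R k (gen n (a, b) f) x)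
      \<le> ennreal (s\<^sup>2 * C)"
proof -
  note ab = act_carrier[OF Sp_carrier[OF k] act]
  obtain c where c: "c \<ge> 0" "\<And>x s. x \<in> carrier_vec n \<Longrightarrow> \<bar>s\<bar> \<le> 1 \<Longrightarrow>
    norm (sch (a, b) s f x - f x - of_real s * gen n (a, b) f x) \<le> s\<^sup>2 * c / (1 + scalar_prod x x) ^ n"
    using sch_taylor[OF f ab] by blast
  obtain w where w: "w \<ge> 0" "weight_integral n = ennreal w"
    using weight_integral_finite[of n] by (metis ennreal_enn2real_if enn2real_nonneg infinity_ennreal_def order_less_irrefl)
  show ?thesis
  proof
    show "0 \<le> c\<^sup>2 * w" using w by simp
    fix s :: real assume s: "0 < s" "s \<le> 1"
    have "N2 n (\<lambda>x. of_real (1 / s) * sch (a, b) s f x + of_real (- 1 / s) * f x - gen n (a, b) f x) \<le> ennreal ((s * c)\<^sup>2) * weight_integral n"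
    proof (rule N2_bound)
      show "continuous_vec n (\<lambda>x. of_real (1 / s) * sch (a, b) s f x + of_real (- 1 / s) * f x - gen n (a, b) f x)"
        using continuous_vec_sch[OF schwartz_continuous[OF f] ab, of s] schwartz_continuous[OF f] schwartz_continuous[OF schwartz_gen[OF f]]
        unfolding continuous_vec_def by (intro continuous_intros)
      fix x :: "real Matrix.vec" assume x: "x \<in> carrier_vec n"
      have "of_real (1 / s) * sch (a, b) s f x + of_real (- 1 / s) * f x - gen n (a, b) f x
          = of_real (1 / s) * (sch (a, b) s f x - f x - of_real s * gen n (a, b) f x)"
        using s by (simp add: algebra_simps)
      also have "norm \<dots> \<le> 1 / s * (s\<^sup>2 * c / (1 + scalar_prod x x) ^ n)"
        unfolding norm_mult using c(2)[OF x, of s] s by (intro mult_mono) (auto simp: norm_divide)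
      finally show "norm (of_real (1 / s) * sch (a, b) s f x + of_real (- 1 / s) * f x - gen n (a, b) f x) \<le> s * c / (1 + scalar_prod x x) ^ n"
        using s by (simp add: power2_eq_square)
    qed
    also have "\<dots> = ennreal (s\<^sup>2 * (c\<^sup>2 * w))"
      unfolding w(2) using w(1) by (simp add: ennreal_mult[symmetric] power_mult_distrib mult.assoc)
    finally show "N2 n (\<lambda>x. of_real (1 / s) * sch (p, q) s (R k f) x + of_real (- 1 / s) * R k f x - R k (gen n (a, b) f) x)
      \<le> ennreal (s\<^sup>2 * (c\<^sup>2 * w))"
      using R_difference[OF k f p q act, of s] s by simp
  qed
qed

text \<open>The group generated by (0, e_j) multiplies by e(s x_j). Its difference quotients at R(k)
  f converge pointwise to the right side, and in L^2 to the left side, so the two agree.\<close>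

lemma R_position:
  assumes k: "k \<in> Sp n" and f: "schwartz n f" and j: "j < n" and x: "x \<in> carrier_vec n"
  shows "R k (gen n (act n k (0\<^sub>v n, unit_vec n j)) f) x = 2 * pi * \<i> * of_real (x $ j) * R k f x"
proof -
  obtain a b where act: "act n k (0\<^sub>v n, unit_vec n j) = (a, b)" by fastforce
  let ?F = "R k f" and ?G = "R k (gen n (a, b) f)"
  have cF: "continuous_vec n ?F" and cG: "continuous_vec n ?G"
    using continuous_rep[OF k] f schwartz_gen by auto
  obtain C where C: "C \<ge> 0" "\<And>s. 0 < s \<Longrightarrow> s \<le> 1 \<Longrightarrow>
    N2 n (\<lambda>x. of_real (1 / s) * sch (0\<^sub>v n, unit_vec n j) s ?F x + of_real (- 1 / s) * ?F x - ?G x) \<le> ennreal (s\<^sup>2 * C)"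
    by (rule R_difference_bound[OF k f _ _ act]) auto
  define HN where "HN = (\<lambda>N x. of_real (1 / (1 / real (Suc N))) * sch (0\<^sub>v n, unit_vec n j) (1 / real (Suc N)) ?F x
     + of_real (- 1 / (1 / real (Suc N))) * ?F x - ?G x)"
  have "2 * pi * \<i> * of_real (x $ j) * ?F x - ?G x = 0"
  proof (rule N2_fatou[where HN = HN and n = n])
    show "continuous_vec n (\<lambda>x. 2 * pi * \<i> * of_real (x $ j) * ?F x - ?G x)"
      using cF cG j unfolding continuous_vec_def
      by (intro continuous_intros) (auto intro!: continuous_intros continuous_on_product_coordinates)
    show "continuous_vec n (HN N)" for N
      using continuous_vec_sch[OF cF, of "0\<^sub>v n" "unit_vec n j" "1 / real (Suc N)"] cF cG
      unfolding HN_def continuous_vec_def by (intro continuous_intros) auto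
    show "(\<lambda>N. HN N x) \<longlonglongrightarrow> 2 * pi * \<i> * of_real (x $ j) * ?F x - ?G x" if x: "x \<in> carrier_vec n" for x
    proof -
      \<comment> \<open>With this z, multiplication by e(s x_j) is multiplication by exp(z s), and
        the limit sought is the derivative of that exponential at 0.\<close>
      define z where "z = 2 * pi * \<i> * complex_of_real (x $ j)"
      have "((\<lambda>h. exp (z * h)) has_field_derivative z) (at 0)" by (auto intro!: derivative_eq_intros)
      then have "((\<lambda>h. (exp (z * (0 + h)) - exp (z * 0)) / h) \<longlongrightarrow> z) (at 0)" by (rule DERIV_D)
      moreover have "filterlim (\<lambda>N. complex_of_real (1 / real (Suc N))) (at 0) sequentially"
        unfolding filterlim_at using LIMSEQ_inverse_real_of_nat[THEN tendsto_of_real[where 'a = complex]]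
        by (auto simp: inverse_eq_divide simp del: of_nat_Suc)
      ultimately have "(\<lambda>N. (exp (z * (0 + complex_of_real (1 / real (Suc N)))) - exp (z * 0)) / complex_of_real (1 / real (Suc N))) \<longlonglongrightarrow> z"
        by (rule filterlim_compose)
      then have "(\<lambda>N. (exp (z * (0 + complex_of_real (1 / real (Suc N)))) - exp (z * 0)) / complex_of_real (1 / real (Suc N)) * ?F x - ?G x) \<longlonglongrightarrow> z * ?F x - ?G x"
        by (intro tendsto_intros)
      moreover have "(exp (z * (0 + complex_of_real (1 / real (Suc N)))) - exp (z * 0)) / complex_of_real (1 / real (Suc N)) * ?F x - ?G x = HN N x" for N
      proof -
        have xz: "x + s \<cdot>\<^sub>v 0\<^sub>v n = x" for s :: real using x by (intro eq_vecI) auto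
        have "sch (0\<^sub>v n, unit_vec n j) s ?F x = exp (z * of_real s) * ?F x" for s
          using x j by (subst sch_eq) (auto simp: xz ee_def z_def scalar_prod_right_unit mult_ac)
        then show ?thesis unfolding HN_def by (simp add: algebra_simps)
      qed
      ultimately show ?thesis by (simp add: z_def)
    qed
    have "N2 n (HN N) \<le> ennreal ((1 / real (Suc N))\<^sup>2 * C)" for N
      unfolding HN_def by (rule C(2)) auto
    moreover have "(\<lambda>N. ennreal ((1 / real (Suc N))\<^sup>2 * C)) \<longlonglongrightarrow> ennreal (0\<^sup>2 * C)"
      by (intro tendsto_ennrealI tendsto_intros) (use LIMSEQ_inverse_real_of_nat in \<open>simp add: inverse_eq_divide\<close>)
    ultimately show "(\<lambda>N. N2 n (HN N)) \<longlonglongrightarrow> 0"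
      by (intro tendsto_sandwich[of "\<lambda>_. 0" "\<lambda>N. N2 n (HN N)" sequentially "\<lambda>N. ennreal ((1 / real (Suc N))\<^sup>2 * C)" 0]) auto
  qed (rule x)
  then show ?thesis by (simp add: act)
qed

text \<open>A single difference quotient of R(k) f has no evident pointwise limit. Added up along a
  grid from x to x + t e_j, the quotients telescope, and what remains is a Riemann sum of the
  expected derivative. The accumulated error tends to 0 in L^2, and both sides of the claim are
  continuous in x.\<close>

lemma R_translation_integral:
  assumes k: "k \<in> Sp n" and f: "schwartz n f" and j: "j < n" and x: "x \<in> carrier_vec n" and t: "0 < t" "t \<le> 2"
  shows "R k f (x + t \<cdot>\<^sub>v unit_vec n j) - R k f x
    = integral {0..t} (\<lambda>u. R k (gen n (act n k (unit_vec n j, 0\<^sub>v n)) f) (x + u \<cdot>\<^sub>v unit_vec n j))"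
proof -
  obtain a b where act: "act n k (unit_vec n j, 0\<^sub>v n) = (a, b)" by fastforce
  let ?F = "R k f" and ?G = "R k (gen n (a, b) f)" and ?e = "unit_vec n j"
  have cF: "continuous_vec n ?F" and cG: "continuous_vec n ?G"
    using continuous_rep[OF k] f schwartz_gen by auto
  obtain C where C: "C \<ge> 0" "\<And>s. 0 < s \<Longrightarrow> s \<le> 1 \<Longrightarrow>
    N2 n (\<lambda>x. of_real (1 / s) * sch (?e, 0\<^sub>v n) s ?F x + of_real (- 1 / s) * ?F x - ?G x) \<le> ennreal (s\<^sup>2 * C)"
    by (rule R_difference_bound[OF k f _ _ act]) auto
  have add: "(x + s \<cdot>\<^sub>v ?e) + r \<cdot>\<^sub>v ?e = x + (s + r) \<cdot>\<^sub>v ?e" if "x \<in> carrier_vec n" for x and s r :: real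
    using that by (intro eq_vecI) (auto simp: algebra_simps)
  define E where "E = (\<lambda>s x. of_real (1 / s) * ?F (x + s \<cdot>\<^sub>v ?e) + of_real (- 1 / s) * ?F x - ?G x)"
  have sch: "sch (?e, 0\<^sub>v n) s ?F x = ?F (x + s \<cdot>\<^sub>v ?e)" if "x \<in> carrier_vec n" for s x
    using that by (subst sch_eq) auto
  have E: "N2 n (E s) \<le> ennreal (s\<^sup>2 * C)" if "0 < s" "s \<le> 1" for s
  proof -
    have "N2 n (E s) = N2 n (\<lambda>x. of_real (1 / s) * sch (?e, 0\<^sub>v n) s ?F x + of_real (- 1 / s) * ?F x - ?G x)"
      unfolding N2_def by (intro nn_integral_cong) (simp only: E_def sch space_lborel_vec)
    then show ?thesis using C(2)[OF that] by simp
  qed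
  have cE: "continuous_vec n (E s)" for s
    using continuous_vec_shift[OF cF, of ?e s] cF cG unfolding E_def continuous_vec_def by (intro continuous_intros) auto
  define m where "m = (\<lambda>N :: nat. N + 2)"
  define h where "h = (\<lambda>N. t / real (m N))"
  \<comment> \<open>The sum of the errors E at the grid points, weighted by the mesh. It is at the
    same time the increment of R(k) f minus a Riemann sum, as \<open>HN\<close> below shows.\<close>
  define HN where "HN = (\<lambda>N x. \<Sum>i<m N. of_real (h N) * E (h N) (x + (real i * h N) \<cdot>\<^sub>v ?e))"
  have h: "0 < h N" "h N \<le> 1" "real (m N) * h N = t" for N using t by (auto simp: h_def m_def divide_simps)
  have HN: "HN N x = ?F (x + t \<cdot>\<^sub>v ?e) - ?F x - (\<Sum>i<m N. of_real (h N) * ?G (x + (real i * h N) \<cdot>\<^sub>v ?e))"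
    if x: "x \<in> carrier_vec n" for N x
  proof -
    have "of_real (h N) * E (h N) (x + (real i * h N) \<cdot>\<^sub>v ?e) =
       (?F (x + (real (Suc i) * h N) \<cdot>\<^sub>v ?e) - ?F (x + (real i * h N) \<cdot>\<^sub>v ?e)) - of_real (h N) * ?G (x + (real i * h N) \<cdot>\<^sub>v ?e)" for i
    proof -
      have "real i * h N + h N = real (Suc i) * h N" by (simp add: algebra_simps)
      then show ?thesis using h(1)[of N] unfolding E_def add[OF x] by (simp add: algebra_simps)
    qed
    then have "HN N x = (\<Sum>i<m N. ?F (x + (real (Suc i) * h N) \<cdot>\<^sub>v ?e) - ?F (x + (real i * h N) \<cdot>\<^sub>v ?e))
       - (\<Sum>i<m N. of_real (h N) * ?G (x + (real i * h N) \<cdot>\<^sub>v ?e))"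
      unfolding HN_def by (simp only: sum_subtractf)
    moreover have "x + (real 0 * h N) \<cdot>\<^sub>v ?e = x" using x by (intro eq_vecI) auto
    ultimately show ?thesis
      using sum_lessThan_telescope[of "\<lambda>i. ?F (x + (real i * h N) \<cdot>\<^sub>v ?e)" "m N"] h(3)[of N] by metis
  qed
  have "?F (x + t \<cdot>\<^sub>v ?e) - ?F x - integral {0..t} (\<lambda>u. ?G (x + u \<cdot>\<^sub>v ?e)) = 0"
  proof (rule N2_fatou[where HN = HN and n = n and x = x and
        H = "\<lambda>x. ?F (x + t \<cdot>\<^sub>v ?e) - ?F x - integral {0..t} (\<lambda>u. ?G (x + u \<cdot>\<^sub>v ?e))"])
    \<comment> \<open>Joint continuity in the base point and the length of the translation; it makes
      the integral a continuous function of the base point, as \<open>N2_fatou\<close> demands of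
      its limit.\<close>
    have upd: "continuous_on UNIV (\<lambda>z::(nat \<Rightarrow> real) \<times> real. (fst z)(j := fst z j + snd z))"
    proof (rule continuous_on_coordinatewise_then_product)
      fix i
      have c: "continuous_on UNIV (\<lambda>z::(nat \<Rightarrow> real) \<times> real. fst z i)" for i
        by (rule continuous_on_compose2[OF continuous_on_product_coordinates[of i], of UNIV fst])
           (auto intro: continuous_on_fst continuous_on_id)
      show "continuous_on UNIV (\<lambda>z::(nat \<Rightarrow> real) \<times> real. ((fst z)(j := fst z j + snd z)) i)"
        by (cases "i = j") (auto intro!: continuous_intros c)
    qed
    have "continuous_on (UNIV \<times> cbox 0 t) (\<lambda>(u, r). ?G (Matrix.vec n u + r \<cdot>\<^sub>v ?e))"
      unfolding vec_fun_upd[OF j] case_prod_unfold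
      by (rule continuous_on_compose2[OF cG[unfolded continuous_vec_def] continuous_on_subset[OF upd]]) auto
    from integral_continuous_on_param[OF this]
    show "continuous_vec n (\<lambda>x. ?F (x + t \<cdot>\<^sub>v ?e) - ?F x - integral {0..t} (\<lambda>u. ?G (x + u \<cdot>\<^sub>v ?e)))"
      using continuous_vec_shift[OF cF, of ?e t] cF unfolding continuous_vec_def
      by (intro continuous_intros) auto
    show "continuous_vec n (HN N)" for N
      unfolding HN_def continuous_vec_def
      by (intro continuous_intros continuous_vec_shift[OF cE, of ?e, unfolded continuous_vec_def]) auto
    show "(\<lambda>N. HN N x) \<longlonglongrightarrow> ?F (x + t \<cdot>\<^sub>v ?e) - ?F x - integral {0..t} (\<lambda>u. ?G (x + u \<cdot>\<^sub>v ?e))"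
      if x: "x \<in> carrier_vec n" for x
      unfolding HN[OF x] h_def m_def
    proof (intro tendsto_diff tendsto_const riemann_sum_tendsto)
      have "x + u \<cdot>\<^sub>v ?e = Matrix.vec n ((\<lambda>i. x $ i)(j := x $ j + u))" for u
        using vec_fun_upd[OF j, of "\<lambda>i. x $ i" u] x by (simp add: vec_of_carrier)
      moreover have "continuous_on {0..t} (\<lambda>u. (\<lambda>i. x $ i)(j := x $ j + u))"
        by (rule continuous_on_fun_upd_affine)
      ultimately show "continuous_on {0..t} (\<lambda>u. ?G (x + u \<cdot>\<^sub>v ?e))"
        using continuous_on_compose2[OF cG[unfolded continuous_vec_def], of "{0..t}" "\<lambda>u. (\<lambda>i. x $ i)(j := x $ j + u)"] by simp
    qed (use t in auto)
    have "N2 n (HN N) \<le> ennreal (t\<^sup>2 * ((h N)\<^sup>2 * C))" for N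
    proof -
      let ?M = "m N"
      have m: "(\<lambda>x. E (h N) (x + (real i * h N) \<cdot>\<^sub>v ?e)) \<in> borel_measurable (borel_vec n)" for i
        by (intro continuous_vec_measurable continuous_vec_shift cE) auto
      have mn: "(\<lambda>x. ennreal ((norm (E (h N) (x + (real i * h N) \<cdot>\<^sub>v ?e)))\<^sup>2)) \<in> borel_measurable (lborel_vec n)" for i
        using m[of i] by (simp add: measurable_cong_sets[OF sets_lborel_vec refl])
      have "N2 n (HN N) \<le> (\<integral>\<^sup>+x. ennreal (h N * t) * (\<Sum>i<?M. ennreal ((norm (E (h N) (x + (real i * h N) \<cdot>\<^sub>v ?e)))\<^sup>2)) \<partial>lborel_vec n)"
        unfolding N2_def
      proof (rule nn_integral_mono)
        fix x
        let ?v = "\<lambda>i. norm (E (h N) (x + (real i * h N) \<cdot>\<^sub>v ?e))"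
        have "norm (HN N x) \<le> h N * (\<Sum>i<?M. ?v i)"
          unfolding HN_def sum_distrib_left using h(1)[of N] by (intro order_trans[OF norm_sum] sum_mono) (simp add: norm_mult)
        from power_mono[OF this norm_ge_zero, of 2]
        have "(norm (HN N x))\<^sup>2 \<le> (h N)\<^sup>2 * (\<Sum>i<?M. 1 * ?v i)\<^sup>2"
          by (simp add: power_mult_distrib)
        \<comment> \<open>Cauchy-Schwarz over the grid costs a factor equal to the number of points,
          which one of the two factors h N turns into t.\<close>
        also have "\<dots> \<le> (h N)\<^sup>2 * ((\<Sum>i<?M. 1\<^sup>2) * (\<Sum>i<?M. (?v i)\<^sup>2))"
          by (intro mult_left_mono Cauchy_Schwarz_ineq_sum) auto
        also have "\<dots> = h N * t * (\<Sum>i<?M. (?v i)\<^sup>2)"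
          using h(3)[of N] by (simp add: power2_eq_square[of "h N"] mult_ac)
        finally have "ennreal ((norm (HN N x))\<^sup>2) \<le> ennreal (h N * t * (\<Sum>i<?M. (?v i)\<^sup>2))" by (rule ennreal_leI)
        also have "\<dots> = ennreal (h N * t) * (\<Sum>i<?M. ennreal ((?v i)\<^sup>2))"
          using h(1)[of N] t by (subst ennreal_mult) (auto intro!: sum_nonneg)
        finally show "ennreal ((norm (HN N x))\<^sup>2) \<le> ennreal (h N * t) * (\<Sum>i<?M. ennreal ((?v i)\<^sup>2))" .
      qed
      also have "\<dots> = ennreal (h N * t) * (\<Sum>i<?M. N2 n (\<lambda>x. E (h N) (x + (real i * h N) \<cdot>\<^sub>v ?e)))"
        unfolding N2_def
        by (subst nn_integral_cmult, intro borel_measurable_sum mn, subst nn_integral_sum, rule mn, rule refl)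
      also have "\<dots> = ennreal (h N * t) * (\<Sum>i<?M. N2 n (E (h N)))"
        by (simp add: N2_translate[OF continuous_vec_measurable[OF cE] j])
      also have "\<dots> \<le> ennreal (h N * t) * (\<Sum>i<?M. ennreal ((h N)\<^sup>2 * C))"
        by (intro mult_left_mono sum_mono E h) auto
      also have "\<dots> = ennreal (h N * t * (real ?M * ((h N)\<^sup>2 * C)))"
      proof -
        have nn: "0 \<le> h N" "0 \<le> t" "0 \<le> (h N)\<^sup>2 * C" using h(1)[of N] t C(1) by auto
        have "(\<Sum>i<?M. ennreal ((h N)\<^sup>2 * C)) = ennreal (real ?M * ((h N)\<^sup>2 * C))"
          using nn(3) by (subst sum_ennreal) auto
        then show ?thesis using nn by (simp only: ennreal_mult[symmetric] mult_nonneg_nonneg of_nat_0_le_iff)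
      qed
      also have "h N * t * (real ?M * ((h N)\<^sup>2 * C)) = t\<^sup>2 * ((h N)\<^sup>2 * C)"
      proof -
        have "h N * t * (real ?M * ((h N)\<^sup>2 * C)) = (real ?M * h N) * t * ((h N)\<^sup>2 * C)" by (simp only: mult_ac)
        then show ?thesis unfolding h(3) by (simp add: power2_eq_square)
      qed
      finally show ?thesis .
    qed
    moreover have "(\<lambda>N. ennreal (t\<^sup>2 * ((h N)\<^sup>2 * C))) \<longlonglongrightarrow> ennreal (t\<^sup>2 * (0\<^sup>2 * C))"
    proof -
      have "h \<longlonglongrightarrow> 0" unfolding h_def m_def
        by (rule tendsto_divide_0[OF tendsto_const]) (intro filterlim_at_top_imp_at_infinity filterlim_compose[OF filterlim_real_sequentially filterlim_add_const_nat_at_top])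
      then show ?thesis by (intro tendsto_ennrealI tendsto_intros)
    qed
    ultimately show "(\<lambda>N. N2 n (HN N)) \<longlonglongrightarrow> 0"
      by (intro tendsto_sandwich[of "\<lambda>_. 0" "\<lambda>N. N2 n (HN N)" sequentially "\<lambda>N. ennreal (t\<^sup>2 * ((h N)\<^sup>2 * C))" 0]) auto
  qed (rule x)
  then show ?thesis by (simp add: act)
qed

text \<open>The integral form exhibits R(k) f along a coordinate line as a primitive of a continuous
  function.\<close>

lemma R_derivative:
  assumes k: "k \<in> Sp n" and f: "schwartz n f" and j: "j < n"
  shows "((\<lambda>r. R k f (Matrix.vec n (u(j := r)))) has_vector_derivative
    R k (gen n (act n k (unit_vec n j, 0\<^sub>v n)) f) (Matrix.vec n (u(j := r)))) (at r)"
proof -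
  let ?F = "R k f" and ?G = "R k (gen n (act n k (unit_vec n j, 0\<^sub>v n)) f)"
  \<comment> \<open>The base point is moved back by 1, so that r corresponds to t = 1 inside {0..2}
    and the derivative is two-sided. This is the origin of the range t \<le> 2 above.\<close>
  let ?y = "\<lambda>t. Matrix.vec n (u(j := r - 1 + t))"
  have y: "?y 0 + t \<cdot>\<^sub>v unit_vec n j = ?y t" for t
    using vec_fun_upd[OF j, of "u(j := r - 1)" t] by simp
  have cG: "continuous_vec n ?G" using continuous_rep[OF k] f schwartz_gen by auto
  have "continuous_on {0..2} (\<lambda>t. u(j := r - 1 + t))"
    by (rule continuous_on_fun_upd_affine)
  then have cont: "continuous_on {0..2} (\<lambda>t. ?G (?y t))"
    by (rule continuous_on_compose2[OF cG[unfolded continuous_vec_def]]) auto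
  have eq: "?F (?y t) = ?F (?y 0) + integral {0..t} (\<lambda>t. ?G (?y t))" if "0 \<le> t" "t \<le> 2" for t
  proof (cases "t = 0")
    case False
    then show ?thesis using R_translation_integral[OF k f j, of "?y 0" t] that unfolding y by (simp add: algebra_simps)
  qed simp
  have "((\<lambda>t. integral {0..t} (\<lambda>t. ?G (?y t))) has_vector_derivative ?G (?y 1)) (at 1 within {0..2})"
    by (rule integral_has_vector_derivative[OF cont]) auto
  then have "((\<lambda>t. integral {0..t} (\<lambda>t. ?G (?y t))) has_vector_derivative ?G (?y 1)) (at 1)"
    by (simp add: at_within_Icc_at)
  then have "((\<lambda>t. ?F (?y 0) + integral {0..t} (\<lambda>t. ?G (?y t))) has_vector_derivative 0 + ?G (?y 1)) (at 1)"
    by (intro has_vector_derivative_add) auto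
  then have "((\<lambda>t. ?F (?y t)) has_vector_derivative 0 + ?G (?y 1)) (at 1)"
    by (rule has_vector_derivative_transform_within_open[where S = "{0<..<2}"]) (auto simp: eq)
  then have "(((\<lambda>t. ?F (?y t)) \<circ> (\<lambda>t. t - (r - 1))) has_vector_derivative 1 *\<^sub>R (0 + ?G (?y 1))) (at r)"
    by (intro vector_diff_chain_at) (auto intro!: derivative_eq_intros)
  then show ?thesis by (simp add: o_def)
qed

end

section \<open>Sobolev inequality and uniform decay\<close>

lemma norm_sq_has_vector_derivative:
  fixes F :: "real \<Rightarrow> complex"
  assumes "(F has_vector_derivative F') (at s)"
  shows "((\<lambda>s. (norm (F s))\<^sup>2) has_vector_derivative 2 * inner (F s) F') (at s)"
  using bounded_bilinear.has_vector_derivative[OF bounded_bilinear_inner assms assms]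
  by (simp add: power2_norm_eq_inner inner_commute)

text \<open>The squared modulus, times a weight that falls from 1 at r to 0 at r + 1, is integrated
  by parts over this interval of length 1; Cauchy-Schwarz bounds the derivative that
  appears.\<close>

lemma sobolev_line:
  fixes F F' :: "real \<Rightarrow> complex"
  assumes F: "\<And>s. (F has_vector_derivative F' s) (at s)" and F': "continuous_on UNIV F'"
  shows "ennreal ((norm (F r))\<^sup>2) \<le> 2 * (\<integral>\<^sup>+s. ennreal ((norm (F s))\<^sup>2) + ennreal ((norm (F' s))\<^sup>2) \<partial>lborel)"
proof -
  have cF: "continuous_on UNIV F"
    using F by (metis UNIV_I continuous_at_imp_continuous_on has_vector_derivative_continuous)
  \<comment> \<open>The weight r + 1 - s makes K vanish at r + 1 and equal the squared modulus of F
    at r, so that no boundary term other than the wanted one remains.\<close>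
  define K where "K = (\<lambda>s. (r + 1 - s) * (norm (F s))\<^sup>2)"
  define K' where "K' = (\<lambda>s. (r + 1 - s) * (2 * inner (F s) (F' s)) - (norm (F s))\<^sup>2)"
  define P where "P = (\<lambda>s. 2 * ((norm (F s))\<^sup>2 + (norm (F' s))\<^sup>2))"
  have K: "(K has_vector_derivative K' s) (at s within {r..r+1})" for s
  proof -
    have "((\<lambda>s. r + 1 - s) has_vector_derivative - 1) (at s)" by (auto intro!: derivative_eq_intros)
    from has_vector_derivative_mult[OF this norm_sq_has_vector_derivative[OF F]]
    have "(K has_vector_derivative K' s) (at s)" unfolding K_def K'_def by simp
    then show ?thesis by (rule has_vector_derivative_at_within)
  qed
  have "(K' has_integral (K (r + 1) - K r)) {r..r+1}"
    by (rule fundamental_theorem_of_calculus) (use K in auto)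
  then have 1: "((\<lambda>s. - K' s) has_integral (norm (F r))\<^sup>2) {r..r+1}"
    using has_integral_neg by (force simp: K_def)
  have cP: "continuous_on UNIV P" unfolding P_def using cF F' by (intro continuous_intros)
  then have Pb: "P \<in> borel_measurable borel" by (rule borel_measurable_continuous_onI)
  obtain I where I: "(P has_integral I) {r..r+1}"
    using integrable_continuous_real[OF continuous_on_subset[OF cP]] by blast
  have le: "- K' s \<le> P s" if "s \<in> {r..r+1}" for s
  proof -
    have "\<bar>inner (F s) (F' s)\<bar> \<le> norm (F s) * norm (F' s)" by (rule Cauchy_Schwarz_ineq2)
    also have "2 * \<dots> \<le> (norm (F s))\<^sup>2 + (norm (F' s))\<^sup>2"
      using sum_squares_bound[of "norm (F s)" "norm (F' s)"] by simp
    finally have "2 * \<bar>inner (F s) (F' s)\<bar> \<le> (norm (F s))\<^sup>2 + (norm (F' s))\<^sup>2" by simp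
    moreover have "\<bar>(r + 1 - s) * (2 * inner (F s) (F' s))\<bar> \<le> 1 * (2 * \<bar>inner (F s) (F' s)\<bar>)"
      unfolding abs_mult using that by (intro mult_mono) auto
    ultimately have "- K' s \<le> (norm (F s))\<^sup>2 + (norm (F' s))\<^sup>2 + (norm (F s))\<^sup>2" unfolding K'_def by linarith
    also have "\<dots> \<le> P s" by (simp add: P_def)
    finally show ?thesis .
  qed
  have I2: "(norm (F r))\<^sup>2 \<le> I" using has_integral_le[OF 1 I] le by simp
  have "ennreal ((norm (F r))\<^sup>2) \<le> ennreal I" using I2 by (rule ennreal_leI)
  also have "ennreal I = (\<integral>\<^sup>+s. ennreal (P s) * indicator {r..r+1} s \<partial>lborel)"
  proof -
    have "ennreal (indicator {r..r+1} s * P s) = ennreal (P s) * indicator {r..r+1} s" for s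
      by (auto simp: indicator_def)
    moreover have "0 \<le> P s" for s by (simp add: P_def)
    ultimately show ?thesis using nn_integral_has_integral_lebesgue[OF _ I] by simp
  qed
  also have "\<dots> \<le> (\<integral>\<^sup>+s. ennreal (P s) \<partial>lborel)" by (intro nn_integral_mono) (auto simp: indicator_def)
  also have "\<dots> = (\<integral>\<^sup>+s. 2 * (ennreal ((norm (F s))\<^sup>2) + ennreal ((norm (F' s))\<^sup>2)) \<partial>lborel)"
  proof (rule nn_integral_cong)
    fix s
    have "ennreal (P s) = ennreal 2 * ennreal ((norm (F s))\<^sup>2 + (norm (F' s))\<^sup>2)"
      unfolding P_def by (rule ennreal_mult) auto
    then show "ennreal (P s) = 2 * (ennreal ((norm (F s))\<^sup>2) + ennreal ((norm (F' s))\<^sup>2))"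
      by simp
  qed
  also have "\<dots> = 2 * (\<integral>\<^sup>+s. ennreal ((norm (F s))\<^sup>2) + ennreal ((norm (F' s))\<^sup>2) \<partial>lborel)"
  proof -
    have [measurable]: "F \<in> borel_measurable borel" "F' \<in> borel_measurable borel"
      using cF F' by (auto intro: borel_measurable_continuous_onI)
    show ?thesis by (rule nn_integral_cmult) measurable
  qed
  finally show ?thesis .
qed

lemma vec_overwrite_measurable:
  assumes "continuous_vec n f"
  shows "(\<lambda>v. f (Matrix.vec n (\<lambda>i. if i < m then v i else u i))) \<in> borel_measurable (Pi\<^sub>M {..<m} (\<lambda>_. lborel))"
proof -
  have "(\<lambda>v i. if i < m then v i else u i) \<in> borel_measurable (Pi\<^sub>M {..<m} (\<lambda>_. lborel :: real measure))"
  proof (rule measurable_coordinatewise_then_product)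
    fix i
    show "(\<lambda>v. if i < m then v i else u i) \<in> borel_measurable (Pi\<^sub>M {..<m} (\<lambda>_. lborel :: real measure))"
      using measurable_component_singleton[of i "{..<m}" "\<lambda>_. lborel :: real measure"] by (cases "i < m") auto
  qed
  then show ?thesis
    using assms unfolding continuous_vec_def by (rule measurable_compose[OF _ borel_measurable_continuous_onI])
qed

text \<open>The mixed derivatives in which each direction below m occurs at most once, a list of 2^m
  entries. The operators d are arbitrary because a derivative of R(k) f is R(k) of a generator
  applied to f.\<close>

primrec sobolev_words :: "(nat \<Rightarrow> 'a \<Rightarrow> 'a) \<Rightarrow> nat \<Rightarrow> 'a \<Rightarrow> 'a list" where
  "sobolev_words d 0 f = [f]"
| "sobolev_words d (Suc m) f = concat (map (\<lambda>g. [g, d m g]) (sobolev_words d m f))"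

lemma sum_list_sobolev_words_Suc:
  "(\<Sum>g\<leftarrow>sobolev_words d (Suc m) f. \<phi> g) = (\<Sum>g\<leftarrow>sobolev_words d m f. \<phi> g + (\<phi> (d m g) :: ennreal))"
proof -
  have "(\<Sum>g\<leftarrow>concat (map (\<lambda>g. [g, d m g]) gs). \<phi> g) = (\<Sum>g\<leftarrow>gs. \<phi> g + \<phi> (d m g))" for gs
    by (induction gs) (auto simp: add_ac)
  then show ?thesis by simp
qed

lemma length_sobolev_words: "length (sobolev_words d m f) = 2 ^ m"
proof -
  have "length (concat (map (\<lambda>g. [g, d m g]) gs)) = 2 * length gs" for m and gs :: "'a list"
    by (induction gs) auto
  then show ?thesis by (induction m) auto
qed

text \<open>A set of generators that does not depend on k yet contains the image under k of every
  basic one, as soon as the entries of k are at most 1 in absolute value.\<close>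

definition unit_box :: "nat \<Rightarrow> (real Matrix.vec \<times> real Matrix.vec) set" where
  "unit_box n = {(a, b). a \<in> carrier_vec n \<and> b \<in> carrier_vec n \<and> (\<forall>j<n. \<bar>a $ j\<bar> \<le> 1 \<and> \<bar>b $ j\<bar> \<le> 1)}"

lemma schwartz_fold_gen: "schwartz n f \<Longrightarrow> schwartz n (fold (gen n) hs f)"
  by (induction hs arbitrary: f) (auto intro: schwartz_gen)

context segal_shale_weil
begin

text \<open>The one-dimensional inequality is applied in one coordinate after another.
  Differentiating R(k) g in direction m gives R(k) (d m g), so every integrand remains the image
  under R(k) of a Schwartz function.\<close>

lemma sobolev_step:
  assumes k: "k \<in> Sp n" and f: "schwartz n f"
  defines "d \<equiv> \<lambda>j. gen n (act n k (unit_vec n j, 0\<^sub>v n))"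
  shows "m \<le> n \<Longrightarrow> ennreal ((norm (R k f (Matrix.vec n u)))\<^sup>2) \<le> 2 ^ m * (\<Sum>g\<leftarrow>sobolev_words d m f.
     \<integral>\<^sup>+v. ennreal ((norm (R k g (Matrix.vec n (\<lambda>i. if i < m then v i else u i))))\<^sup>2) \<partial>Pi\<^sub>M {..<m} (\<lambda>_. lborel))"
proof (induction m)
  interpret product_sigma_finite "\<lambda>_::nat. lborel :: real measure" by standard
  {
    case 0
    show ?case by (simp add: nn_integral_empty space_PiM_empty emeasure_PiM_empty)
  next
    case (Suc m)
    \<comment> \<open>Coordinates below m are integration variables; the others are still held at
      the point u where the supremum bound is wanted.\<close>
    let ?e = "\<lambda>m v i. if i < m then v i else u i :: real"
    let ?\<phi> = "\<lambda>m g. \<integral>\<^sup>+v. ennreal ((norm (R k g (Matrix.vec n (?e m v))))\<^sup>2) \<partial>Pi\<^sub>M {..<m} (\<lambda>_. lborel)"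
    have sch: "schwartz n g" if "g \<in> set (sobolev_words d m f)" for g m
      using that by (induction m arbitrary: g) (auto simp: f d_def intro: schwartz_gen)
    have step: "?\<phi> m g \<le> 2 * (?\<phi> (Suc m) g + ?\<phi> (Suc m) (d m g))" if g: "g \<in> set (sobolev_words d m f)" for g
    proof -
      note sg = sch[OF g]
      have sdg: "schwartz n (d m g)" unfolding d_def by (rule schwartz_gen[OF sg])
      have meas: "(\<lambda>v. ennreal ((norm (R k h (Matrix.vec n (?e (Suc m) v))))\<^sup>2)) \<in> borel_measurable (Pi\<^sub>M (insert m {..<m}) (\<lambda>_. lborel))"
        if "schwartz n h" for h
        using vec_overwrite_measurable[OF continuous_rep[OF k that], of "Suc m" u] unfolding lessThan_Suc by measurable
      have "?\<phi> m g \<le> (\<integral>\<^sup>+v. 2 * (\<integral>\<^sup>+y. ennreal ((norm (R k g (Matrix.vec n (?e (Suc m) (v(m := y))))))\<^sup>2)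
           + ennreal ((norm (R k (d m g) (Matrix.vec n (?e (Suc m) (v(m := y))))))\<^sup>2) \<partial>lborel) \<partial>Pi\<^sub>M {..<m} (\<lambda>_. lborel))"
      proof (rule nn_integral_mono)
        fix v
        have e: "?e (Suc m) (v(m := y)) = (?e m v)(m := y)" for y by (auto simp: less_Suc_eq)
        have "continuous_on UNIV (\<lambda>y. R k (d m g) (Matrix.vec n ((?e m v)(m := y))))"
          using continuous_on_fun_upd_affine[of UNIV "?e m v" m 0]
          by (intro continuous_on_compose2[OF continuous_rep[OF k sdg, unfolded continuous_vec_def]]) auto
        then have "ennreal ((norm (R k g (Matrix.vec n ((?e m v)(m := u m)))))\<^sup>2) \<le>
          2 * (\<integral>\<^sup>+y. ennreal ((norm (R k g (Matrix.vec n ((?e m v)(m := y)))))\<^sup>2)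
           + ennreal ((norm (R k (d m g) (Matrix.vec n ((?e m v)(m := y)))))\<^sup>2) \<partial>lborel)"
          unfolding d_def using Suc.prems by (intro sobolev_line R_derivative[OF k sg]) auto
        \<comment> \<open>The line inequality is read at the value u m of its own variable, which
          recovers the point of the previous stage.\<close>
        moreover have "(?e m v)(m := u m) = ?e m v" by auto
        ultimately show "ennreal ((norm (R k g (Matrix.vec n (?e m v))))\<^sup>2) \<le>
          2 * (\<integral>\<^sup>+y. ennreal ((norm (R k g (Matrix.vec n (?e (Suc m) (v(m := y))))))\<^sup>2)
           + ennreal ((norm (R k (d m g) (Matrix.vec n (?e (Suc m) (v(m := y))))))\<^sup>2) \<partial>lborel)"
          unfolding e by simp
      qed
      also have "\<dots> = 2 * (\<integral>\<^sup>+v. (\<integral>\<^sup>+y. ennreal ((norm (R k g (Matrix.vec n (?e (Suc m) (v(m := y))))))\<^sup>2)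
           + ennreal ((norm (R k (d m g) (Matrix.vec n (?e (Suc m) (v(m := y))))))\<^sup>2) \<partial>lborel) \<partial>Pi\<^sub>M {..<m} (\<lambda>_. lborel))"
      proof (rule nn_integral_cmult)
        let ?\<psi> = "\<lambda>v. ennreal ((norm (R k g (Matrix.vec n (?e (Suc m) v))))\<^sup>2) + ennreal ((norm (R k (d m g) (Matrix.vec n (?e (Suc m) v))))\<^sup>2)"
        have "?\<psi> \<in> borel_measurable (Pi\<^sub>M (insert m {..<m}) (\<lambda>_. lborel))"
          by (intro borel_measurable_add meas sg sdg)
        from measurable_compose[OF measurable_add_dim[unfolded case_prod_unfold] this]
        have "(\<lambda>(v, y). ?\<psi> (v(m := y))) \<in> borel_measurable (Pi\<^sub>M {..<m} (\<lambda>_. lborel) \<Otimes>\<^sub>M lborel)"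
          by (simp add: case_prod_unfold)
        then show "(\<lambda>v. \<integral>\<^sup>+y. ?\<psi> (v(m := y)) \<partial>lborel) \<in> borel_measurable (Pi\<^sub>M {..<m} (\<lambda>_. lborel))"
          by (rule sigma_finite_measure.borel_measurable_nn_integral[OF lborel.sigma_finite_measure_axioms])
      qed
      also have "\<dots> = 2 * (\<integral>\<^sup>+v. ennreal ((norm (R k g (Matrix.vec n (?e (Suc m) v))))\<^sup>2)
           + ennreal ((norm (R k (d m g) (Matrix.vec n (?e (Suc m) v))))\<^sup>2) \<partial>Pi\<^sub>M (insert m {..<m}) (\<lambda>_. lborel))"
        by (subst product_nn_integral_insert, simp, simp, intro borel_measurable_add meas sg sdg, rule refl)
      also have "\<dots> = 2 * (?\<phi> (Suc m) g + ?\<phi> (Suc m) (d m g))"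
        unfolding lessThan_Suc by (subst nn_integral_add, rule meas[OF sg], rule meas[OF sdg], rule refl)
      finally show ?thesis .
    qed
    have "ennreal ((norm (R k f (Matrix.vec n u)))\<^sup>2) \<le> 2 ^ m * (\<Sum>g\<leftarrow>sobolev_words d m f. ?\<phi> m g)"
      using Suc by simp
    also have "\<dots> \<le> 2 ^ m * (\<Sum>g\<leftarrow>sobolev_words d m f. 2 * (?\<phi> (Suc m) g + ?\<phi> (Suc m) (d m g)))"
      by (intro mult_left_mono sum_list_mono step) auto
    also have "\<dots> = 2 ^ Suc m * (\<Sum>g\<leftarrow>sobolev_words d (Suc m) f. ?\<phi> (Suc m) g)"
      unfolding sum_list_sobolev_words_Suc by (simp only: sum_list_const_mult power_Suc2 mult.assoc)
    finally show ?case .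
  }
qed

text \<open>With all coordinates integrated, the isometry removes R(k). The bound then depends on k
  only through the coefficients of the generators in the words.\<close>

lemma R_sup_bound:
  assumes k: "k \<in> Sp n" and f: "schwartz n f" and x: "x \<in> carrier_vec n"
  shows "ennreal ((norm (R k f x))\<^sup>2) \<le> 2 ^ n * (\<Sum>g\<leftarrow>sobolev_words (\<lambda>j. gen n (act n k (unit_vec n j, 0\<^sub>v n))) n f. N2 n g)"
proof -
  let ?d = "\<lambda>j. gen n (act n k (unit_vec n j, 0\<^sub>v n))"
  have sch: "schwartz n g" if "g \<in> set (sobolev_words ?d m f)" for g m
    using that by (induction m arbitrary: g) (auto simp: f intro: schwartz_gen)
  have "(\<integral>\<^sup>+v. ennreal ((norm (R k g (Matrix.vec n (\<lambda>i. if i < n then v i else x $ i))))\<^sup>2) \<partial>Pi\<^sub>M {..<n} (\<lambda>_. lborel)) = N2 n g"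
    if g: "g \<in> set (sobolev_words ?d n f)" for g
  proof -
    have eq: "Matrix.vec n (\<lambda>i. if i < n then v i else x $ i) = Matrix.vec n v" for v by (intro eq_vecI) auto
    show ?thesis unfolding eq
      using R_isometric_N2[OF k rapid_L2[OF schwartz_rapid[OF sch[OF g]]]]
        N2_eq_PiM[OF continuous_vec_measurable[OF continuous_rep[OF k sch[OF g]]]] by simp
  qed
  then have eq: "map (\<lambda>g. \<integral>\<^sup>+v. ennreal ((norm (R k g (Matrix.vec n (\<lambda>i. if i < n then v i else x $ i))))\<^sup>2) \<partial>Pi\<^sub>M {..<n} (\<lambda>_. lborel)) (sobolev_words ?d n f)
      = map (N2 n) (sobolev_words ?d n f)" by simp
  show ?thesis using sobolev_step[OF k f order_refl, of "\<lambda>i. x $ i"] unfolding eq vec_of_carrier[OF x] .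
qed

end

section \<open>Words in the generators: bounds uniform in the coefficients\<close>

lemma partials_lincomb:
  assumes "finite I" "\<And>i. i \<in> I \<Longrightarrow> schwartz n (G i)" "j < n" "x \<in> carrier_vec n"
  shows "partials n [j] (\<lambda>x. \<Sum>i\<in>I. c i * G i x) x = (\<Sum>i\<in>I. c i * partials n [j] (G i) x)"
proof -
  have "along n j (\<lambda>x. \<Sum>i\<in>I. c i * G i x) x = (\<lambda>s. \<Sum>i\<in>I. c i * along n j (G i) x s)"
    by (intro ext) (simp add: along_def)
  moreover have "((\<lambda>s. \<Sum>i\<in>I. c i * along n j (G i) x s) has_vector_derivative (\<Sum>i\<in>I. c i * partials n [j] (G i) x)) (at 0)"
    using assms by (intro has_vector_derivative_sum has_vector_derivative_mult_right along_has_vector_derivative) auto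
  ultimately show ?thesis by (simp add: vector_derivative_at)
qed

lemma gen_lincomb:
  assumes "finite I" "\<And>i. i \<in> I \<Longrightarrow> schwartz n (G i)" "x \<in> carrier_vec n"
  shows "gen n h (\<lambda>x. \<Sum>i\<in>I. c i * G i x) x = (\<Sum>i\<in>I. c i * gen n h (G i) x)"
proof -
  have "(\<Sum>j<n. of_real (fst h $ j) * partials n [j] (\<lambda>x. \<Sum>i\<in>I. c i * G i x) x)
     = (\<Sum>j<n. \<Sum>i\<in>I. of_real (fst h $ j) * (c i * partials n [j] (G i) x))"
    by (intro sum.cong refl) (simp add: partials_lincomb[OF assms(1,2) _ assms(3)] sum_distrib_left del: partials.simps)
  also have "\<dots> = (\<Sum>i\<in>I. c i * (\<Sum>j<n. of_real (fst h $ j) * partials n [j] (G i) x))"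
    by (subst sum.swap) (simp add: sum_distrib_left mult_ac del: partials.simps)
  finally have 1: "(\<Sum>j<n. of_real (fst h $ j) * partials n [j] (\<lambda>x. \<Sum>i\<in>I. c i * G i x) x)
     = (\<Sum>i\<in>I. c i * (\<Sum>j<n. of_real (fst h $ j) * partials n [j] (G i) x))" .
  have "(\<Sum>j<n. complex_of_real (snd h $ j) * (2 * pi * \<i> * (of_real (x $ j) * (\<Sum>i\<in>I. c i * G i x))))
    = (\<Sum>j<n. \<Sum>i\<in>I. complex_of_real (snd h $ j) * (2 * pi * \<i> * (of_real (x $ j) * (c i * G i x))))"
    by (simp add: sum_distrib_left)
  also have "\<dots> = (\<Sum>i\<in>I. c i * (\<Sum>j<n. of_real (snd h $ j) * (2 * pi * \<i> * (of_real (x $ j) * G i x))))"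
    by (subst sum.swap) (simp add: sum_distrib_left mult_ac)
  finally show ?thesis unfolding gen_def 1 by (simp add: sum.distrib distrib_left)
qed

lemma gen_cong:
  assumes "\<And>x. x \<in> carrier_vec n \<Longrightarrow> f x = g x" "x \<in> carrier_vec n"
  shows "gen n h f x = gen n h g x"
proof -
  have "along n j f x = along n j g x" for j
    using assms by (intro ext) (simp add: along_def)
  then show ?thesis using assms by (simp add: gen_def)
qed

lemma fold_gen_lincomb:
  assumes "finite I" "\<And>i. i \<in> I \<Longrightarrow> schwartz n (G i)"
    and "\<And>x. x \<in> carrier_vec n \<Longrightarrow> f x = (\<Sum>i\<in>I. c i * G i x)" and "x \<in> carrier_vec n"
  shows "fold (gen n) hs f x = (\<Sum>i\<in>I. c i * fold (gen n) hs (G i) x)"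
  using assms
proof (induction hs arbitrary: f G x)
  case Nil
  then show ?case by simp
next
  case (Cons h hs)
  have "gen n h f x = (\<Sum>i\<in>I. c i * gen n h (G i) x)" if x: "x \<in> carrier_vec n" for x
    using gen_cong[OF Cons.prems(3) x] gen_lincomb[OF Cons.prems(1,2) x] by simp
  then have "fold (gen n) hs (gen n h f) x = (\<Sum>i\<in>I. c i * fold (gen n) hs (gen n h (G i)) x)"
    using Cons.prems by (intro Cons.IH) (auto intro: schwartz_gen)
  then show ?case by simp
qed

lemma norm_sum_sq_le:
  fixes z :: "'a \<Rightarrow> complex"
  assumes "finite I" "\<And>i. i \<in> I \<Longrightarrow> norm (c i) \<le> (1::real)"
  shows "(norm (\<Sum>i\<in>I. (c i :: complex) * z i))\<^sup>2 \<le> real (card I) * (\<Sum>i\<in>I. (norm (z i))\<^sup>2)"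
proof -
  have "norm (\<Sum>i\<in>I. c i * z i) \<le> (\<Sum>i\<in>I. 1 * norm (z i))"
    using assms by (intro order_trans[OF norm_sum] sum_mono) (simp add: norm_mult mult_left_le_one_le)
  then have "(norm (\<Sum>i\<in>I. c i * z i))\<^sup>2 \<le> (\<Sum>i\<in>I. 1 * norm (z i))\<^sup>2" by (intro power_mono) auto
  also have "\<dots> \<le> (\<Sum>i\<in>I. 1\<^sup>2) * (\<Sum>i\<in>I. (norm (z i))\<^sup>2)" by (rule Cauchy_Schwarz_ineq_sum)
  finally show ?thesis by simp
qed

text \<open>The first letter of a word is a combination, with coefficients at most 1 in absolute
  value, of 2n fixed operators. It can therefore be traded for 2n fixed Schwartz functions, with f
  general in the induction.\<close>

lemma words_bound:
  assumes "schwartz n f"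
  shows "\<exists>C\<ge>0. \<forall>hs. length hs = m \<and> set hs \<subseteq> unit_box n \<longrightarrow> N2 n (fold (gen n) hs f) \<le> ennreal C"
  using assms
proof (induction m arbitrary: f)
  case 0
  have "N2 n f < \<infinity>" by (rule rapid_N2_finite[OF schwartz_rapid[OF 0]])
  then obtain C where "C \<ge> 0" "N2 n f = ennreal C"
    by (metis ennreal_enn2real_if enn2real_nonneg infinity_ennreal_def order_less_irrefl)
  then show ?case by auto
next
  case (Suc m)
  \<comment> \<open>The 2n basic operators applied to f: n partial derivatives, then n
    multiplications by 2 pi i x_j.\<close>
  define G where "G = (\<lambda>i. if i < n then partials n [i] f else (\<lambda>x. 2 * pi * \<i> * (complex_of_real (x $ (i - n)) * f x)))"
  have G: "schwartz n (G i)" if "i < n + n" for i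
    using that Suc.prems unfolding G_def by (auto intro!: schwartz_scale schwartz_mult_coord schwartz_partial simp del: partials.simps)
  have "\<forall>i\<in>{..<n + n}. \<exists>C\<ge>0. \<forall>hs. length hs = m \<and> set hs \<subseteq> unit_box n \<longrightarrow> N2 n (fold (gen n) hs (G i)) \<le> ennreal C"
    using Suc.IH G by auto
  then obtain C where C: "\<And>i. i < n + n \<Longrightarrow> C i \<ge> 0"
     "\<And>i hs. i < n + n \<Longrightarrow> length hs = m \<and> set hs \<subseteq> unit_box n \<Longrightarrow> N2 n (fold (gen n) hs (G i)) \<le> ennreal (C i)"
    by (metis lessThan_iff)
  show ?case
  proof (intro exI[of _ "real (n + n) * (\<Sum>i<n + n. C i)"] conjI allI impI)
    show "0 \<le> real (n + n) * (\<Sum>i<n + n. C i)" using C(1) by (intro mult_nonneg_nonneg sum_nonneg) auto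
    fix hs' assume hs': "length hs' = Suc m \<and> set hs' \<subseteq> unit_box n"
    then obtain h hs where hs: "hs' = h # hs" "length hs = m" "set hs \<subseteq> unit_box n" and h: "h \<in> unit_box n"
      by (cases hs') auto
    obtain a b where ab: "h = (a, b)" by fastforce
    define c where "c = (\<lambda>i. complex_of_real (if i < n then a $ i else b $ (i - n)))"
    have c: "norm (c i) \<le> 1" if "i \<in> {..<n + n}" for i using h that by (auto simp: c_def ab unit_box_def)
    have "gen n h f x = (\<Sum>i<n + n. c i * G i x)" for x
    proof -
      have *: "(\<Sum>i<n + k. q i) = (\<Sum>i<n. q i) + (\<Sum>i<k. q (n + i))" for q :: "nat \<Rightarrow> complex" and k
        by (induction k) (auto simp: add_ac)
      show ?thesis unfolding * by (simp add: gen_def ab c_def G_def del: partials.simps)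
    qed
    then have eq: "fold (gen n) hs' f x = (\<Sum>i<n + n. c i * fold (gen n) hs (G i) x)" if "x \<in> carrier_vec n" for x
      unfolding hs(1) using that G by (simp, intro fold_gen_lincomb) auto
    have meas: "(\<lambda>x. ennreal ((norm (fold (gen n) hs (G i) x))\<^sup>2)) \<in> borel_measurable (lborel_vec n)" if "i < n + n" for i
      using continuous_vec_measurable[OF schwartz_continuous[OF schwartz_fold_gen[OF G[OF that]]], of hs]
      by (simp add: measurable_cong_sets[OF sets_lborel_vec refl])
    have "N2 n (fold (gen n) hs' f) \<le> (\<integral>\<^sup>+x. ennreal (real (n + n)) * (\<Sum>i<n + n. ennreal ((norm (fold (gen n) hs (G i) x))\<^sup>2)) \<partial>lborel_vec n)"
      unfolding N2_def
    proof (rule nn_integral_mono)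
      fix x assume "x \<in> space (lborel_vec n)"
      then have x: "x \<in> carrier_vec n" by simp
      have "ennreal ((norm (fold (gen n) hs' f x))\<^sup>2) \<le> ennreal (real (n + n) * (\<Sum>i<n + n. (norm (fold (gen n) hs (G i) x))\<^sup>2))"
        unfolding eq[OF x] using norm_sum_sq_le[of "{..<n + n}" c "\<lambda>i. fold (gen n) hs (G i) x"] c by (intro ennreal_leI) auto
      then show "ennreal ((norm (fold (gen n) hs' f x))\<^sup>2) \<le> ennreal (real (n + n)) * (\<Sum>i<n + n. ennreal ((norm (fold (gen n) hs (G i) x))\<^sup>2))"
        by (subst (asm) ennreal_mult) (auto intro!: sum_nonneg)
    qed
    also have "\<dots> = ennreal (real (n + n)) * (\<Sum>i<n + n. N2 n (fold (gen n) hs (G i)))"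
      unfolding N2_def using meas
      by (subst nn_integral_cmult, intro borel_measurable_sum, simp, subst nn_integral_sum) auto
    also have "\<dots> \<le> ennreal (real (n + n)) * (\<Sum>i<n + n. ennreal (C i))"
      using hs by (intro mult_left_mono sum_mono C) auto
    also have "\<dots> = ennreal (real (n + n) * (\<Sum>i<n + n. C i))"
    proof -
      have "(\<Sum>i<n + n. ennreal (C i)) = ennreal (\<Sum>i<n + n. C i)" using C(1) by (intro sum_ennreal) auto
      moreover have "0 \<le> (\<Sum>i<n + n. C i)" using C(1) by (intro sum_nonneg) auto
      ultimately show ?thesis by (simp only: ennreal_mult[symmetric] of_nat_0_le_iff)
    qed
    finally show "N2 n (fold (gen n) hs' f) \<le> ennreal (real (n + n) * (\<Sum>i<n + n. C i))" .
  qed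
qed

lemma words_bound_le:
  assumes "schwartz n f"
  shows "\<exists>C\<ge>0. \<forall>hs. length hs \<le> m \<and> set hs \<subseteq> unit_box n \<longrightarrow> N2 n (fold (gen n) hs f) \<le> ennreal C"
proof -
  obtain C where C: "\<And>m. C m \<ge> 0" "\<And>m hs. length hs = m \<and> set hs \<subseteq> unit_box n \<Longrightarrow> N2 n (fold (gen n) hs f) \<le> ennreal (C m)"
    using words_bound[OF assms] by metis
  have "N2 n (fold (gen n) hs f) \<le> ennreal (\<Sum>i\<le>m. C i)" if "length hs \<le> m \<and> set hs \<subseteq> unit_box n" for hs
  proof -
    have "C (length hs) \<le> (\<Sum>i\<le>m. C i)" using that C(1) by (intro member_le_sum) auto
    then show ?thesis using C(2)[of hs "length hs"] that by (meson ennreal_leI order_trans)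
  qed
  then show ?thesis using C(1) by (intro exI[of _ "\<Sum>i\<le>m. C i"]) (auto intro: sum_nonneg)
qed

text \<open>Identifies the derivatives in the Sobolev bound with words of the kind bounded above;
  \<open>fold\<close> applies its first letter first, so a new derivative is appended at the end of
  the word.\<close>

lemma sobolev_words_fold_gen:
  assumes "g \<in> set (sobolev_words (\<lambda>j. gen n (\<kappa> j)) m f)" "m \<le> n" "\<And>j. j < n \<Longrightarrow> \<kappa> j \<in> unit_box n"
  shows "\<exists>hs. length hs \<le> m \<and> set hs \<subseteq> unit_box n \<and> g = fold (gen n) hs f"
  using assms
proof (induction m arbitrary: g)
  case 0
  then show ?case by (intro exI[of _ "[]"]) auto
next
  case (Suc m)
  then obtain g' where g': "g' \<in> set (sobolev_words (\<lambda>j. gen n (\<kappa> j)) m f)" "g = g' \<or> g = gen n (\<kappa> m) g'" by auto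
  then obtain hs where hs: "length hs \<le> m" "set hs \<subseteq> unit_box n" "g' = fold (gen n) hs f"
    using Suc.IH[OF g'(1)] Suc.prems by auto
  show ?case
  proof (cases "g = g'")
    case True
    then show ?thesis using hs by (intro exI[of _ hs]) auto
  next
    case False
    then show ?thesis using hs g'(2) Suc.prems by (intro exI[of _ "hs @ [\<kappa> m]"]) auto
  qed
qed

text \<open>Stands in for the image of U(n): all that the decay needs is the symplectic relation and
  entries bounded by 1, and every k(Q) has both.\<close>

definition Sp_unit :: "nat \<Rightarrow> real mat set" where
  "Sp_unit n = {k \<in> Sp n. \<forall>i<n + n. \<forall>j<n + n. \<bar>k $$ (i, j)\<bar> \<le> 1}"

text \<open>The image of a basis vector is a row of k.\<close>

lemma act_unit_box:
  assumes k: "k \<in> Sp_unit n" and j: "j < n"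
  shows "act n k (unit_vec n j, 0\<^sub>v n) \<in> unit_box n" "act n k (0\<^sub>v n, unit_vec n j) \<in> unit_box n"
proof -
  have kc: "k \<in> carrier_mat (n + n) (n + n)" and k1: "\<And>i j. i < n + n \<Longrightarrow> j < n + n \<Longrightarrow> \<bar>k $$ (i, j)\<bar> \<le> 1"
    using k by (auto simp: Sp_unit_def Sp_carrier)
  have "unit_vec (n + n) i \<^sub>v* k = row k i" if "i < n + n" for i
    using kc that by (intro eq_vecI) (auto simp: row_mult_def scalar_prod_right_unit)
  moreover have "unit_vec n j @\<^sub>v 0\<^sub>v n = (unit_vec (n + n) j :: real Matrix.vec)" "(0\<^sub>v n :: real Matrix.vec) @\<^sub>v unit_vec n j = unit_vec (n + n) (n + j)"
    using j by (auto intro!: eq_vecI simp: unit_vec_def)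
  ultimately show "act n k (unit_vec n j, 0\<^sub>v n) \<in> unit_box n" "act n k (0\<^sub>v n, unit_vec n j) \<in> unit_box n"
    using kc k1 j by (auto simp: act_def Let_def unit_box_def vec_first_def vec_last_def)
qed

text \<open>The sum is at most the number of terms times the largest one, whose power is one of the
  summands on the right.\<close>

lemma power_sum_le:
  assumes "finite I" "I \<noteq> {}" "\<And>i. i \<in> I \<Longrightarrow> (t i :: real) \<ge> 0"
  shows "(\<Sum>i\<in>I. t i) ^ M \<le> real (card I) ^ M * (\<Sum>i\<in>I. t i ^ M)"
proof -
  have "Max (t ` I) \<in> t ` I" using assms(1,2) by (intro Max_in) auto
  then obtain j where "j \<in> I" "Max (t ` I) = t j" by auto
  then have j: "j \<in> I" "\<And>i. i \<in> I \<Longrightarrow> t i \<le> t j"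
    using assms(1) by (auto simp flip: \<open>Max (t ` I) = t j\<close>)
  have "(\<Sum>i\<in>I. t i) \<le> real (card I) * t j" using sum_bounded_above[of I t "t j"] j(2) by simp
  then have "(\<Sum>i\<in>I. t i) ^ M \<le> (real (card I) * t j) ^ M" using assms(3) by (intro power_mono sum_nonneg) auto
  also have "\<dots> = real (card I) ^ M * t j ^ M" by (simp add: power_mult_distrib)
  also have "\<dots> \<le> real (card I) ^ M * (\<Sum>i\<in>I. t i ^ M)"
    using assms j by (intro mult_left_mono member_le_sum) auto
  finally show ?thesis .
qed

context segal_shale_weil
begin

text \<open>The Sobolev bound adds up to n letters to a word of length r, so words of length at most
  r + n have to be controlled.\<close>

lemma R_words_bound:
  assumes f: "schwartz n f"
  shows "\<exists>C\<ge>0. \<forall>hs k x. length hs = r \<and> set hs \<subseteq> unit_box n \<and> k \<in> Sp_unit n \<and> x \<in> carrier_vec n \<longrightarrow>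
    norm (R k (fold (gen n) hs f) x) \<le> C"
proof -
  obtain C where C: "C \<ge> 0" "\<And>hs. length hs \<le> r + n \<and> set hs \<subseteq> unit_box n \<Longrightarrow> N2 n (fold (gen n) hs f) \<le> ennreal C"
    using words_bound_le[OF f] by metis
  show ?thesis
  \<comment> \<open>One factor 2^n is the Sobolev constant, the other the number of words in its
    sum.\<close>
  proof (intro exI[of _ "sqrt (2 ^ n * (2 ^ n * C))"] conjI allI impI)
    show "0 \<le> sqrt (2 ^ n * (2 ^ n * C))" using C(1) by simp
    fix hs k and x :: "real Matrix.vec" assume "length hs = r \<and> set hs \<subseteq> unit_box n \<and> k \<in> Sp_unit n \<and> x \<in> carrier_vec n"
    then have hs: "length hs = r" "set hs \<subseteq> unit_box n" and k: "k \<in> Sp_unit n" and x: "x \<in> carrier_vec n" by auto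
    let ?f = "fold (gen n) hs f" and ?d = "\<lambda>j. gen n (act n k (unit_vec n j, 0\<^sub>v n))"
    have "N2 n g \<le> ennreal C" if g: "g \<in> set (sobolev_words ?d n ?f)" for g
    proof -
      obtain hs' where "length hs' \<le> n" "set hs' \<subseteq> unit_box n" "g = fold (gen n) hs' ?f"
        using sobolev_words_fold_gen[OF g] act_unit_box[OF k] by auto
      then have "g = fold (gen n) (hs @ hs') f" "length (hs @ hs') \<le> r + n" "set (hs @ hs') \<subseteq> unit_box n"
        using hs by auto
      then show ?thesis using C(2) by blast
    qed
    then have "(\<Sum>g\<leftarrow>sobolev_words ?d n ?f. N2 n g) \<le> (\<Sum>g\<leftarrow>sobolev_words ?d n ?f. ennreal C)"
      by (intro sum_list_mono) auto
    also have "\<dots> = 2 ^ n * ennreal C"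
      by (simp add: sum_list_triv length_sobolev_words)
    finally have "(\<Sum>g\<leftarrow>sobolev_words ?d n ?f. N2 n g) \<le> 2 ^ n * ennreal C" .
    then have "2 ^ n * (\<Sum>g\<leftarrow>sobolev_words ?d n ?f. N2 n g) \<le> 2 ^ n * (2 ^ n * ennreal C)"
      by (intro mult_left_mono) auto
    with R_sup_bound[OF _ schwartz_fold_gen[OF f] x, of k hs] k
    have "ennreal ((norm (R k ?f x))\<^sup>2) \<le> 2 ^ n * (2 ^ n * ennreal C)" by (auto simp: Sp_unit_def)
    also have "\<dots> = ennreal (2 ^ n * (2 ^ n * C))" using C(1) by (simp add: ennreal_mult ennreal_power[symmetric])
    finally have "(norm (R k ?f x))\<^sup>2 \<le> 2 ^ n * (2 ^ n * C)" using C(1) by (subst (asm) ennreal_le_iff) auto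
    then show "norm (R k ?f x) \<le> sqrt (2 ^ n * (2 ^ n * C))" by (simp add: real_le_rsqrt)
  qed
qed

lemma R_position_power:
  assumes "k \<in> Sp n" "schwartz n f" "j < n" "x \<in> carrier_vec n"
  shows "R k (fold (gen n) (replicate r (act n k (0\<^sub>v n, unit_vec n j))) f) x = (2 * pi * \<i> * of_real (x $ j)) ^ r * R k f x"
  using assms(2)
proof (induction r arbitrary: f)
  case (Suc r)
  then show ?case using assms by (simp add: R_position schwartz_gen)
qed simp

text \<open>By \<open>R_position\<close>, (2 pi i x_j)^(2M) R(k) f is R(k) of a word of length 2M
  applied to f, hence bounded uniformly in k and x. The 2M-th powers of the coordinates together
  with 1 control (1 + |x|^2)^M.\<close>

lemma R_uniform_decay:
  assumes f: "schwartz n f"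
  shows "\<exists>C\<ge>0. \<forall>k x. k \<in> Sp_unit n \<and> x \<in> carrier_vec n \<longrightarrow> (1 + scalar_prod x x) ^ M * norm (R k f x) \<le> C"
proof -
  obtain C0 where C0: "C0 \<ge> 0" "\<And>hs k x. length hs = 0 \<and> set hs \<subseteq> unit_box n \<and> k \<in> Sp_unit n \<and> x \<in> carrier_vec n \<Longrightarrow>
    norm (R k (fold (gen n) hs f) x) \<le> C0" using R_words_bound[OF f, of 0] by blast
  obtain C where C: "C \<ge> 0" "\<And>hs k x. length hs = 2 * M \<and> set hs \<subseteq> unit_box n \<and> k \<in> Sp_unit n \<and> x \<in> carrier_vec n \<Longrightarrow>
    norm (R k (fold (gen n) hs f) x) \<le> C" using R_words_bound[OF f, of "2 * M"] by blast
  show ?thesis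
  proof (intro exI[of _ "real (Suc n) ^ M * (real n * C + C0)"] conjI allI impI)
    show "0 \<le> real (Suc n) ^ M * (real n * C + C0)" using C(1) C0(1) by simp
    fix k and x :: "real Matrix.vec" assume "k \<in> Sp_unit n \<and> x \<in> carrier_vec n"
    then have k: "k \<in> Sp_unit n" and x: "x \<in> carrier_vec n" by auto
    have kS: "k \<in> Sp n" using k by (simp add: Sp_unit_def)
    have b0: "norm (R k f x) \<le> C0" using C0(2)[of "[]" k x] k x by simp
    have b: "(x $ j)\<^sup>2 ^ M * norm (R k f x) \<le> C" if j: "j < n" for j
    proof -
      have "norm (R k (fold (gen n) (replicate (2 * M) (act n k (0\<^sub>v n, unit_vec n j))) f) x) \<le> C"
        using act_unit_box(2)[OF k j] k x by (intro C(2)) auto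
      then have *: "(2 * pi * \<bar>x $ j\<bar>) ^ (2 * M) * norm (R k f x) \<le> C"
        unfolding R_position_power[OF kS f j x] by (simp add: norm_mult norm_power)
      have "(x $ j)\<^sup>2 ^ M = \<bar>x $ j\<bar> ^ (2 * M)" by (simp add: power_mult)
      also have "\<dots> \<le> (2 * pi * \<bar>x $ j\<bar>) ^ (2 * M)"
      proof (intro power_mono)
        have "1 * \<bar>x $ j\<bar> \<le> (2 * pi) * \<bar>x $ j\<bar>" using pi_gt3 by (intro mult_right_mono) auto
        then show "\<bar>x $ j\<bar> \<le> 2 * pi * \<bar>x $ j\<bar>" by simp
      qed auto
      finally have "(x $ j)\<^sup>2 ^ M * norm (R k f x) \<le> (2 * pi * \<bar>x $ j\<bar>) ^ (2 * M) * norm (R k f x)"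
        by (intro mult_right_mono) auto
      with * show ?thesis by linarith
    qed
    \<comment> \<open>The additional index n carries the summand 1 of 1 + |x|^2.\<close>
    define t where "t = (\<lambda>i. if i < n then (x $ i)\<^sup>2 else 1)"
    have eq: "1 + scalar_prod x x = (\<Sum>i\<in>{..<Suc n}. t i)"
      using x by (simp add: scalar_prod_self t_def)
    have "(\<Sum>i\<in>{..<Suc n}. t i) ^ M \<le> real (card {..<Suc n}) ^ M * (\<Sum>i\<in>{..<Suc n}. t i ^ M)"
      by (rule power_sum_le) (auto simp: t_def)
    then have "(1 + scalar_prod x x) ^ M \<le> real (Suc n) ^ M * (\<Sum>i\<in>{..<Suc n}. t i ^ M)"
      by (simp only: eq card_lessThan)
    then have "(1 + scalar_prod x x) ^ M * norm (R k f x) \<le> real (Suc n) ^ M * (\<Sum>i\<in>{..<Suc n}. t i ^ M) * norm (R k f x)"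
      by (rule mult_right_mono) simp
    also have "\<dots> = real (Suc n) ^ M * ((\<Sum>i<n. (x $ i)\<^sup>2 ^ M * norm (R k f x)) + norm (R k f x))"
      by (simp add: t_def sum_distrib_right distrib_right mult.assoc)
    also have "\<dots> \<le> real (Suc n) ^ M * ((\<Sum>i<n. C) + C0)"
      using b b0 by (intro mult_left_mono add_mono sum_mono) auto
    finally show "(1 + scalar_prod x x) ^ M * norm (R k f x) \<le> real (Suc n) ^ M * (real n * C + C0)" by simp
  qed
qed

end

section \<open>Matrices acting on row vectors\<close>

lemma mat_inverse_some:
  fixes A :: "real mat"
  assumes A: "A \<in> carrier_mat n n" and det: "Determinant.det A \<noteq> 0"
  obtains B where "mat_inverse A = Some B" "A * B = 1\<^sub>m n" "B * A = 1\<^sub>m n" "B \<in> carrier_mat n n"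
proof (cases "mat_inverse A")
  case None
  have "A \<in> Units (ring_mat TYPE(real) n ())" using A det by (rule det_non_zero_imp_unit)
  with mat_inverse(1)[OF A None, of "()"] show ?thesis by simp
next
  case (Some B)
  then show ?thesis using mat_inverse(2)[OF A Some] by (intro that[OF Some]) simp_all
qed

lemma mat_inv:
  assumes A: "A \<in> carrier_mat n n" and det: "Determinant.det A \<noteq> 0"
  shows "A * mat_inv A = 1\<^sub>m n" "mat_inv A * A = 1\<^sub>m n" "mat_inv A \<in> carrier_mat n n"
proof -
  obtain B where "mat_inverse A = Some B" "A * B = 1\<^sub>m n" "B * A = 1\<^sub>m n" "B \<in> carrier_mat n n"
    by (rule mat_inverse_some[OF A det])
  then show "A * mat_inv A = 1\<^sub>m n" "mat_inv A * A = 1\<^sub>m n" "mat_inv A \<in> carrier_mat n n"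
    by (simp_all add: mat_inv_def)
qed

lemma mat_inv_unique:
  assumes A: "A \<in> carrier_mat n n" and B: "B \<in> carrier_mat n n" and AB: "A * B = 1\<^sub>m n"
  shows "mat_inv A = B"
proof -
  have "Determinant.det A * Determinant.det B = 1" using det_mult[OF A B] AB by simp
  then have d: "Determinant.det A \<noteq> 0" by auto
  have "mat_inv A = mat_inv A * (A * B)" using AB mat_inv(3)[OF A d] by simp
  also have "\<dots> = B" using mat_inv[OF A d] A B by (simp flip: assoc_mult_mat[of _ n n _ n _ n])
  finally show ?thesis .
qed

lemma row_mult_carrier [simp]: "A \<in> carrier_mat m n \<Longrightarrow> x \<^sub>v* A \<in> carrier_vec n"
  by (intro carrier_vecI) (simp add: row_mult_def)

lemma dim_row_mult [simp]: "dim_vec (x \<^sub>v* A) = dim_col A"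
  by (simp add: row_mult_def)

lemma row_mult_index:
  assumes "x \<in> carrier_vec m" "A \<in> carrier_mat m n" "j < n"
  shows "(x \<^sub>v* A) $ j = (\<Sum>i<m. x $ i * A $$ (i, j))"
  using assms by (simp add: row_mult_def scalar_prod_def lessThan_atLeast0 mult.commute)

lemma row_mult_assoc:
  assumes "x \<in> carrier_vec m" "A \<in> carrier_mat m n" "B \<in> carrier_mat n k"
  shows "x \<^sub>v* (A * B) = (x \<^sub>v* A) \<^sub>v* B"
  using assms unfolding row_mult_def
  by (subst transpose_mult[of _ m n _ k]) (auto intro!: assoc_mult_mat_vec[of _ k n _ m])

lemma row_mult_add:
  assumes "x \<in> carrier_vec m" "y \<in> carrier_vec m" "A \<in> carrier_mat m n"
  shows "(x + y) \<^sub>v* A = x \<^sub>v* A + y \<^sub>v* A"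
  using assms unfolding row_mult_def by (intro mult_add_distrib_mat_vec[of _ n m]) auto

lemma row_mult_add_mat:
  assumes "x \<in> carrier_vec m" "A \<in> carrier_mat m n" "B \<in> carrier_mat m n"
  shows "x \<^sub>v* (A + B) = x \<^sub>v* A + x \<^sub>v* B"
  using assms unfolding row_mult_def
  by (simp add: transpose_add add_mult_distrib_mat_vec[of _ n m])

lemma row_mult_one [simp]: "x \<in> carrier_vec n \<Longrightarrow> x \<^sub>v* 1\<^sub>m n = x"
  by (simp add: row_mult_def)

lemma row_mult_zero_mat [simp]: "x \<in> carrier_vec m \<Longrightarrow> x \<^sub>v* 0\<^sub>m m n = 0\<^sub>v n"
  by (auto simp: row_mult_def scalar_prod_def)

lemma zero_row_mult [simp]: "A \<in> carrier_mat m n \<Longrightarrow> 0\<^sub>v m \<^sub>v* A = 0\<^sub>v n"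
  by (auto simp: row_mult_def scalar_prod_def)

lemma scalar_prod_row_mult:
  assumes "x \<in> carrier_vec m" "A \<in> carrier_mat m n" "y \<in> carrier_vec n"
  shows "scalar_prod (x \<^sub>v* A) y = scalar_prod x (y \<^sub>v* transpose_mat A)"
proof -
  have "scalar_prod (x \<^sub>v* A) y = (\<Sum>j<n. \<Sum>i<m. x $ i * A $$ (i, j) * y $ j)"
    using assms by (simp add: scalar_prod_def row_mult_index[of x m A n] sum_distrib_right lessThan_atLeast0)
  also have "\<dots> = (\<Sum>i<m. \<Sum>j<n. x $ i * A $$ (i, j) * y $ j)" by (rule sum.swap)
  also have "\<dots> = scalar_prod x (y \<^sub>v* transpose_mat A)"
    using assms by (simp add: scalar_prod_def row_mult_index[of y n "transpose_mat A" m] sum_distrib_left lessThan_atLeast0 mult_ac)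
  finally show ?thesis .
qed

lemma row_mult_four_block:
  assumes "A \<in> carrier_mat m1 n1" "B \<in> carrier_mat m1 n2" "C \<in> carrier_mat m2 n1" "D \<in> carrier_mat m2 n2"
    and "x \<in> carrier_vec m1" "y \<in> carrier_vec m2"
  shows "(x @\<^sub>v y) \<^sub>v* four_block_mat A B C D = (x \<^sub>v* A + y \<^sub>v* C) @\<^sub>v (x \<^sub>v* B + y \<^sub>v* D)"
  unfolding row_mult_def transpose_four_block_mat[OF assms(1-4)]
  using assms by (intro four_block_mat_mult_vec) auto

lemma row_mult_blk_diag:
  assumes "A \<in> carrier_mat m1 n1" "D \<in> carrier_mat m2 n2" "x \<in> carrier_vec m1" "y \<in> carrier_vec m2"
  shows "(x @\<^sub>v y) \<^sub>v* blk_diag A D = (x \<^sub>v* A) @\<^sub>v (y \<^sub>v* D)"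
proof -
  have "(x @\<^sub>v y) \<^sub>v* blk_diag A D = (x \<^sub>v* A + y \<^sub>v* 0\<^sub>m m2 n1) @\<^sub>v (x \<^sub>v* 0\<^sub>m m1 n2 + y \<^sub>v* D)"
    using row_mult_four_block[of A m1 n1 "0\<^sub>m m1 n2" n2 "0\<^sub>m m2 n1" m2 D x y] assms by (auto simp: blk_diag_def)
  then show ?thesis using assms by simp
qed

lemma blk_diag_carrier [simp]:
  "A \<in> carrier_mat m1 n1 \<Longrightarrow> B \<in> carrier_mat m2 n2 \<Longrightarrow> blk_diag A B \<in> carrier_mat (m1 + m2) (n1 + n2)"
  by (auto simp: blk_diag_def)

lemma scalar_prod_four_append:
  assumes "x1 \<in> carrier_vec m" "y1 \<in> carrier_vec m" "x2 \<in> carrier_vec k" "y2 \<in> carrier_vec k"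
  shows "scalar_prod (x1 @\<^sub>v x2) (y1 @\<^sub>v y2) = scalar_prod x1 y1 + scalar_prod x2 (y2 :: real Matrix.vec)"
  using assms by (intro scalar_prod_append)

lemma vec_first_append [simp]: "x \<in> carrier_vec m \<Longrightarrow> vec_first (x @\<^sub>v y) m = x"
  by (intro eq_vecI) (auto simp: vec_first_def)

lemma vec_last_append [simp]: "y \<in> carrier_vec k \<Longrightarrow> vec_last (x @\<^sub>v y) k = y"
  by (intro eq_vecI) (auto simp: vec_last_def)

text \<open>Only the lower right block is compared: in the Iwasawa coordinates of g, that block of g
  g^T is the inverse of Y.\<close>

lemma four_block_mat_inject:
  assumes "four_block_mat A B C D = four_block_mat A' B' C' D'"
    and "A \<in> carrier_mat m1 n1" "B \<in> carrier_mat m1 n2" "C \<in> carrier_mat m2 n1" "D \<in> carrier_mat m2 n2"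
    and "A' \<in> carrier_mat m1 n1" "B' \<in> carrier_mat m1 n2" "C' \<in> carrier_mat m2 n1" "D' \<in> carrier_mat m2 n2"
  shows "D = D'"
proof (rule eq_matI)
  fix i j assume "i < dim_row D'" "j < dim_col D'"
  then have "four_block_mat A B C D $$ (m1 + i, n1 + j) = D $$ (i, j)" "four_block_mat A' B' C' D' $$ (m1 + i, n1 + j) = D' $$ (i, j)"
    using assms(2-9) by auto
  then show "D $$ (i, j) = D' $$ (i, j)" using assms(1) by simp
qed (use assms(2-9) in auto)

section \<open>Unitary matrices and triangular square roots\<close>

lemma mult_adjoint_index:
  fixes Q :: "complex mat"
  assumes Q: "Q \<in> carrier_mat n n" and i: "i < n" and j: "j < n"
  shows "(Q * mat_adjoint Q) $$ (i, j) = (\<Sum>k<n. Q $$ (i, k) * cnj (Q $$ (j, k)))"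
proof -
  have a: "mat_adjoint Q $$ (k, j) = cnj (Q $$ (j, k))" if "k < n" for k
  proof -
    have "mat_adjoint Q $$ (k, j) = map conjugate (cols Q) ! k $ j"
      unfolding mat_adjoint_def using Q that j by (intro mat_of_rows_index) auto
    also have "\<dots> = cnj (Q $$ (j, k))" using Q that j by auto
    finally show ?thesis .
  qed
  have d: "mat_adjoint Q \<in> carrier_mat n n" unfolding mat_adjoint_def
    by (intro carrier_matI) (use Q in auto)
  have "(Q * mat_adjoint Q) $$ (i, j) = (\<Sum>k<n. Q $$ (i, k) * mat_adjoint Q $$ (k, j))"
    using Q d i j by (simp add: scalar_prod_def lessThan_atLeast0)
  then show ?thesis using a by simp
qed

lemma unitary_entries:
  assumes Q: "Q \<in> unitary_mats n" and i: "i < n" and j: "j < n"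
  shows "(\<Sum>k<n. Q $$ (i, k) * cnj (Q $$ (j, k))) = (if i = j then 1 else 0)"
proof -
  have Qc: "Q \<in> carrier_mat n n" and QQ: "Q * mat_adjoint Q = 1\<^sub>m n" using Q by (auto simp: unitary_mats_def)
  show ?thesis using mult_adjoint_index[OF Qc i j] QQ i j by simp
qed

lemma unitary_real_imag:
  assumes Q: "Q \<in> unitary_mats n"
  defines "A \<equiv> map_mat Re Q" and "B \<equiv> map_mat Im Q"
  shows "A * transpose_mat A + B * transpose_mat B = 1\<^sub>m n" "B * transpose_mat A = A * transpose_mat B"
proof -
  have Qc: "Q \<in> carrier_mat n n" using Q by (auto simp: unitary_mats_def)
  show "A * transpose_mat A + B * transpose_mat B = 1\<^sub>m n"
  proof (rule eq_matI)
    fix i j assume ij: "i < dim_row (1\<^sub>m n :: real mat)" "j < dim_col (1\<^sub>m n :: real mat)"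
    then show "(A * transpose_mat A + B * transpose_mat B) $$ (i, j) = 1\<^sub>m n $$ (i, j)"
      using arg_cong[OF unitary_entries[OF Q, of i j], of Re] Qc
      by (simp add: A_def B_def scalar_prod_def lessThan_atLeast0 sum.distrib split: if_splits)
  qed (use Qc in \<open>auto simp: A_def B_def\<close>)
  show "B * transpose_mat A = A * transpose_mat B"
  proof (rule eq_matI)
    fix i j assume ij: "i < dim_row (A * transpose_mat B)" "j < dim_col (A * transpose_mat B)"
    then show "(B * transpose_mat A) $$ (i, j) = (A * transpose_mat B) $$ (i, j)"
      using arg_cong[OF unitary_entries[OF Q, of i j], of Im] Qc
      by (simp add: A_def B_def scalar_prod_def lessThan_atLeast0 sum.distrib sum_subtractf split: if_splits)
  qed (use Qc in \<open>auto simp: A_def B_def\<close>)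
qed

lemma uminus_mult_uminus_mat:
  assumes "A \<in> carrier_mat n m" "B \<in> carrier_mat m k" shows "- A * - B = A * (B :: real mat)"
  using assms by (intro eq_matI) (auto simp: scalar_prod_def)

lemma transpose_uminus_mat: "transpose_mat (- A) = - transpose_mat (A :: real mat)"
  by (intro eq_matI) auto

text \<open>With Q = A + iB, unitarity says A A^T + B B^T = 1 and B A^T = A B^T. These two relations
  make k(Q) symplectic and orthogonal at once. The entries are bounded because every row of Q has
  norm 1.\<close>

lemma k_mat_props:
  assumes Q: "Q \<in> unitary_mats n"
  shows "k_mat Q \<in> Sp n" "k_mat Q * transpose_mat (k_mat Q) = 1\<^sub>m (n + n)"
    "\<And>i j. i < n + n \<Longrightarrow> j < n + n \<Longrightarrow> \<bar>k_mat Q $$ (i, j)\<bar> \<le> 1"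
proof -
  have Qc: "Q \<in> carrier_mat n n" using Q by (auto simp: unitary_mats_def)
  define A where "A = map_mat Re Q"
  define B where "B = map_mat Im Q"
  have A: "A \<in> carrier_mat n n" and B: "B \<in> carrier_mat n n" using Qc by (auto simp: A_def B_def)
  have e1: "A * transpose_mat A + B * transpose_mat B = 1\<^sub>m n" and e2: "B * transpose_mat A = A * transpose_mat B"
    using unitary_real_imag[OF Q] by (auto simp: A_def B_def)
  have k: "k_mat Q = four_block_mat A (- B) B A" by (simp add: k_mat_def A_def B_def)
  have kt: "transpose_mat (k_mat Q) = four_block_mat (transpose_mat A) (transpose_mat B) (- transpose_mat B) (transpose_mat A)"
    unfolding k using A B by (subst transpose_four_block_mat[of _ n n _ n _ n]) (auto simp: transpose_uminus_mat)
  have e3: "B * transpose_mat B + A * transpose_mat A = 1\<^sub>m n"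
    using e1 A B by (metis comm_add_mat mult_carrier_mat transpose_carrier_mat)
  have one: "four_block_mat (1\<^sub>m n) (0\<^sub>m n n) (0\<^sub>m n n) (1\<^sub>m n) = (1\<^sub>m (n + n) :: real mat)" by (intro eq_matI) auto
  have AA: "A * transpose_mat A \<in> carrier_mat n n" and BB: "B * transpose_mat B \<in> carrier_mat n n"
    and AB: "A * transpose_mat B \<in> carrier_mat n n" using A B by auto
  have mB: "- B \<in> carrier_mat n n" and At: "transpose_mat A \<in> carrier_mat n n" and Bt: "transpose_mat B \<in> carrier_mat n n"
    and mBt: "- transpose_mat B \<in> carrier_mat n n" using A B by auto
  have canc: "X + - X = 0\<^sub>m n n" "- X + X = 0\<^sub>m n n" if "X \<in> carrier_mat n n" for X :: "real mat"
    using that by (auto intro!: eq_matI)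
  have neg: "- B * transpose_mat A = - (A * transpose_mat B)" "A * - transpose_mat B = - (A * transpose_mat B)"
    "- B * transpose_mat B = - (B * transpose_mat B)" "B * - transpose_mat B = - (B * transpose_mat B)"
    "- B * - transpose_mat B = B * transpose_mat B" "- A * transpose_mat A = - (A * transpose_mat A)" "- A * transpose_mat B = - (A * transpose_mat B)"
    using A B e2 by (auto simp: uminus_mult_uminus_mat[of _ n n _ n])
  show "k_mat Q * transpose_mat (k_mat Q) = 1\<^sub>m (n + n)"
    unfolding kt unfolding k mult_four_block_mat[OF A mB B A At Bt mBt At] neg e1 e2 e3 canc[OF AB] one ..
  have kJ: "k_mat Q * symp_form n = four_block_mat B A (- A) B"
    unfolding k symp_form_def using A B
    by (subst mult_four_block_mat[of _ n n _ n _ n _ _ n _ n]) (auto simp: uminus_mult_uminus_mat[of _ n n _ n])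
  have "k_mat Q * symp_form n * transpose_mat (k_mat Q) = symp_form n"
  proof -
    have mA: "- A \<in> carrier_mat n n" using A by auto
    have s: "- (A * transpose_mat A) + - (B * transpose_mat B) = - (1\<^sub>m n)"
    proof -
      have "- X + - Y = - (X + Y)" if "X \<in> carrier_mat n n" "Y \<in> carrier_mat n n" for X Y :: "real mat"
        using that by (intro eq_matI) auto
      from this[OF AA BB] show ?thesis unfolding e1 .
    qed
    show ?thesis
      unfolding kJ kt mult_four_block_mat[OF B A mA B At Bt mBt At] neg e1 e2 e3 canc[OF AB] s
      unfolding symp_form_def ..
  qed
  then show "k_mat Q \<in> Sp n" using A B k by (auto simp: Sp_def)
  have b: "norm (Q $$ (i, j)) \<le> 1" if "i < n" "j < n" for i j
  proof -
    have "complex_of_real (\<Sum>k<n. (norm (Q $$ (i, k)))\<^sup>2) = 1"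
      using unitary_entries[OF Q that(1) that(1)] by (simp only: of_real_sum complex_norm_square if_True refl)
    then have "(\<Sum>k<n. (norm (Q $$ (i, k)))\<^sup>2) = 1" by (metis of_real_eq_1_iff)
    moreover have "(norm (Q $$ (i, j)))\<^sup>2 \<le> (\<Sum>k<n. (norm (Q $$ (i, k)))\<^sup>2)"
      using that by (intro member_le_sum) auto
    ultimately show ?thesis by (metis abs_norm_cancel abs_square_le_1)
  qed
  show "\<bar>k_mat Q $$ (i, j)\<bar> \<le> 1" if "i < n + n" "j < n + n" for i j
  proof -
    have "\<bar>Re (Q $$ (i, j))\<bar> \<le> 1" "\<bar>Im (Q $$ (i, j))\<bar> \<le> 1" if "i < n" "j < n" for i j
      using b[OF that] abs_Re_le_cmod[of "Q $$ (i, j)"] abs_Im_le_cmod[of "Q $$ (i, j)"] by linarith+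
    then show ?thesis using that Qc by (auto simp: k_mat_def)
  qed
qed

lemma det_triangular_pos:
  assumes "Z \<in> carrier_mat n n" "upper_triangular Z" "\<And>i. i < n \<Longrightarrow> (Z $$ (i, i) :: real) > 0"
  shows "Determinant.det Z > 0" "Determinant.det Z = (\<Prod>i<n. Z $$ (i, i))"
proof -
  have "Determinant.det Z = prod_list (diag_mat Z)" using assms by (intro det_upper_triangular)
  also have "\<dots> = (\<Prod>i<n. Z $$ (i, i))"
    using assms(1) by (simp add: diag_mat_def prod.distinct_set_conv_list[symmetric] lessThan_atLeast0)
  finally show "Determinant.det Z = (\<Prod>i<n. Z $$ (i, i))" .
  then show "Determinant.det Z > 0" using assms(3) by (auto intro: prod_pos)
qed

text \<open>The columns are recovered from the last to the first: column j of Y involves only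
  columns j and later of the root, and positivity decides the sign of the diagonal entry.\<close>

lemma tri_root_unique:
  assumes Z: "tri_root n Y Z" and Z': "tri_root n Y Z'"
  shows "Z = Z'"
proof -
  have c: "Z \<in> carrier_mat n n" "Z' \<in> carrier_mat n n" using Z Z' by (auto simp: tri_root_def)
  have entry: "(\<Sum>k\<in>{j..<n}. W $$ (i, k) * W $$ (j, k)) = Y $$ (i, j)" if W: "tri_root n Y W" and "i < n" "j < n" for W i j
  proof -
    have Wc: "W \<in> carrier_mat n n" and ut: "upper_triangular W" and Y: "Y = W * transpose_mat W"
      using W by (auto simp: tri_root_def)
    have "Y $$ (i, j) = (\<Sum>k\<in>{0..<n}. W $$ (i, k) * W $$ (j, k))"
      unfolding Y using Wc that by (simp add: scalar_prod_def)
    \<comment> \<open>Row j of an upper triangular matrix vanishes before column j.\<close>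
    also have "\<dots> = (\<Sum>k\<in>{j..<n}. W $$ (i, k) * W $$ (j, k))"
      using upper_triangularD[OF ut] Wc that by (intro sum.mono_neutral_right) auto
    finally show ?thesis by simp
  qed
  have main: "\<forall>i<n. Z $$ (i, j) = Z' $$ (i, j)" if "j < n" for j
    using that
  proof (induction "n - j" arbitrary: j rule: less_induct)
    case less
    have IH: "Z $$ (i, k) = Z' $$ (i, k)" if "j < k" "k < n" "i < n" for i k
      using less(1)[of k] less(2) that by auto
    have split: "{j..<n} = insert j {Suc j..<n}" using less(2) by auto
    have eq: "Z $$ (i, j) * Z $$ (j, j) = Z' $$ (i, j) * Z' $$ (j, j)" if i: "i < n" for i
    proof -
      have "(\<Sum>k\<in>{Suc j..<n}. Z $$ (i, k) * Z $$ (j, k)) = (\<Sum>k\<in>{Suc j..<n}. Z' $$ (i, k) * Z' $$ (j, k))"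
        using IH i less(2) by (intro sum.cong) auto
      with entry[OF Z i less(2)] entry[OF Z' i less(2)] show ?thesis unfolding split by simp
    qed
    have pos: "Z $$ (j, j) > 0" "Z' $$ (j, j) > 0" using Z Z' less(2) by (auto simp: tri_root_def)
    have "(Z $$ (j, j))\<^sup>2 = (Z' $$ (j, j))\<^sup>2" using eq[OF less(2)] by (simp add: power2_eq_square)
    then have "Z $$ (j, j) = Z' $$ (j, j)" using pos by (simp add: power2_eq_iff_nonneg)
    then show ?case using eq pos by simp
  qed
  show ?thesis using main c by (intro eq_matI) auto
qed

lemma tri_root_inv:
  assumes "tri_root n Y Z"
  shows "Z \<in> carrier_mat n n" "Determinant.det Z > 0" "mat_inv (transpose_mat Z) \<in> carrier_mat n n"
    "transpose_mat Z * mat_inv (transpose_mat Z) = 1\<^sub>m n" "mat_inv (transpose_mat Z) * transpose_mat Z = 1\<^sub>m n"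
    "Z * transpose_mat (mat_inv (transpose_mat Z)) = 1\<^sub>m n"
proof -
  show Z: "Z \<in> carrier_mat n n" using assms by (simp add: tri_root_def)
  show d: "Determinant.det Z > 0" using det_triangular_pos(1)[OF Z] assms by (auto simp: tri_root_def)
  then have d': "Determinant.det (transpose_mat Z) \<noteq> 0" using det_transpose[OF Z] by simp
  have Zt: "transpose_mat Z \<in> carrier_mat n n" using Z by simp
  note i = mat_inv[OF Zt d']
  show "mat_inv (transpose_mat Z) \<in> carrier_mat n n" "transpose_mat Z * mat_inv (transpose_mat Z) = 1\<^sub>m n"
    "mat_inv (transpose_mat Z) * transpose_mat Z = 1\<^sub>m n" using i by auto
  have "transpose_mat (mat_inv (transpose_mat Z) * transpose_mat Z) = 1\<^sub>m n" using i(2) by simp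
  then show "Z * transpose_mat (mat_inv (transpose_mat Z)) = 1\<^sub>m n"
    using i(3) Z by (simp add: transpose_mult[of _ n n _ n])
qed

lemma na_mat:
  assumes X: "X \<in> carrier_mat n n" and Z: "Z \<in> carrier_mat n n" and D: "mat_inv (transpose_mat Z) \<in> carrier_mat n n"
  shows "n_mat n X * a_mat n Z = four_block_mat Z (X * mat_inv (transpose_mat Z)) (0\<^sub>m n n) (mat_inv (transpose_mat Z))"
  unfolding n_mat_def a_mat_def using assms
  by (subst mult_four_block_mat[of _ n n _ n _ n _ _ n _ n]) auto

text \<open>The second identity evaluates A B^T in the formula for R on the parabolic subgroup,
  where A = Z and B = X Z^(-T); it turns the phase there into x X x^T / 2.\<close>

lemma na_mat_Sp:
  assumes X: "sym_mat n X" and Z: "tri_root n Y Z"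
  shows "n_mat n X * a_mat n Z \<in> Sp n"
    "Z * transpose_mat (X * mat_inv (transpose_mat Z)) = X"
proof -
  note z = tri_root_inv[OF Z]
  have Xc: "X \<in> carrier_mat n n" and Xt: "transpose_mat X = X" using X by (auto simp: sym_mat_def)
  define D where "D = mat_inv (transpose_mat Z)"
  have D: "D \<in> carrier_mat n n" "D * transpose_mat Z = 1\<^sub>m n" "Z * transpose_mat D = 1\<^sub>m n"
    using z by (auto simp: D_def)
  have AB: "Z * transpose_mat (X * D) = X"
  proof -
    have "transpose_mat (X * D) = transpose_mat D * X" using transpose_mult[OF Xc D(1)] Xt by simp
    moreover have "Z * (transpose_mat D * X) = (Z * transpose_mat D) * X"
      using D(1) Xc z(1) by (intro assoc_mult_mat[symmetric, of _ n n _ n _ n]) auto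
    ultimately show ?thesis using D(3) Xc by simp
  qed
  then show "Z * transpose_mat (X * mat_inv (transpose_mat Z)) = X" by (simp add: D_def)
  have BA: "X * D * transpose_mat Z = X"
    using D Xc z(1) by (simp add: assoc_mult_mat[of _ n n _ n _ n])
  have g: "n_mat n X * a_mat n Z = four_block_mat Z (X * D) (0\<^sub>m n n) D"
    using na_mat[OF Xc z(1) z(3)] by (simp add: D_def)
  have XD: "X * D \<in> carrier_mat n n" and Zt: "transpose_mat Z \<in> carrier_mat n n" and Dt: "transpose_mat D \<in> carrier_mat n n"
    and XDt: "transpose_mat (X * D) \<in> carrier_mat n n" using Xc D z(1) by auto
  have mXD: "- (X * D) \<in> carrier_mat n n" and mD: "- D \<in> carrier_mat n n" and O: "0\<^sub>m n n \<in> carrier_mat n n"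
    using XD D(1) by simp_all
  have "X * D * - (1\<^sub>m n) = - (X * D * 1\<^sub>m n)" "D * - (1\<^sub>m n) = - (D * 1\<^sub>m n)"
    by (rule uminus_mult_right_mat, use XD D(1) in simp)+
  then have r: "X * D * - (1\<^sub>m n) = - (X * D)" "D * - (1\<^sub>m n) = - D"
    unfolding right_mult_one_mat[OF XD] right_mult_one_mat[OF D(1)] .
  have zl: "0\<^sub>m n n + Y = Y" "Y + 0\<^sub>m n n = Y" "Y * 0\<^sub>m n n = 0\<^sub>m n n" "0\<^sub>m n n * Y = 0\<^sub>m n n" "Y * 1\<^sub>m n = Y"
    if "Y \<in> carrier_mat n n" for Y :: "real mat" using that by simp_all
  have gJ: "four_block_mat Z (X * D) (0\<^sub>m n n) D * symp_form n = four_block_mat (- (X * D)) Z (- D) (0\<^sub>m n n)"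
    unfolding symp_form_def mult_four_block_mat[OF z(1) XD O D(1) O one_carrier_mat uminus_carrier_mat[OF one_carrier_mat] O] r
      zl[OF z(1)] zl[OF XD] zl[OF D(1)] zl[OF mXD] zl[OF mD] zl[OF O] zl[OF one_carrier_mat] ..
  have gt: "transpose_mat (four_block_mat Z (X * D) (0\<^sub>m n n) D) = four_block_mat (transpose_mat Z) (0\<^sub>m n n) (transpose_mat (X * D)) (transpose_mat D)"
    using z(1) XD D(1) by (subst transpose_four_block_mat[of _ n n _ n _ n]) auto
  have canc: "- X + X = 0\<^sub>m n n" by (rule uminus_l_inv_mat[OF Xc])
  have "- (X * D) * transpose_mat Z = - (X * D * transpose_mat Z)" "- D * transpose_mat Z = - (D * transpose_mat Z)"
    by (rule uminus_mult_left_mat, use D(1) z(1) in simp)+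
  then have m: "- (X * D) * transpose_mat Z = - X" "- D * transpose_mat Z = - (1\<^sub>m n)"
    unfolding BA D(2) .
  have "four_block_mat Z (X * D) (0\<^sub>m n n) D * symp_form n * transpose_mat (four_block_mat Z (X * D) (0\<^sub>m n n) D) = symp_form n"
    unfolding gJ gt mult_four_block_mat[OF mXD z(1) mD O Zt O XDt Dt] m AB D(3) canc
      zl[OF mXD] zl[OF mD] zl[OF XDt] zl[OF Dt] zl[OF O] zl[OF one_carrier_mat] zl[OF uminus_carrier_mat[OF one_carrier_mat]]
    unfolding symp_form_def ..
  then show "n_mat n X * a_mat n Z \<in> Sp n" using z(1) XD D(1) unfolding g Sp_def by auto
qed

section \<open>Reduction theory\<close>

text \<open>In g g^T the orthogonal factor k(Q) cancels, and with D = Z^(-T) the lower right block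
  of what is left is D D^T, the inverse of Y.\<close>

lemma iwasawa_unique:
  assumes "iwasawa n g X Y" "iwasawa n g X' Y'"
  shows "Y = Y'"
proof -
  have key: "\<exists>D B A C. four_block_mat A B C (D * transpose_mat D) = g * transpose_mat g \<and> D \<in> carrier_mat n n \<and>
      A \<in> carrier_mat n n \<and> B \<in> carrier_mat n n \<and> C \<in> carrier_mat n n \<and> Y * (D * transpose_mat D) = 1\<^sub>m n"
    if "iwasawa n g X Y" for X Y
  proof -
    obtain Z Q where X: "sym_mat n X" and Z: "tri_root n Y Z" and Q: "Q \<in> unitary_mats n"
      and g: "g = n_mat n X * a_mat n Z * k_mat Q" using \<open>iwasawa n g X Y\<close> by (auto simp: iwasawa_def)
    note z = tri_root_inv[OF Z]
    define D where "D = mat_inv (transpose_mat Z)"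
    have Xc: "X \<in> carrier_mat n n" using X by (simp add: sym_mat_def)
    have D: "D \<in> carrier_mat n n" "transpose_mat Z * D = 1\<^sub>m n" "Z * transpose_mat D = 1\<^sub>m n" using z by (auto simp: D_def)
    define h where "h = n_mat n X * a_mat n Z"
    have h: "h = four_block_mat Z (X * D) (0\<^sub>m n n) D" using na_mat[OF Xc z(1) z(3)] by (simp add: h_def D_def)
    have XD: "X * D \<in> carrier_mat n n" and Zt: "transpose_mat Z \<in> carrier_mat n n" and Dt: "transpose_mat D \<in> carrier_mat n n"
      and XDt: "transpose_mat (X * D) \<in> carrier_mat n n" and O: "0\<^sub>m n n \<in> carrier_mat n n" using Xc D(1) z(1) by simp_all
    have hc: "h \<in> carrier_mat (n + n) (n + n)" using z(1) D(1) by (simp add: h)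
    have kc: "k_mat Q \<in> carrier_mat (n + n) (n + n)" using k_mat_props(1)[OF Q] by (simp add: Sp_def)
    have ht: "transpose_mat h = four_block_mat (transpose_mat Z) (0\<^sub>m n n) (transpose_mat (X * D)) (transpose_mat D)"
      unfolding h transpose_four_block_mat[OF z(1) XD O D(1)] by simp
    have "g * transpose_mat g = h * k_mat Q * (transpose_mat (k_mat Q) * transpose_mat h)"
      unfolding g h_def[symmetric] using transpose_mult[OF hc kc] by simp
    also have "\<dots> = h * (k_mat Q * (transpose_mat (k_mat Q) * transpose_mat h))"
      using hc kc by (intro assoc_mult_mat[of _ "n + n" "n + n" _ "n + n" _ "n + n"]) auto
    also have "k_mat Q * (transpose_mat (k_mat Q) * transpose_mat h) = k_mat Q * transpose_mat (k_mat Q) * transpose_mat h"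
      using hc kc by (intro assoc_mult_mat[symmetric, of _ "n + n" "n + n" _ "n + n" _ "n + n"]) auto
    also have "\<dots> = transpose_mat h" unfolding k_mat_props(2)[OF Q] using hc by (intro left_mult_one_mat) auto
    finally have gg: "g * transpose_mat g = four_block_mat (Z * transpose_mat Z + X * D * transpose_mat (X * D))
        (Z * 0\<^sub>m n n + X * D * transpose_mat D) (0\<^sub>m n n * transpose_mat Z + D * transpose_mat (X * D)) (0\<^sub>m n n * 0\<^sub>m n n + D * transpose_mat D)"
      unfolding ht unfolding h mult_four_block_mat[OF z(1) XD O D(1) Zt O XDt Dt] .
    have DD: "D * transpose_mat D \<in> carrier_mat n n" using D(1) by simp
    have "0\<^sub>m n n * 0\<^sub>m n n + D * transpose_mat D = D * transpose_mat D" using DD by simp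
    note gg = gg[unfolded this]
    have "Y * (D * transpose_mat D) = Z * (transpose_mat Z * (D * transpose_mat D))"
      using Z z(1) DD by (auto simp: tri_root_def intro!: assoc_mult_mat[of _ n n _ n _ n])
    also have "transpose_mat Z * (D * transpose_mat D) = transpose_mat Z * D * transpose_mat D"
      using z(1) D(1) by (intro assoc_mult_mat[symmetric, of _ n n _ n _ n]) auto
    also have "\<dots> = transpose_mat D" unfolding D(2) using D(1) by simp
    finally have YD: "Y * (D * transpose_mat D) = 1\<^sub>m n" using D(3) by simp
    show ?thesis
      by (rule exI[of _ D], rule exI, rule exI, rule exI, intro conjI, rule gg[symmetric], rule D(1)) (use YD z(1) D(1) XD Dt XDt in auto)
  qed
  obtain D A B C where 1: "four_block_mat A B C (D * transpose_mat D) = g * transpose_mat g" "D \<in> carrier_mat n n"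
      "A \<in> carrier_mat n n" "B \<in> carrier_mat n n" "C \<in> carrier_mat n n" "Y * (D * transpose_mat D) = 1\<^sub>m n"
    using key[OF assms(1)] by blast
  obtain D' A' B' C' where 2: "four_block_mat A' B' C' (D' * transpose_mat D') = g * transpose_mat g" "D' \<in> carrier_mat n n"
      "A' \<in> carrier_mat n n" "B' \<in> carrier_mat n n" "C' \<in> carrier_mat n n" "Y' * (D' * transpose_mat D') = 1\<^sub>m n"
    using key[OF assms(2)] by blast
  have D2: "D * transpose_mat D \<in> carrier_mat n n" "D' * transpose_mat D' \<in> carrier_mat n n" using 1(2) 2(2) by simp_all
  have eq: "D * transpose_mat D = D' * transpose_mat D'"
    by (rule four_block_mat_inject[OF _ 1(3-5) D2(1) 2(3-5) D2(2)]) (simp add: 1(1) 2(1))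
  have Yc: "Y \<in> carrier_mat n n" "Y' \<in> carrier_mat n n" using assms unfolding iwasawa_def pos_def_def sym_mat_def by blast+
  define E where "E = D * transpose_mat D"
  have E: "E \<in> carrier_mat n n" "Y * E = 1\<^sub>m n" "Y' * E = 1\<^sub>m n" using D2(1) 1(6) 2(6) eq by (auto simp: E_def)
  have EY: "E * Y = 1\<^sub>m n" by (rule mat_mult_left_right_inverse[OF Yc(1) E(1) E(2)])
  have "Y' = Y' * (E * Y)" using EY Yc(2) by simp
  also have "\<dots> = Y' * E * Y" using Yc E(1) by (intro assoc_mult_mat[symmetric, of _ n n _ n _ n]) auto
  also have "\<dots> = Y" using E(3) Yc(1) by simp
  finally show ?thesis ..
qed

section \<open>Positive definite forms and the partial Iwasawa decomposition\<close>

lemma scalar_prod_square_root: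
  assumes Z: "Z \<in> carrier_mat n n" and w: "w \<in> carrier_vec n"
  shows "scalar_prod (w \<^sub>v* (Z * transpose_mat Z)) w = scalar_prod (w \<^sub>v* Z) (w \<^sub>v* Z)"
proof -
  have Zt: "transpose_mat Z \<in> carrier_mat n n" using Z by simp
  have "w \<^sub>v* (Z * transpose_mat Z) = (w \<^sub>v* Z) \<^sub>v* transpose_mat Z" by (rule row_mult_assoc[OF w Z Zt])
  then show ?thesis using scalar_prod_row_mult[of "w \<^sub>v* Z" n "transpose_mat Z" n w] Z w by simp
qed

lemma pos_def_det:
  assumes "pos_def n Y" shows "Determinant.det Y \<noteq> 0"
proof
  assume d: "Determinant.det Y = 0"
  have Yc: "Y \<in> carrier_mat n n" and Yt: "transpose_mat Y = Y" using assms by (auto simp: pos_def_def sym_mat_def)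
  obtain v where v: "v \<in> carrier_vec n" "v \<noteq> 0\<^sub>v n" "Y *\<^sub>v v = 0\<^sub>v n"
    using det_0_iff_vec_prod_zero[OF Yc] d by blast
  then have "v \<^sub>v* Y = 0\<^sub>v n" by (simp add: row_mult_def Yt)
  then have "scalar_prod (v \<^sub>v* Y) v = 0" using v(1) by simp
  then show False using assms v by (auto simp: pos_def_def)
qed

lemma partial_iwasawa_product:
  assumes r: "r \<in> carrier_mat 1 n" and Y: "Y1 \<in> carrier_mat n n" and P: "P = four_block_mat (1\<^sub>m 1) r (0\<^sub>m n 1) (1\<^sub>m n)"
  shows "P * blk_diag (v \<cdot>\<^sub>m 1\<^sub>m 1) Y1 * transpose_mat P =
    four_block_mat (v \<cdot>\<^sub>m 1\<^sub>m 1 + r * Y1 * transpose_mat r) (r * Y1) (Y1 * transpose_mat r) Y1"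
    "P * blk_diag (v \<cdot>\<^sub>m 1\<^sub>m 1) Y1 = four_block_mat (v \<cdot>\<^sub>m 1\<^sub>m 1) (r * Y1) (0\<^sub>m n 1) Y1"
proof -
  have v: "v \<cdot>\<^sub>m 1\<^sub>m 1 \<in> carrier_mat 1 1" and rY: "r * Y1 \<in> carrier_mat 1 n" and rt: "transpose_mat r \<in> carrier_mat n 1" using r Y by auto
  have O: "0\<^sub>m n 1 \<in> carrier_mat n 1" "0\<^sub>m 1 n \<in> carrier_mat 1 n" by simp_all
  have B: "blk_diag (v \<cdot>\<^sub>m 1\<^sub>m 1) Y1 = four_block_mat (v \<cdot>\<^sub>m 1\<^sub>m 1) (0\<^sub>m 1 n) (0\<^sub>m n 1) Y1"
    using Y by (simp add: blk_diag_def)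
  have "1\<^sub>m 1 * (v \<cdot>\<^sub>m 1\<^sub>m 1) + r * 0\<^sub>m n 1 = v \<cdot>\<^sub>m 1\<^sub>m 1" "1\<^sub>m 1 * 0\<^sub>m 1 n + r * Y1 = r * Y1"
    "0\<^sub>m n 1 * (v \<cdot>\<^sub>m 1\<^sub>m 1) + 1\<^sub>m n * 0\<^sub>m n 1 = 0\<^sub>m n 1" "0\<^sub>m n 1 * 0\<^sub>m 1 n + 1\<^sub>m n * Y1 = Y1"
    using r Y rY v by simp_all
  then show 1: "P * blk_diag (v \<cdot>\<^sub>m 1\<^sub>m 1) Y1 = four_block_mat (v \<cdot>\<^sub>m 1\<^sub>m 1) (r * Y1) (0\<^sub>m n 1) Y1"
    unfolding P B mult_four_block_mat[OF one_carrier_mat r O(1) one_carrier_mat v O(2) O(1) Y] by simp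
  have Pt: "transpose_mat P = four_block_mat (1\<^sub>m 1) (0\<^sub>m 1 n) (transpose_mat r) (1\<^sub>m n)"
    unfolding P transpose_four_block_mat[OF one_carrier_mat r O(1) one_carrier_mat] by simp
  have "v \<cdot>\<^sub>m 1\<^sub>m 1 * 1\<^sub>m 1 + r * Y1 * transpose_mat r = v \<cdot>\<^sub>m 1\<^sub>m 1 + r * Y1 * transpose_mat r"
    "v \<cdot>\<^sub>m 1\<^sub>m 1 * 0\<^sub>m 1 n + r * Y1 * 1\<^sub>m n = r * Y1" "0\<^sub>m n 1 * 1\<^sub>m 1 + Y1 * transpose_mat r = Y1 * transpose_mat r"
    "0\<^sub>m n 1 * 0\<^sub>m 1 n + Y1 * 1\<^sub>m n = Y1"
    using r Y rY v rt by simp_all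
  then show "P * blk_diag (v \<cdot>\<^sub>m 1\<^sub>m 1) Y1 * transpose_mat P =
    four_block_mat (v \<cdot>\<^sub>m 1\<^sub>m 1 + r * Y1 * transpose_mat r) (r * Y1) (Y1 * transpose_mat r) Y1"
    unfolding 1 Pt mult_four_block_mat[OF v rY O(1) Y one_carrier_mat O(2) rt one_carrier_mat] by simp
qed

text \<open>Completing the square in the first coordinate. The vector x is supplied because v is the
  value of the form there, and its first entry is known to be 1.\<close>

lemma partial_iwasawa_exists:
  assumes "pos_def (Suc n) Y"
  obtains v r Y1 x where "partial_iwasawa n Y v r Y1" "x \<in> carrier_vec (Suc n)" "x $ 0 = 1"
    "scalar_prod (x \<^sub>v* Y) x = v"
proof -
  have Yc: "Y \<in> carrier_mat (Suc n) (Suc n)" and Yt: "transpose_mat Y = Y"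
    and pos: "\<And>x. x \<in> carrier_vec (Suc n) \<Longrightarrow> x \<noteq> 0\<^sub>v (Suc n) \<Longrightarrow> scalar_prod (x \<^sub>v* Y) x > 0"
    using assms by (auto simp: pos_def_def sym_mat_def)
  have sym: "Y $$ (i, j) = Y $$ (j, i)" if "i < Suc n" "j < Suc n" for i j
    using that Yc arg_cong[OF Yt, of "\<lambda>M. M $$ (j, i)"] by simp
  define b where "b = Matrix.mat 1 n (\<lambda>(i, j). Y $$ (0, Suc j))"
  define Y1 where "Y1 = Matrix.mat n n (\<lambda>(i, j). Y $$ (Suc i, Suc j))"
  define a where "a = Matrix.mat 1 1 (\<lambda>_. Y $$ (0, 0))"
  have b: "b \<in> carrier_mat 1 n" and Y1: "Y1 \<in> carrier_mat n n" and a: "a \<in> carrier_mat 1 1" by (auto simp: b_def Y1_def a_def)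
  have bt: "transpose_mat b \<in> carrier_mat n 1" using b by simp
  have Y: "Y = four_block_mat a b (transpose_mat b) Y1"
  proof (rule eq_matI)
    fix i j assume ij: "i < dim_row (four_block_mat a b (transpose_mat b) Y1)" "j < dim_col (four_block_mat a b (transpose_mat b) Y1)"
    then have ij: "i < Suc n" "j < Suc n" using a Y1 by auto
    show "Y $$ (i, j) = four_block_mat a b (transpose_mat b) Y1 $$ (i, j)"
      using ij sym[of i 0] a Y1 by (cases i; cases j) (auto simp: a_def b_def Y1_def)
  qed (use Yc a Y1 in auto)
  have Y1t: "transpose_mat Y1 = Y1" using sym by (intro eq_matI) (auto simp: Y1_def)
  have pd: "pos_def n Y1"
    unfolding pos_def_def sym_mat_def
  proof (intro conjI ballI impI)
    fix x :: "real Matrix.vec" assume x: "x \<in> carrier_vec n" "x \<noteq> 0\<^sub>v n"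
    have z: "(0\<^sub>v 1 :: real Matrix.vec) \<in> carrier_vec 1" by simp
    have xc: "0\<^sub>v 1 @\<^sub>v x \<in> carrier_vec (Suc n)" using x(1) append_carrier_vec[OF z x(1)] by simp
    have "0\<^sub>v 1 @\<^sub>v x \<noteq> 0\<^sub>v (Suc n)"
    proof
      assume e: "0\<^sub>v 1 @\<^sub>v x = 0\<^sub>v (Suc n)"
      have "x = 0\<^sub>v n"
      proof (rule eq_vecI)
        fix i assume "i < dim_vec (0\<^sub>v n)"
        then show "x $ i = 0\<^sub>v n $ i" using arg_cong[OF e, of "\<lambda>v. v $ Suc i"] x(1) by simp
      qed (use x(1) in simp)
      with x(2) show False ..
    qed
    then have "0 < scalar_prod ((0\<^sub>v 1 @\<^sub>v x) \<^sub>v* Y) (0\<^sub>v 1 @\<^sub>v x)" using pos[OF xc] by simp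
    also have "(0\<^sub>v 1 @\<^sub>v x) \<^sub>v* Y = (0\<^sub>v 1 \<^sub>v* a + x \<^sub>v* transpose_mat b) @\<^sub>v (0\<^sub>v 1 \<^sub>v* b + x \<^sub>v* Y1)"
      unfolding Y by (rule row_mult_four_block[OF a b bt Y1 z x(1)])
    also have "scalar_prod \<dots> (0\<^sub>v 1 @\<^sub>v x) = scalar_prod (0\<^sub>v 1 \<^sub>v* a + x \<^sub>v* transpose_mat b) (0\<^sub>v 1) + scalar_prod (0\<^sub>v 1 \<^sub>v* b + x \<^sub>v* Y1) x"
      using row_mult_carrier[OF bt, of x] row_mult_carrier[OF a] row_mult_carrier[OF b] row_mult_carrier[OF Y1] x(1)
      by (intro scalar_prod_four_append[of _ 1 _ _ n] add_carrier_vec z)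
    also have "\<dots> = scalar_prod (x \<^sub>v* Y1) x"
    proof -
      have "0\<^sub>v 1 \<^sub>v* a + x \<^sub>v* transpose_mat b \<in> carrier_vec 1"
        by (intro add_carrier_vec row_mult_carrier[OF a] row_mult_carrier[OF bt])
      moreover have "0\<^sub>v 1 \<^sub>v* b + x \<^sub>v* Y1 = x \<^sub>v* Y1" using row_mult_carrier[OF Y1, of x] zero_row_mult[OF b] by simp
      ultimately show ?thesis by simp
    qed
    finally show "0 < scalar_prod (x \<^sub>v* Y1) x" .
  qed (use Y1 Y1t in auto)
  note inv = mat_inv[OF Y1 pos_def_det[OF pd]]
  \<comment> \<open>Chosen so that r Y1 is the upper right block b; v then has to be the Schur
    complement of Y1 in Y.\<close>
  define r where "r = b * mat_inv Y1"
  have r: "r \<in> carrier_mat 1 n" using b inv(3) by (simp add: r_def)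
  have rt: "transpose_mat r \<in> carrier_mat n 1" using r by simp
  have "r * Y1 = b * (mat_inv Y1 * Y1)" unfolding r_def using b inv(3) Y1 by (intro assoc_mult_mat) auto
  then have rY: "r * Y1 = b" using inv(2) b by simp
  have Yr: "Y1 * transpose_mat r = transpose_mat b"
    using transpose_mult[OF r Y1] rY Y1t by simp
  define q where "q = r * Y1 * transpose_mat r"
  have q: "q \<in> carrier_mat 1 1" using r Y1 rt by (simp add: q_def)
  define v where "v = Y $$ (0, 0) - q $$ (0, 0)"
  define P where "P = four_block_mat (1\<^sub>m 1) r (0\<^sub>m n 1) (1\<^sub>m n)"
  have va: "v \<cdot>\<^sub>m 1\<^sub>m 1 + q = a" using q by (intro eq_matI) (auto simp: v_def a_def)
  have YP: "Y = P * blk_diag (v \<cdot>\<^sub>m 1\<^sub>m 1) Y1 * transpose_mat P"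
    unfolding partial_iwasawa_product(1)[OF r Y1 P_def] q_def[symmetric] va
    unfolding Yr rY by (rule Y)
  \<comment> \<open>The vector (1, -r), which P sends to the first basis vector, so that the form
    takes the value v on it.\<close>
  define x where "x = Matrix.vec 1 (\<lambda>_. 1 :: real) @\<^sub>v (- (Matrix.vec 1 (\<lambda>_. 1) \<^sub>v* r))"
  let ?o = "Matrix.vec 1 (\<lambda>_. 1 :: real)"
  have o: "?o \<in> carrier_vec 1" by simp
  have or: "?o \<^sub>v* r \<in> carrier_vec n" using r by simp
  have xc: "x \<in> carrier_vec (Suc n)" using append_carrier_vec[OF o, of "- (?o \<^sub>v* r)" n] or by (simp add: x_def)
  have x0: "x $ 0 = 1" by (simp add: x_def)
  have mor: "- (?o \<^sub>v* r) \<in> carrier_vec n" using or by simp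
  have Pc: "P \<in> carrier_mat (Suc n) (Suc n)" unfolding P_def using four_block_carrier_mat[OF one_carrier_mat one_carrier_mat, of 1 r "0\<^sub>m n 1" n] by simp
  have Bc: "blk_diag (v \<cdot>\<^sub>m 1\<^sub>m 1) Y1 \<in> carrier_mat (Suc n) (Suc n)"
    using blk_diag_carrier[OF _ Y1, of "v \<cdot>\<^sub>m 1\<^sub>m 1" 1 1] by simp
  have Ptc: "transpose_mat P \<in> carrier_mat (Suc n) (Suc n)" using Pc by simp
  have xP: "x \<^sub>v* P = ?o @\<^sub>v 0\<^sub>v n"
  proof -
    have "x \<^sub>v* P = (?o \<^sub>v* 1\<^sub>m 1 + - (?o \<^sub>v* r) \<^sub>v* 0\<^sub>m n 1) @\<^sub>v (?o \<^sub>v* r + - (?o \<^sub>v* r) \<^sub>v* 1\<^sub>m n)"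
      unfolding x_def P_def by (rule row_mult_four_block[OF one_carrier_mat r _ one_carrier_mat o mor]) simp
    moreover have "?o \<^sub>v* 1\<^sub>m 1 + - (?o \<^sub>v* r) \<^sub>v* 0\<^sub>m n 1 = ?o" using o mor by simp
    moreover have "?o \<^sub>v* r + - (?o \<^sub>v* r) \<^sub>v* 1\<^sub>m n = 0\<^sub>v n" using or mor by simp
    ultimately show ?thesis by simp
  qed
  have "x \<^sub>v* Y = ((x \<^sub>v* P) \<^sub>v* blk_diag (v \<cdot>\<^sub>m 1\<^sub>m 1) Y1) \<^sub>v* transpose_mat P"
    unfolding YP row_mult_assoc[OF xc mult_carrier_mat[OF Pc Bc] Ptc] row_mult_assoc[OF xc Pc Bc] ..
  then have "scalar_prod (x \<^sub>v* Y) x = scalar_prod ((x \<^sub>v* P) \<^sub>v* blk_diag (v \<cdot>\<^sub>m 1\<^sub>m 1) Y1) (x \<^sub>v* P)"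
    using scalar_prod_row_mult[of "(x \<^sub>v* P) \<^sub>v* blk_diag (v \<cdot>\<^sub>m 1\<^sub>m 1) Y1" "Suc n" "transpose_mat P" "Suc n" x] Bc Ptc xc by simp
  also have "(x \<^sub>v* P) \<^sub>v* blk_diag (v \<cdot>\<^sub>m 1\<^sub>m 1) Y1 = (?o \<^sub>v* (v \<cdot>\<^sub>m 1\<^sub>m 1)) @\<^sub>v (0\<^sub>v n \<^sub>v* Y1)"
    unfolding xP using Y1 by (intro row_mult_blk_diag[of _ 1 1 _ n n]) auto
  also have "scalar_prod \<dots> (x \<^sub>v* P) = v"
  proof -
    have "?o \<^sub>v* (v \<cdot>\<^sub>m 1\<^sub>m 1) = Matrix.vec 1 (\<lambda>_. v)"
      by (intro eq_vecI) (simp_all add: row_mult_def scalar_prod_def)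
    then show ?thesis unfolding xP zero_row_mult[OF Y1]
      by (subst scalar_prod_four_append[of _ 1 _ _ n]) (auto simp: scalar_prod_def)
  qed
  finally have qv: "scalar_prod (x \<^sub>v* Y) x = v" .
  have "x \<noteq> 0\<^sub>v (Suc n)" using x0 by auto
  then have "v > 0" using pos[OF xc] qv by simp
  then have "partial_iwasawa n Y v r Y1"
    using r pd YP by (simp add: partial_iwasawa_def Let_def P_def)
  then show ?thesis using xc x0 qv by (rule that)
qed


lemma pos_def_congruence:
  assumes Y: "pos_def n Y" and B: "B \<in> carrier_mat n n" and d: "Determinant.det B \<noteq> 0"
  shows "pos_def n (B * Y * transpose_mat B)"
    "\<And>x. x \<in> carrier_vec n \<Longrightarrow> scalar_prod (x \<^sub>v* (B * Y * transpose_mat B)) x = scalar_prod ((x \<^sub>v* B) \<^sub>v* Y) (x \<^sub>v* B)"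
proof -
  have Yc: "Y \<in> carrier_mat n n" and Yt: "transpose_mat Y = Y" using Y by (auto simp: pos_def_def sym_mat_def)
  have Bt: "transpose_mat B \<in> carrier_mat n n" using B by simp
  show q: "scalar_prod (x \<^sub>v* (B * Y * transpose_mat B)) x = scalar_prod ((x \<^sub>v* B) \<^sub>v* Y) (x \<^sub>v* B)" if x: "x \<in> carrier_vec n" for x
  proof -
    have "x \<^sub>v* (B * Y * transpose_mat B) = ((x \<^sub>v* B) \<^sub>v* Y) \<^sub>v* transpose_mat B"
      unfolding row_mult_assoc[OF x mult_carrier_mat[OF B Yc] Bt] row_mult_assoc[OF x B Yc] ..
    then show ?thesis
      using scalar_prod_row_mult[of "(x \<^sub>v* B) \<^sub>v* Y" n "transpose_mat B" n x] row_mult_carrier[OF Yc] Bt x by simp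
  qed
  have tr: "transpose_mat (B * Y * transpose_mat B) = B * Y * transpose_mat B"
  proof -
    have "transpose_mat (B * Y * transpose_mat B) = transpose_mat (transpose_mat B) * transpose_mat (B * Y)"
      by (rule transpose_mult[OF mult_carrier_mat[OF B Yc] Bt])
    also have "transpose_mat (B * Y) = Y * transpose_mat B" using transpose_mult[OF B Yc] Yt by simp
    finally show ?thesis using assoc_mult_mat[OF B Yc Bt] by simp
  qed
  show "pos_def n (B * Y * transpose_mat B)"
    unfolding pos_def_def sym_mat_def
  proof (intro conjI ballI impI tr)
    show "B * Y * transpose_mat B \<in> carrier_mat n n" using B Yc Bt by (intro mult_carrier_mat)
    fix x :: "real Matrix.vec" assume x: "x \<in> carrier_vec n" "x \<noteq> 0\<^sub>v n"
    have "x \<^sub>v* B \<noteq> 0\<^sub>v n"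
    proof
      assume e: "x \<^sub>v* B = 0\<^sub>v n"
      note i = mat_inv[OF B d]
      have "x = x \<^sub>v* (B * mat_inv B)" using i(1) x(1) by simp
      also have "\<dots> = 0\<^sub>v n" unfolding row_mult_assoc[OF x(1) B i(3)] e by (rule zero_row_mult[OF i(3)])
      finally show False using x(2) by simp
    qed
    then show "0 < scalar_prod (x \<^sub>v* (B * Y * transpose_mat B)) x"
      unfolding q[OF x(1)] using Y row_mult_carrier[OF B, of x] by (simp add: pos_def_def)
  qed
qed

lemma scalar_prod_self_index:
  assumes "u \<in> carrier_vec n" shows "scalar_prod u u = (\<Sum>i<n. (u $ i :: real)\<^sup>2)"
  using assms by (simp add: scalar_prod_def power2_eq_square lessThan_atLeast0)

lemma tri_root_pos_def:
  assumes "tri_root n Y Z" shows "pos_def n Y"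
proof -
  have Zc: "Z \<in> carrier_mat n n" and Zu: "upper_triangular Z" and Zp: "\<And>i. i < n \<Longrightarrow> Z $$ (i, i) > 0"
    and ZZ: "Y = Z * transpose_mat Z" using assms by (auto simp: tri_root_def)
  have Yc: "Y \<in> carrier_mat n n" unfolding ZZ using Zc by simp
  show ?thesis
    unfolding pos_def_def sym_mat_def
  proof (intro conjI ballI impI Yc)
    have "transpose_mat (Z * transpose_mat Z) = transpose_mat (transpose_mat Z) * transpose_mat Z"
      by (rule transpose_mult[OF Zc]) (use Zc in simp)
    then show "transpose_mat Y = Y" unfolding ZZ by simp
    fix x :: "real Matrix.vec" assume x: "x \<in> carrier_vec n" "x \<noteq> 0\<^sub>v n"
    have "Determinant.det Z > 0" by (rule det_triangular_pos(1)[OF Zc Zu]) (rule Zp)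
    then have dZ: "Determinant.det Z \<noteq> 0" by simp
    note zi = mat_inv[OF Zc dZ]
    have "x \<^sub>v* Z \<noteq> 0\<^sub>v n"
    proof
      assume e: "x \<^sub>v* Z = 0\<^sub>v n"
      have "x = x \<^sub>v* (Z * mat_inv Z)" using zi(1) x(1) by simp
      also have "\<dots> = 0\<^sub>v n" unfolding row_mult_assoc[OF x(1) Zc zi(3)] e by (rule zero_row_mult[OF zi(3)])
      finally show False using x(2) by simp
    qed
    then obtain i where i: "i < n" "(x \<^sub>v* Z) $ i \<noteq> 0"
      using row_mult_carrier[OF Zc, of x] by (metis carrier_vecD eq_vecI index_zero_vec(1) index_zero_vec(2))
    have "0 < ((x \<^sub>v* Z) $ i)\<^sup>2" using i(2) by simp
    also have "\<dots> \<le> (\<Sum>i<n. ((x \<^sub>v* Z) $ i)\<^sup>2)" using i(1) by (intro member_le_sum) auto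
    also have "\<dots> = scalar_prod (x \<^sub>v* Y) x"
      unfolding ZZ scalar_prod_square_root[OF Zc x(1)] scalar_prod_self_index[OF row_mult_carrier[OF Zc]] ..
    finally show "0 < scalar_prod (x \<^sub>v* Y) x" .
  qed
qed

text \<open>Over all real a, the form v a^2 + v2 (1 + a r)^2 is at least v v2 / (v + v2 r^2) by
  Cauchy-Schwarz. If some value is at most v, then v2 \<le> v + v2 r^2 \<le> v + v2 / 4.\<close>

lemma two_dim_min:
  fixes v v2 a r :: real
  assumes "v > 0" "v2 > 0" "\<bar>r\<bar> \<le> 1/2" "v * a\<^sup>2 + v2 * (1 + a * r)\<^sup>2 \<le> v"
  shows "3/4 * v2 \<le> v"
proof -
  \<comment> \<open>Lagrange's identity: the difference of the two sides is a perfect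
    square.\<close>
  have cs: "v * v2 * ((1 + a * r) - a * r)\<^sup>2 \<le> (v * a\<^sup>2 + v2 * (1 + a * r)\<^sup>2) * (v + v2 * r\<^sup>2)"
  proof -
    have "(v * a\<^sup>2 + v2 * (1 + a * r)\<^sup>2) * (v + v2 * r\<^sup>2) - v * v2 * ((1 + a * r) - a * r)\<^sup>2 = (v * a + v2 * r * (1 + a * r))\<^sup>2"
      by (simp add: power2_eq_square algebra_simps)
    then show ?thesis using zero_le_power2[of "v * a + v2 * r * (1 + a * r)"] by linarith
  qed
  also have "\<dots> \<le> v * (v + v2 * r\<^sup>2)" using assms by (intro mult_right_mono) auto
  finally have "v * v2 \<le> v * (v + v2 * r\<^sup>2)" by simp
  then have "v2 \<le> v + v2 * r\<^sup>2" using assms(1) by simp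
  moreover have "v2 * r\<^sup>2 \<le> v2 * (1/4)"
    using assms abs_le_square_iff[of r "1/2"] by (intro mult_left_mono) (auto simp: power2_eq_square)
  ultimately show ?thesis by simp
qed

text \<open>The recursion that defines the domain also builds the root. The ratio 3/4 between
  neighbouring squared diagonal entries comes from comparing v with its value after the first two
  coordinates are exchanged. The bound b expresses that the unipotent part of Z has bounded
  entries.\<close>

lemma grenier_root:
  "\<exists>b. \<forall>Y\<in>grenier_domain n. \<exists>Z. tri_root n Y Z \<and>
    (\<forall>i. Suc i < n \<longrightarrow> 3/4 * (Z $$ (Suc i, Suc i))\<^sup>2 \<le> (Z $$ (i, i))\<^sup>2) \<and>
    (\<forall>i<n. \<forall>j<n. \<bar>Z $$ (i, j)\<bar> \<le> b * Z $$ (j, j))"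
proof (induction n)
  case 0
  have "tri_root 0 Y (0\<^sub>m 0 0)" if "Y \<in> grenier_domain 0" for Y
    using that by (auto simp: tri_root_def intro!: eq_matI)
  then show ?case by (intro exI[of _ 0]) auto
next
  case (Suc n)
  then obtain b where b: "\<And>Y. Y \<in> grenier_domain n \<Longrightarrow> \<exists>Z. tri_root n Y Z \<and>
    (\<forall>i. Suc i < n \<longrightarrow> 3/4 * (Z $$ (Suc i, Suc i))\<^sup>2 \<le> (Z $$ (i, i))\<^sup>2) \<and>
    (\<forall>i<n. \<forall>j<n. \<bar>Z $$ (i, j)\<bar> \<le> b * Z $$ (j, j))" by metis
  show ?case
  \<comment> \<open>Grenier's bound 1/2 is on r, whereas the first row of the root is r Z1, a sum of
    n products; hence the factor n. The rows below need |b|, and the corner entry needs 1.\<close>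
  proof (intro exI[of _ "1 + \<bar>b\<bar> * (1 + real n)"] ballI)
    fix Y assume Y: "Y \<in> grenier_domain (Suc n)"
    then obtain v r Y1 where pi: "partial_iwasawa n Y v r Y1"
      and min: "\<And>B v' r' Y1'. B \<in> GLZ (Suc n) \<Longrightarrow> partial_iwasawa n (B * Y * transpose_mat B) v' r' Y1' \<Longrightarrow> v' \<le> v"
      and rb: "\<And>j. j < n \<Longrightarrow> \<bar>r $$ (0, j)\<bar> \<le> 1/2" and gY1: "Y1 \<in> grenier_domain n"
      unfolding grenier_domain.simps mem_Collect_eq by blast
    have v: "v > 0" and r: "r \<in> carrier_mat 1 n" and pd1: "pos_def n Y1" using pi by (auto simp: partial_iwasawa_def)
    have Y1c: "Y1 \<in> carrier_mat n n" using pd1 by (auto simp: pos_def_def sym_mat_def)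
    define P where "P = four_block_mat (1\<^sub>m 1) r (0\<^sub>m n 1) (1\<^sub>m n)"
    have YP: "Y = P * blk_diag (v \<cdot>\<^sub>m 1\<^sub>m 1) Y1 * transpose_mat P" using pi by (simp add: partial_iwasawa_def Let_def P_def)
    obtain Z1 where Z1: "tri_root n Y1 Z1"
      and Z1m: "\<And>i. Suc i < n \<Longrightarrow> 3/4 * (Z1 $$ (Suc i, Suc i))\<^sup>2 \<le> (Z1 $$ (i, i))\<^sup>2"
      and Z1b: "\<And>i j. i < n \<Longrightarrow> j < n \<Longrightarrow> \<bar>Z1 $$ (i, j)\<bar> \<le> b * Z1 $$ (j, j)"
      using b[OF gY1] by blast
    have Z1c: "Z1 \<in> carrier_mat n n" and Z1u: "upper_triangular Z1" and Z1p: "\<And>i. i < n \<Longrightarrow> Z1 $$ (i, i) > 0"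
      and Z1Y: "Y1 = Z1 * transpose_mat Z1" using Z1 by (auto simp: tri_root_def)
    have Z1tc: "transpose_mat Z1 \<in> carrier_mat n n" using Z1c by simp
    define s where "s = sqrt v"
    have s: "s > 0" "s * s = v" using v by (auto simp: s_def)
    \<comment> \<open>This is P times the block diagonal matrix with blocks s and Z1, where s^2 = v,
      so that Z Z^T = Y.\<close>
    define Z where "Z = four_block_mat (s \<cdot>\<^sub>m 1\<^sub>m 1) (r * Z1) (0\<^sub>m n 1) Z1"
    have sc: "s \<cdot>\<^sub>m 1\<^sub>m 1 \<in> carrier_mat 1 1" by simp
    have rZ1: "r * Z1 \<in> carrier_mat 1 n" using r Z1c by simp
    have O: "0\<^sub>m n 1 \<in> carrier_mat n 1" "0\<^sub>m 1 n \<in> carrier_mat 1 n" by simp_all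
    have rZ1t: "transpose_mat (r * Z1) \<in> carrier_mat n 1" using rZ1 by simp
    have Zc: "Z \<in> carrier_mat (Suc n) (Suc n)" unfolding Z_def using four_block_carrier_mat[OF sc Z1c] by simp
    have ix: "Z $$ (0, 0) = s" "\<And>j. j < n \<Longrightarrow> Z $$ (0, Suc j) = (r * Z1) $$ (0, j)" "\<And>i. i < n \<Longrightarrow> Z $$ (Suc i, 0) = 0"
      "\<And>i j. i < n \<Longrightarrow> j < n \<Longrightarrow> Z $$ (Suc i, Suc j) = Z1 $$ (i, j)"
      using Z1c rZ1 by (auto simp: Z_def)
    have ZZ: "Y = Z * transpose_mat Z"
    proof -
      have Zt: "transpose_mat Z = four_block_mat (s \<cdot>\<^sub>m 1\<^sub>m 1) (0\<^sub>m 1 n) (transpose_mat (r * Z1)) (transpose_mat Z1)"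
      proof -
        have "transpose_mat (s \<cdot>\<^sub>m 1\<^sub>m 1) = (s \<cdot>\<^sub>m 1\<^sub>m 1 :: real mat)" by (intro eq_matI) auto
        then show ?thesis unfolding Z_def transpose_four_block_mat[OF sc rZ1 O(1) Z1c] by simp
      qed
      have t: "transpose_mat (r * Z1) = transpose_mat Z1 * transpose_mat r" by (rule transpose_mult[OF r Z1c])
      have rtc: "transpose_mat r \<in> carrier_mat n 1" using r by simp
      have 1: "r * Z1 * (transpose_mat Z1 * transpose_mat r) = r * Y1 * transpose_mat r"
      proof -
        have "r * Z1 * (transpose_mat Z1 * transpose_mat r) = r * Z1 * transpose_mat Z1 * transpose_mat r"
          by (rule assoc_mult_mat[symmetric, OF rZ1 Z1tc rtc])
        also have "r * Z1 * transpose_mat Z1 = r * Y1" unfolding Z1Y by (rule assoc_mult_mat[OF r Z1c Z1tc])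
        finally show ?thesis .
      qed
      have 2: "r * Z1 * transpose_mat Z1 = r * Y1" unfolding Z1Y by (rule assoc_mult_mat[OF r Z1c Z1tc])
      have 3: "Z1 * (transpose_mat Z1 * transpose_mat r) = Y1 * transpose_mat r" unfolding Z1Y by (rule assoc_mult_mat[symmetric, OF Z1c Z1tc rtc])
      have 4: "s \<cdot>\<^sub>m 1\<^sub>m 1 * (s \<cdot>\<^sub>m 1\<^sub>m 1) = (v \<cdot>\<^sub>m 1\<^sub>m 1 :: real mat)" using s by (intro eq_matI) (auto simp: scalar_prod_def)
      have rY: "r * Y1 \<in> carrier_mat 1 n" "Y1 * transpose_mat r \<in> carrier_mat n 1" using r rtc Y1c by simp_all
      have 5: "s \<cdot>\<^sub>m 1\<^sub>m 1 * 0\<^sub>m 1 n + r * Y1 = r * Y1" "0\<^sub>m n 1 * (s \<cdot>\<^sub>m 1\<^sub>m 1) + Y1 * transpose_mat r = Y1 * transpose_mat r"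
        "0\<^sub>m n 1 * 0\<^sub>m 1 n + Y1 = Y1" using rY Y1c by simp_all
      show ?thesis
        unfolding YP partial_iwasawa_product(1)[OF r Y1c P_def] Zt t
        unfolding Z_def mult_four_block_mat[OF sc rZ1 O(1) Z1c sc O(2) mult_carrier_mat[OF Z1tc rtc] Z1tc] 1 2 3 4 Z1Y[symmetric] 5 ..
    qed
    have Zp: "Z $$ (i, i) > 0" if "i < Suc n" for i using that ix s Z1p by (cases i) auto
    have Zu: "upper_triangular Z"
    proof (rule upper_triangularI)
      fix i j assume "j < i" "i < dim_row Z"
      then show "Z $$ (i, j) = 0"
        using ix Zc Z1c upper_triangularD[OF Z1u] by (cases i; cases j) auto
    qed
    have root: "tri_root (Suc n) Y Z" using Zc Zu Zp ZZ by (auto simp: tri_root_def)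
    have Yc: "Y \<in> carrier_mat (Suc n) (Suc n)" unfolding ZZ using Zc by simp
    have pdY: "pos_def (Suc n) Y" by (rule tri_root_pos_def[OF root])
    have first: "3/4 * (Z1 $$ (0, 0))\<^sup>2 \<le> v" if n: "0 < n"
    proof -
      \<comment> \<open>Of the maximality of v over the whole orbit, only the comparison with this
        transposition enters.\<close>
      define B where "B = (swaprows_mat (Suc n) 0 1 :: real mat)"
      have Bc: "B \<in> carrier_mat (Suc n) (Suc n)" by (simp add: B_def)
      have dB: "Determinant.det B = - 1" unfolding B_def using n by (intro det_swaprows_mat) auto
      have BG: "B \<in> GLZ (Suc n)" using Bc dB by (auto simp: GLZ_def int_mat_def B_def)
      have pdB: "pos_def (Suc n) (B * Y * transpose_mat B)" by (rule pos_def_congruence(1)[OF pdY Bc]) (simp add: dB)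
      obtain v' r' Y1' x where B': "partial_iwasawa n (B * Y * transpose_mat B) v' r' Y1'"
        and x: "x \<in> carrier_vec (Suc n)" "x $ 0 = 1" and xv: "scalar_prod (x \<^sub>v* (B * Y * transpose_mat B)) x = v'"
        by (rule partial_iwasawa_exists[OF pdB])
      have "v' \<le> v" by (rule min[OF BG B'])
      \<comment> \<open>The transposition moves the entry 1 of x to position 1 of w. The entry a at
        position 0 is an unknown real number, which \<open>two_dim_min\<close> allows.\<close>
      define w where "w = x \<^sub>v* B"
      have w: "w \<in> carrier_vec (Suc n)" unfolding w_def by (rule row_mult_carrier[OF Bc])
      have "w $ 1 = (\<Sum>i<Suc n. x $ i * B $$ (i, 1))" unfolding w_def by (rule row_mult_index[OF x(1) Bc]) (use n in simp)
      also have "\<dots> = (\<Sum>i\<in>{0}. x $ i * B $$ (i, 1))" using n by (intro sum.mono_neutral_right) (auto simp: B_def)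
      also have "\<dots> = 1" using x(2) n by (simp add: B_def)
      finally have w1: "w $ 1 = 1" .
      define a where "a = w $ 0"
      have wZ: "w \<^sub>v* Z \<in> carrier_vec (Suc n)" by (rule row_mult_carrier[OF Zc])
      have "v' = scalar_prod (w \<^sub>v* Y) w" using xv pos_def_congruence(2)[OF pdY Bc _ x(1)] dB by (simp add: w_def)
      also have "\<dots> = (\<Sum>i<Suc n. ((w \<^sub>v* Z) $ i)\<^sup>2)"
        unfolding ZZ scalar_prod_square_root[OF Zc w] scalar_prod_self_index[OF wZ] ..
      finally have v': "v' = (\<Sum>i<Suc n. ((w \<^sub>v* Z) $ i)\<^sup>2)" .
      \<comment> \<open>Of the squares that make up v' only two are kept. As Z is triangular they
        involve only the first two entries of w, so the remaining ones need not be known.\<close>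
      have "(\<Sum>i\<in>{0, 1}. ((w \<^sub>v* Z) $ i)\<^sup>2) \<le> (\<Sum>i<Suc n. ((w \<^sub>v* Z) $ i)\<^sup>2)"
        using n by (intro sum_mono2) auto
      then have le: "((w \<^sub>v* Z) $ 0)\<^sup>2 + ((w \<^sub>v* Z) $ 1)\<^sup>2 \<le> v" using v' \<open>v' \<le> v\<close> by simp
      have "(w \<^sub>v* Z) $ 0 = (\<Sum>i<Suc n. w $ i * Z $$ (i, 0))" by (rule row_mult_index[OF w Zc]) simp
      also have "\<dots> = (\<Sum>i\<in>{0}. w $ i * Z $$ (i, 0))"
        using upper_triangularD[OF Zu] Zc by (intro sum.mono_neutral_right) auto
      finally have e0: "(w \<^sub>v* Z) $ 0 = a * s" using ix(1) by (simp add: a_def)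
      have "(w \<^sub>v* Z) $ 1 = (\<Sum>i<Suc n. w $ i * Z $$ (i, 1))" by (rule row_mult_index[OF w Zc]) (use n in simp)
      also have "\<dots> = (\<Sum>i\<in>{0, 1}. w $ i * Z $$ (i, 1))"
        using upper_triangularD[OF Zu, of 1] Zc n by (intro sum.mono_neutral_right) (auto simp: not_less_eq less_Suc_eq)
      also have "\<dots> = a * (r * Z1) $$ (0, 0) + Z1 $$ (0, 0)"
        using ix(2)[of 0] ix(4)[of 0 0] n w1 by (simp add: a_def)
      also have "(r * Z1) $$ (0, 0) = (\<Sum>k<n. r $$ (0, k) * Z1 $$ (k, 0))"
        using r Z1c n by (simp add: scalar_prod_def lessThan_atLeast0)
      also have "\<dots> = (\<Sum>k\<in>{0}. r $$ (0, k) * Z1 $$ (k, 0))"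
        using upper_triangularD[OF Z1u] Z1c n by (intro sum.mono_neutral_right) auto
      finally have e1: "(w \<^sub>v* Z) $ 1 = Z1 $$ (0, 0) * (1 + a * r $$ (0, 0))" by (simp add: algebra_simps)
      have "v * a\<^sup>2 + (Z1 $$ (0, 0))\<^sup>2 * (1 + a * r $$ (0, 0))\<^sup>2 \<le> v"
        using le unfolding e0 e1 by (simp add: power_mult_distrib power2_eq_square[of s] s(2) mult.commute)
      then show ?thesis using two_dim_min[OF v, of "(Z1 $$ (0, 0))\<^sup>2" "r $$ (0, 0)" a] Z1p[OF n] rb[OF n] by simp
    qed
    show "\<exists>Z. tri_root (Suc n) Y Z \<and>
      (\<forall>i. Suc i < Suc n \<longrightarrow> 3/4 * (Z $$ (Suc i, Suc i))\<^sup>2 \<le> (Z $$ (i, i))\<^sup>2) \<and>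
      (\<forall>i<Suc n. \<forall>j<Suc n. \<bar>Z $$ (i, j)\<bar> \<le> (1 + \<bar>b\<bar> * (1 + real n)) * Z $$ (j, j))"
    proof (intro exI[of _ Z] conjI allI impI root)
      fix i assume i: "Suc i < Suc n"
      show "3/4 * (Z $$ (Suc i, Suc i))\<^sup>2 \<le> (Z $$ (i, i))\<^sup>2"
      proof (cases i)
        case 0
        then show ?thesis using first ix(1) ix(4)[of 0 0] i s(2) by (simp add: power2_eq_square)
      next
        case (Suc k)
        then show ?thesis using Z1m[of k] ix(4)[of k k] ix(4)[of "Suc k" "Suc k"] i by simp
      qed
    next
      fix i j assume i: "i < Suc n" and j: "j < Suc n"
      let ?b = "1 + \<bar>b\<bar> * (1 + real n)"
      have b1: "\<bar>b\<bar> \<le> ?b" "0 \<le> \<bar>b\<bar> * real n" "\<bar>b\<bar> * real n \<le> ?b" by (auto simp: algebra_simps)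
      show "\<bar>Z $$ (i, j)\<bar> \<le> ?b * Z $$ (j, j)"
      proof (cases j)
        case 0
        show ?thesis
        proof (cases i)
          case 0
          then show ?thesis using \<open>j = 0\<close> ix(1) s(1) by (simp add: distrib_right)
        next
          case (Suc k)
          then show ?thesis using \<open>j = 0\<close> ix(1) ix(3)[of k] i s(1) by simp
        qed
      next
        case (Suc m)
        then have m: "m < n" using j by simp
        note pm = Z1p[OF m]
        have z: "\<bar>Z1 $$ (k, m)\<bar> \<le> \<bar>b\<bar> * Z1 $$ (m, m)" if "k < n" for k
          using Z1b[OF that m] pm by (meson abs_ge_self less_imp_le mult_right_mono order_trans)
        show ?thesis
        proof (cases i)
          case 0
          have "(r * Z1) $$ (0, m) = (\<Sum>k<n. r $$ (0, k) * Z1 $$ (k, m))"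
            using r Z1c m by (simp add: scalar_prod_def lessThan_atLeast0)
          then have "\<bar>(r * Z1) $$ (0, m)\<bar> \<le> (\<Sum>k<n. \<bar>r $$ (0, k) * Z1 $$ (k, m)\<bar>)" by simp
          also have "\<dots> \<le> (\<Sum>k<n. 1 * (\<bar>b\<bar> * Z1 $$ (m, m)))"
            unfolding abs_mult using rb z by (intro sum_mono mult_mono) force+
          also have "\<dots> = (\<bar>b\<bar> * real n) * Z1 $$ (m, m)" by simp
          also have "\<dots> \<le> ?b * Z1 $$ (m, m)" using b1 pm by (intro mult_right_mono) auto
          finally show ?thesis using 0 Suc ix(2)[OF m] ix(4)[OF m m] by simp
        next
          case (Suc k)
          have "\<bar>Z1 $$ (k, m)\<bar> \<le> ?b * Z1 $$ (m, m)"
            using z[of k] b1(1) pm i Suc by (meson Suc_less_eq less_imp_le mult_right_mono order_trans)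
          then show ?thesis using Suc \<open>j = Suc m\<close> ix(4)[of k m] ix(4)[OF m m] m i by simp
        qed
      qed
    qed
  qed
qed

text \<open>Forward substitution in w Z = u. The entries satisfy |Z_ij| \<le> b Z_jj \<le> b
  \<kappa> Z_ii for i \<le> j, so Z_jj |w_j| is at most |u_j| plus b \<kappa> times the sum of the
  earlier Z_ii |w_i|.\<close>

lemma triangular_lower_bound:
  assumes Zc: "Z \<in> carrier_mat n n" and Zu: "upper_triangular Z" and Zp: "\<And>i. i < n \<Longrightarrow> Z $$ (i, i) > (0 :: real)"
    and Zb: "\<And>i j. i < n \<Longrightarrow> j < n \<Longrightarrow> \<bar>Z $$ (i, j)\<bar> \<le> b * Z $$ (j, j)" and b: "b \<ge> 0"
    and Zk: "\<And>i j. i \<le> j \<Longrightarrow> j < n \<Longrightarrow> Z $$ (j, j) \<le> \<kappa> * Z $$ (i, i)" and k: "\<kappa> \<ge> 0"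
    and w: "w \<in> carrier_vec n"
  shows "(\<Sum>j<n. (Z $$ (j, j))\<^sup>2 * (w $ j)\<^sup>2) \<le> real n * ((1 + b * \<kappa>) ^ n)\<^sup>2 * scalar_prod (w \<^sub>v* Z) (w \<^sub>v* Z)"
proof -
  define u where "u = w \<^sub>v* Z"
  have uc: "u \<in> carrier_vec n" unfolding u_def by (rule row_mult_carrier[OF Zc])
  define M where "M = sqrt (scalar_prod u u)"
  define d where "d = 1 + b * \<kappa>"
  have d: "d \<ge> 1" using b k by (simp add: d_def)
  have uu: "scalar_prod u u = (\<Sum>i<n. (u $ i)\<^sup>2)" by (rule scalar_prod_self_index[OF uc])
  have uM: "\<bar>u $ j\<bar> \<le> M" if "j < n" for j
  proof -
    have "(u $ j)\<^sup>2 \<le> scalar_prod u u" unfolding uu using that by (intro member_le_sum) auto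
    then show ?thesis unfolding M_def by (simp add: real_le_rsqrt)
  qed
  have M: "M \<ge> 0" unfolding M_def uu by (simp add: sum_nonneg)
  \<comment> \<open>The geometric sum that solves the recursive inequality: d is chosen as 1 + b
    \<kappa> to make the induction close with d^j.\<close>
  have geo: "1 + b * \<kappa> * (\<Sum>i<j. d ^ i) = d ^ j" for j
    by (induction j) (simp_all add: d_def algebra_simps)
  have main: "Z $$ (j, j) * \<bar>w $ j\<bar> \<le> d ^ j * M" if "j < n" for j
    using that
  proof (induction j rule: less_induct)
    case (less j)
    have "u $ j = (\<Sum>i<n. w $ i * Z $$ (i, j))" unfolding u_def by (rule row_mult_index[OF w Zc less.prems])
    also have "\<dots> = (\<Sum>i<Suc j. w $ i * Z $$ (i, j))"
      using upper_triangularD[OF Zu] Zc less.prems by (intro sum.mono_neutral_right) auto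
    finally have "Z $$ (j, j) * w $ j = u $ j - (\<Sum>i<j. w $ i * Z $$ (i, j))" by simp
    then have "\<bar>Z $$ (j, j) * w $ j\<bar> \<le> \<bar>u $ j\<bar> + \<bar>\<Sum>i<j. w $ i * Z $$ (i, j)\<bar>" by linarith
    also have "\<dots> \<le> M + (\<Sum>i<j. b * \<kappa> * (d ^ i * M))"
    proof (intro add_mono uM less.prems order_trans[OF sum_abs] sum_mono)
      fix i assume i: "i \<in> {..<j}"
      have zz: "\<bar>Z $$ (i, j)\<bar> \<le> b * (\<kappa> * Z $$ (i, i))"
        using Zb[of i j] Zk[of i j] i less.prems b by (meson lessThan_iff less_imp_le less_trans mult_left_mono order_trans)
      have "\<bar>w $ i * Z $$ (i, j)\<bar> \<le> \<bar>w $ i\<bar> * (b * (\<kappa> * Z $$ (i, i)))"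
        unfolding abs_mult using zz by (intro mult_left_mono) auto
      also have "\<dots> = b * \<kappa> * (Z $$ (i, i) * \<bar>w $ i\<bar>)" by simp
      also have "\<dots> \<le> b * \<kappa> * (d ^ i * M)" using less.IH[of i] i less.prems b k by (intro mult_left_mono) auto
      finally show "\<bar>w $ i * Z $$ (i, j)\<bar> \<le> b * \<kappa> * (d ^ i * M)" .
    qed
    also have "\<dots> = (1 + b * \<kappa> * (\<Sum>i<j. d ^ i)) * M" by (simp add: sum_distrib_left sum_distrib_right algebra_simps)
    finally show ?case using Zp[OF less.prems] unfolding geo by (simp add: abs_mult)
  qed
  have "(Z $$ (j, j))\<^sup>2 * (w $ j)\<^sup>2 \<le> (d ^ n)\<^sup>2 * scalar_prod u u" if j: "j < n" for j
  proof -
    have "Z $$ (j, j) * \<bar>w $ j\<bar> \<le> d ^ n * M"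
      using main[OF j] power_increasing[of j n d] d j M by (meson less_imp_le mult_right_mono order_trans)
    then have "(Z $$ (j, j) * \<bar>w $ j\<bar>)\<^sup>2 \<le> (d ^ n * M)\<^sup>2" using Zp[OF j] by (intro power_mono) auto
    then show ?thesis unfolding power_mult_distrib M_def using uu by (simp add: sum_nonneg)
  qed
  then have "(\<Sum>j<n. (Z $$ (j, j))\<^sup>2 * (w $ j)\<^sup>2) \<le> (\<Sum>j<n. (d ^ n)\<^sup>2 * scalar_prod u u)" by (intro sum_mono) auto
  then show ?thesis by (simp add: u_def d_def)
qed

text \<open>The columns of U scaled by the square roots of V form a triangular root of U V U^T; by
  uniqueness this is Z, and U has diagonal 1.\<close>

lemma iwasawa_diag_root:
  assumes V: "pos_diag n V" and U: "upper_unipotent n U" and Z: "tri_root n (U * V * transpose_mat U) Z" and i: "i < n"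
  shows "V $$ (i, i) = (Z $$ (i, i))\<^sup>2"
proof -
  have Vc: "V \<in> carrier_mat n n" and Vd: "diagonal_mat V" and Vp: "\<And>i. i < n \<Longrightarrow> V $$ (i, i) > 0"
    using V by (auto simp: pos_diag_def)
  have Uc: "U \<in> carrier_mat n n" and Uu: "upper_triangular U" and U1: "\<And>i. i < n \<Longrightarrow> U $$ (i, i) = 1"
    using U by (auto simp: upper_unipotent_def)
  define W where "W = Matrix.mat n n (\<lambda>(i, j). U $$ (i, j) * sqrt (V $$ (j, j)))"
  have Wc: "W \<in> carrier_mat n n" by (simp add: W_def)
  have UV: "(U * V) $$ (i, k) = U $$ (i, k) * V $$ (k, k)" if "i < n" "k < n" for i k
  proof -
    have "(U * V) $$ (i, k) = (\<Sum>m<n. U $$ (i, m) * V $$ (m, k))"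
      using Uc Vc that by (simp add: scalar_prod_def lessThan_atLeast0)
    also have "\<dots> = (\<Sum>m\<in>{k}. U $$ (i, m) * V $$ (m, k))"
      using Vd Vc that by (intro sum.mono_neutral_right) (auto simp: diagonal_mat_def)
    finally show ?thesis by simp
  qed
  have "U * V * transpose_mat U = W * transpose_mat W"
  proof (rule eq_matI)
    fix i j assume "i < dim_row (W * transpose_mat W)" "j < dim_col (W * transpose_mat W)"
    then have ij: "i < n" "j < n" by (auto simp: W_def)
    have "(U * V * transpose_mat U) $$ (i, j) = (\<Sum>k<n. (U * V) $$ (i, k) * U $$ (j, k))"
    proof -
      have "(A * transpose_mat B) $$ (i, j) = (\<Sum>k<n. A $$ (i, k) * B $$ (j, k))"
        if "A \<in> carrier_mat n n" "B \<in> carrier_mat n n" for A B :: "real mat"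
        using that ij by (simp add: scalar_prod_def lessThan_atLeast0)
      from this[OF mult_carrier_mat[OF Uc Vc] Uc] show ?thesis .
    qed
    also have "\<dots> = (\<Sum>k<n. (U $$ (i, k) * sqrt (V $$ (k, k))) * (U $$ (j, k) * sqrt (V $$ (k, k))))"
    proof (rule sum.cong)
      fix k assume "k \<in> {..<n}"
      then have k: "k < n" by simp
      have "sqrt (V $$ (k, k)) * sqrt (V $$ (k, k)) = V $$ (k, k)" using Vp[OF k] by simp
      then show "(U * V) $$ (i, k) * U $$ (j, k) = (U $$ (i, k) * sqrt (V $$ (k, k))) * (U $$ (j, k) * sqrt (V $$ (k, k)))"
        unfolding UV[OF ij(1) k] by (metis mult.assoc mult.left_commute mult.commute)
    qed simp
    also have "\<dots> = (W * transpose_mat W) $$ (i, j)"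
      using ij by (simp add: W_def scalar_prod_def lessThan_atLeast0)
    finally show "(U * V * transpose_mat U) $$ (i, j) = (W * transpose_mat W) $$ (i, j)" .
  qed (use Uc Vc in \<open>auto simp: W_def\<close>)
  moreover have "upper_triangular W"
    by (rule upper_triangularI) (use upper_triangularD[OF Uu] Uc in \<open>auto simp: W_def\<close>)
  ultimately have "tri_root n (U * V * transpose_mat U) W"
    using Wc U1 Vp by (auto simp: tri_root_def W_def)
  then have "Z = W" by (rule tri_root_unique[OF Z])
  then show ?thesis using i U1 Vp[OF i] by (simp add: W_def)
qed

text \<open>The element of \<open>Sp(n, \<int>)\<close> inverting only the last coordinate is \<open>k(diag(1, \<dots>, 1, \<i>))\<close>.\<close>

lemma siegel_last_entry:
  assumes n: "n > 0" and X: "X \<in> carrier_mat n n" and Y: "Y \<in> carrier_mat n n"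
    and det: "\<And>A B C D. A \<in> carrier_mat n n \<Longrightarrow> B \<in> carrier_mat n n \<Longrightarrow> C \<in> carrier_mat n n \<Longrightarrow>
        D \<in> carrier_mat n n \<Longrightarrow> four_block_mat A B C D \<in> SpZ n \<Longrightarrow>
        norm (Determinant.det (map_mat complex_of_real C *
            (map_mat complex_of_real X + \<i> \<cdot>\<^sub>m map_mat complex_of_real Y)
          + map_mat complex_of_real D)) \<ge> 1"
    and Xb: "\<bar>X $$ (n - 1, n - 1)\<bar> \<le> 1/2"
  shows "\<bar>Y $$ (n - 1, n - 1)\<bar> \<ge> 3/4"
proof -
  define Q where "Q = Matrix.mat n n (\<lambda>(i, j). if i = j then (if i = n - 1 then \<i> else 1) else 0)"
  have Qc: "Q \<in> carrier_mat n n" by (simp add: Q_def)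
  have Q: "Q \<in> unitary_mats n"
  proof -
    have d: "mat_adjoint Q \<in> carrier_mat n n" unfolding mat_adjoint_def
      by (intro carrier_matI) (use Qc in auto)
    have "Q * mat_adjoint Q = 1\<^sub>m n"
    proof (rule eq_matI)
      fix i j assume "i < dim_row (1\<^sub>m n :: complex mat)" "j < dim_col (1\<^sub>m n :: complex mat)"
      then have ij: "i < n" "j < n" by auto
      have "(Q * mat_adjoint Q) $$ (i, j) = (\<Sum>k<n. Q $$ (i, k) * cnj (Q $$ (j, k)))"
        by (rule mult_adjoint_index[OF Qc ij])
      also have "\<dots> = (\<Sum>k\<in>{i}. Q $$ (i, k) * cnj (Q $$ (j, k)))"
        using ij by (intro sum.mono_neutral_right) (auto simp: Q_def)
      finally show "(Q * mat_adjoint Q) $$ (i, j) = 1\<^sub>m n $$ (i, j)" using ij by (auto simp: Q_def)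
    qed (use Qc d in auto)
    then show ?thesis using Qc by (simp add: unitary_mats_def)
  qed
  define C where "C = map_mat Im Q"
  define D where "D = map_mat Re Q"
  have C: "C \<in> carrier_mat n n" and D: "D \<in> carrier_mat n n" using Qc by (auto simp: C_def D_def)
  have g: "four_block_mat D (- C) C D = k_mat Q" by (simp add: k_mat_def C_def D_def)
  have entC: "C $$ (i, j) = (if i = n - 1 \<and> j = n - 1 then 1 else 0)" and entD: "D $$ (i, j) = (if i = j \<and> i \<noteq> n - 1 then 1 else 0)"
    if "i < n" "j < n" for i j using that by (auto simp: C_def D_def Q_def)
  have "int_mat (k_mat Q)"
    unfolding int_mat_def g[symmetric] using C D by (auto simp: entC entD)
  then have SpZ: "four_block_mat D (- C) C D \<in> SpZ n" using k_mat_props(1)[OF Q] by (simp add: g SpZ_def)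
  define z where "z = map_mat complex_of_real X + \<i> \<cdot>\<^sub>m map_mat complex_of_real Y"
  have zc: "z \<in> carrier_mat n n" using X Y by (simp add: z_def)
  define M where "M = map_mat complex_of_real C * z + map_mat complex_of_real D"
  have Mc: "M \<in> carrier_mat n n" using C D zc by (simp add: M_def)
  \<comment> \<open>M is the identity except in its last row, which is that of X + iY. Hence it is
    lower triangular, and its determinant is the corner entry of X + iY.\<close>
  have M: "M $$ (i, j) = (if i = n - 1 then z $$ (n - 1, j) else if i = j then 1 else 0)" if ij: "i < n" "j < n" for i j
  proof -
    have "(map_mat complex_of_real C * z) $$ (i, j) = (\<Sum>k<n. complex_of_real (C $$ (i, k)) * z $$ (k, j))"
      using C zc ij by (simp add: scalar_prod_def lessThan_atLeast0)
    also have "\<dots> = (\<Sum>k\<in>{n - 1}. complex_of_real (C $$ (i, k)) * z $$ (k, j))"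
      using n ij by (intro sum.mono_neutral_right) (auto simp: entC)
    finally show ?thesis using C D zc ij n by (auto simp: M_def entC entD)
  qed
  have "Determinant.det M = prod_list (diag_mat M)"
    using M Mc by (intro det_lower_triangular[of n]) auto
  also have "\<dots> = (\<Prod>i<n. M $$ (i, i))"
    using Mc by (simp add: diag_mat_def prod.distinct_set_conv_list[symmetric] lessThan_atLeast0)
  also have "\<dots> = (\<Prod>i\<in>{n - 1}. M $$ (i, i))"
    using n M by (intro prod.mono_neutral_right) auto
  also have "\<dots> = z $$ (n - 1, n - 1)" using M n by simp
  finally have "norm (z $$ (n - 1, n - 1)) \<ge> 1"
    using det[OF D _ C D SpZ] C unfolding M_def z_def by simp
  moreover have "z $$ (n - 1, n - 1) = Complex (X $$ (n - 1, n - 1)) (Y $$ (n - 1, n - 1))"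
    using X Y n by (simp add: z_def complex_eq_iff)
  ultimately have "1 \<le> (X $$ (n - 1, n - 1))\<^sup>2 + (Y $$ (n - 1, n - 1))\<^sup>2"
    by (simp add: cmod_def)
  moreover have "(X $$ (n - 1, n - 1))\<^sup>2 \<le> (1/2)\<^sup>2" using Xb by (metis abs_ge_zero power2_abs power_mono)
  \<comment> \<open>From 1 \<le> X^2 + Y^2 and X^2 \<le> 1/4 follows Y^2 \<ge> 3/4, weakened to
    (3/4)^2 to avoid a root.\<close>
  ultimately have "(3/4)\<^sup>2 \<le> \<bar>Y $$ (n - 1, n - 1)\<bar>\<^sup>2" by (simp add: power2_eq_square)
  then show ?thesis by (rule power2_le_imp_le) simp
qed

text \<open>One constant for all comparisons on the fundamental domain. The last v equals the corner
  entry of Y, because Z is triangular, and is at least 3/4; the other v are bounded below through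
  their ratio to the last one.\<close>

lemma siegel_bounds:
  assumes n: "n > 0"
  shows "\<exists>\<kappa>\<ge>1. \<forall>g V X0 Z0 Q. g \<in> siegel_domain n \<and> iwasawa_diag n g V \<and> sym_mat n X0 \<and>
    tri_root n (Z0 * transpose_mat Z0) Z0 \<and> Q \<in> unitary_mats n \<and> g = n_mat n X0 * a_mat n Z0 * k_mat Q \<longrightarrow>
    pos_diag n V \<and> (\<forall>i<n. V $$ (i, i) = (Z0 $$ (i, i))\<^sup>2) \<and> (\<forall>i j. i \<le> j \<and> j < n \<longrightarrow> V $$ (j, j) \<le> \<kappa> * V $$ (i, i)) \<and>
    (\<forall>i<n. 1 \<le> \<kappa> * V $$ (i, i)) \<and>
    (\<forall>w\<in>carrier_vec n. (\<Sum>i<n. V $$ (i, i) * (w $ i)\<^sup>2) \<le> \<kappa> * scalar_prod (w \<^sub>v* Z0) (w \<^sub>v* Z0))"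
proof -
  obtain b0 where b0: "\<And>Y. Y \<in> grenier_domain n \<Longrightarrow> \<exists>Z. tri_root n Y Z \<and>
    (\<forall>i. Suc i < n \<longrightarrow> 3/4 * (Z $$ (Suc i, Suc i))\<^sup>2 \<le> (Z $$ (i, i))\<^sup>2) \<and>
    (\<forall>i<n. \<forall>j<n. \<bar>Z $$ (i, j)\<bar> \<le> b0 * Z $$ (j, j))" using grenier_root[of n] by metis
  define b where "b = \<bar>b0\<bar>"
  define L where "L = real n * ((1 + b * 2 ^ n) ^ n)\<^sup>2"
  \<comment> \<open>4^n bounds the ratios of the v, the factor 2 compensates for the lower bound
    3/4, and L compares V with Y.\<close>
  define \<kappa> where "\<kappa> = 2 * 4 ^ n + L"
  have L0: "L \<ge> 0" by (simp add: L_def)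
  show ?thesis
  proof (intro exI[of _ \<kappa>] conjI allI impI)
    have "(1::real) \<le> 4 ^ n" by simp
    then show "1 \<le> \<kappa>" using L0 unfolding \<kappa>_def by linarith
    fix g V X0 Z0 Q
    assume asm: "g \<in> siegel_domain n \<and> iwasawa_diag n g V \<and> sym_mat n X0 \<and>
      tri_root n (Z0 * transpose_mat Z0) Z0 \<and> Q \<in> unitary_mats n \<and> g = n_mat n X0 * a_mat n Z0 * k_mat Q"
    let ?Y = "Z0 * transpose_mat Z0"
    have iw: "iwasawa n g X0 ?Y" using asm tri_root_pos_def[of n ?Y Z0] by (auto simp: iwasawa_def)
    \<comment> \<open>The domain provides its own pair of coordinates. Uniqueness identifies its Y
      with Z0 Z0^T; the X that it provides is kept, since the bounds concern that one.\<close>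
    obtain X where X: "iwasawa n g X ?Y" and dt: "\<And>A B C D. A \<in> carrier_mat n n \<Longrightarrow> B \<in> carrier_mat n n \<Longrightarrow> C \<in> carrier_mat n n \<Longrightarrow>
        D \<in> carrier_mat n n \<Longrightarrow> four_block_mat A B C D \<in> SpZ n \<Longrightarrow>
        norm (Determinant.det (map_mat complex_of_real C *
            (map_mat complex_of_real X + \<i> \<cdot>\<^sub>m map_mat complex_of_real ?Y)
          + map_mat complex_of_real D)) \<ge> 1" and Xb: "\<And>i j. i < n \<Longrightarrow> j < n \<Longrightarrow> \<bar>X $$ (i, j)\<bar> \<le> 1/2"
      and gr: "?Y \<in> grenier_domain n"
    proof -
      obtain X Y where XY: "iwasawa n g X Y" "\<forall>A B C D. A \<in> carrier_mat n n \<and> B \<in> carrier_mat n n \<and> C \<in> carrier_mat n n \<and>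
        D \<in> carrier_mat n n \<and> four_block_mat A B C D \<in> SpZ n \<longrightarrow>
        norm (Determinant.det (map_mat complex_of_real C *
            (map_mat complex_of_real X + \<i> \<cdot>\<^sub>m map_mat complex_of_real Y)
          + map_mat complex_of_real D)) \<ge> 1" "\<forall>i<n. \<forall>j<n. \<bar>X $$ (i, j)\<bar> \<le> 1/2" "Y \<in> grenier_domain n"
        using asm unfolding siegel_domain_def by blast
      have "Y = ?Y" by (rule iwasawa_unique[OF XY(1) iw])
      then show ?thesis using XY that by metis
    qed
    obtain Z where Z: "tri_root n ?Y Z" and Zm: "\<And>i. Suc i < n \<Longrightarrow> 3/4 * (Z $$ (Suc i, Suc i))\<^sup>2 \<le> (Z $$ (i, i))\<^sup>2"
      and Zb0: "\<And>i j. i < n \<Longrightarrow> j < n \<Longrightarrow> \<bar>Z $$ (i, j)\<bar> \<le> b0 * Z $$ (j, j)" using b0[OF gr] by blast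
    have "Z = Z0" by (rule tri_root_unique[OF Z]) (use asm in simp)
    note Z = Z[unfolded this] and Zm = Zm[unfolded this] and Zb0 = Zb0[unfolded this]
    have Zc: "Z0 \<in> carrier_mat n n" and Zu: "upper_triangular Z0" and Zp: "\<And>i. i < n \<Longrightarrow> Z0 $$ (i, i) > 0"
      using Z by (auto simp: tri_root_def)
    have Zb: "\<bar>Z0 $$ (i, j)\<bar> \<le> b * Z0 $$ (j, j)" if "i < n" "j < n" for i j
      using Zb0[OF that] Zp[OF that(2)] unfolding b_def by (meson abs_ge_self less_imp_le mult_right_mono order_trans)
    obtain X3 Y3 U where V: "pos_diag n V" and X3: "iwasawa n g X3 Y3" and U: "upper_unipotent n U" "Y3 = U * V * transpose_mat U"
      using asm by (auto simp: iwasawa_diag_def)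
    have Y3: "?Y = U * V * transpose_mat U" using iwasawa_unique[OF X3 iw] U(2) by simp
    show "pos_diag n V" by (rule V)
    have VZ: "V $$ (i, i) = (Z0 $$ (i, i))\<^sup>2" if "i < n" for i
      by (rule iwasawa_diag_root[OF V U(1) Z[unfolded Y3] that])
    then show "i < n \<Longrightarrow> V $$ (i, i) = (Z0 $$ (i, i))\<^sup>2" for i .
    \<comment> \<open>The factor 4/3 for squares is enlarged to 4, which gives the factor 2 for the
      entries themselves.\<close>
    have step: "Z0 $$ (Suc i, Suc i) \<le> 2 * Z0 $$ (i, i)" if "Suc i < n" for i
    proof (rule power2_le_imp_le)
      have "(2 * Z0 $$ (i, i))\<^sup>2 = 4 * (Z0 $$ (i, i))\<^sup>2" by (simp add: power_mult_distrib)
      then show "(Z0 $$ (Suc i, Suc i))\<^sup>2 \<le> (2 * Z0 $$ (i, i))\<^sup>2"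
        using Zm[OF that] zero_le_power2[of "Z0 $$ (Suc i, Suc i)"] by linarith
    qed (use Zp[of i] that in simp)
    have grow: "Z0 $$ (i + d, i + d) \<le> 2 ^ d * Z0 $$ (i, i)" if "i + d < n" for i d
      using that
    proof (induction d)
      case (Suc d)
      then have "Z0 $$ (i + Suc d, i + Suc d) \<le> 2 * Z0 $$ (i + d, i + d)" using step[of "i + d"] by simp
      also have "\<dots> \<le> 2 * (2 ^ d * Z0 $$ (i, i))" using Suc by simp
      finally show ?case by simp
    qed simp
    have Zk: "Z0 $$ (j, j) \<le> 2 ^ n * Z0 $$ (i, i)" if "i \<le> j" "j < n" for i j
    proof -
      have "Z0 $$ (j, j) \<le> 2 ^ (j - i) * Z0 $$ (i, i)" using grow[of i "j - i"] that by simp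
      also have "\<dots> \<le> 2 ^ n * Z0 $$ (i, i)" using Zp[of i] that by (intro mult_right_mono power_increasing) auto
      finally show ?thesis .
    qed
    have Vk4: "V $$ (j, j) \<le> 4 ^ n * V $$ (i, i)" if "i \<le> j" "j < n" for i j
    proof -
      have "(Z0 $$ (j, j))\<^sup>2 \<le> (2 ^ n * Z0 $$ (i, i))\<^sup>2" using Zk[OF that] Zp[OF that(2)] by (intro power_mono) auto
      also have "\<dots> = 4 ^ n * (Z0 $$ (i, i))\<^sup>2" by (simp add: power_mult_distrib power2_eq_square flip: power_mult_distrib)
      finally show ?thesis using VZ that by simp
    qed
    have Vp: "V $$ (i, i) > 0" if "i < n" for i using V that by (simp add: pos_diag_def)
    show "V $$ (j, j) \<le> \<kappa> * V $$ (i, i)" if "i \<le> j \<and> j < n" for i j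
    proof -
      have "V $$ (j, j) \<le> 4 ^ n * V $$ (i, i)" using Vk4 that by blast
      also have "\<dots> \<le> \<kappa> * V $$ (i, i)" using Vp[of i] that L0 by (intro mult_right_mono) (auto simp: \<kappa>_def)
      finally show ?thesis .
    qed
    have Yn: "?Y $$ (n - 1, n - 1) = (Z0 $$ (n - 1, n - 1))\<^sup>2"
    proof -
      have "?Y $$ (n - 1, n - 1) = (\<Sum>k<n. Z0 $$ (n - 1, k) * Z0 $$ (n - 1, k))"
        using Zc n by (simp add: scalar_prod_def lessThan_atLeast0)
      also have "\<dots> = (\<Sum>k\<in>{n - 1}. Z0 $$ (n - 1, k) * Z0 $$ (n - 1, k))"
      proof (rule sum.mono_neutral_right)
        show "\<forall>k\<in>{..<n} - {n - 1}. Z0 $$ (n - 1, k) * Z0 $$ (n - 1, k) = 0"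
        proof
          fix k assume "k \<in> {..<n} - {n - 1}"
          then have "k < n - 1" by auto
          then show "Z0 $$ (n - 1, k) * Z0 $$ (n - 1, k) = 0" using upper_triangularD[OF Zu, of k "n - 1"] Zc n by simp
        qed
      qed (use n in auto)
      finally show ?thesis by (simp add: power2_eq_square)
    qed
    have Xc: "X \<in> carrier_mat n n" "?Y \<in> carrier_mat n n" using X Zc by (auto simp: iwasawa_def sym_mat_def)
    have "\<bar>?Y $$ (n - 1, n - 1)\<bar> \<ge> 3/4" by (rule siegel_last_entry[OF n Xc dt]) (use Xb n in auto)
    then have Vn: "V $$ (n - 1, n - 1) \<ge> 3/4" using VZ[of "n - 1"] n unfolding Yn by simp
    show "1 \<le> \<kappa> * V $$ (i, i)" if i: "i < n" for i
    proof -
      have "1 \<le> 2 * V $$ (n - 1, n - 1)" using Vn by simp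
      also have "\<dots> \<le> 2 * (4 ^ n * V $$ (i, i))" using Vk4[of i "n - 1"] i by simp
      also have "\<dots> = (2 * 4 ^ n) * V $$ (i, i)" by simp
      also have "\<dots> \<le> \<kappa> * V $$ (i, i)" using Vp[OF i] L0 by (intro mult_right_mono) (auto simp: \<kappa>_def)
      finally show ?thesis .
    qed
    show "\<forall>w\<in>carrier_vec n. (\<Sum>i<n. V $$ (i, i) * (w $ i)\<^sup>2) \<le> \<kappa> * scalar_prod (w \<^sub>v* Z0) (w \<^sub>v* Z0)"
    proof
      fix w :: "real Matrix.vec" assume w: "w \<in> carrier_vec n"
      have "(\<Sum>i<n. V $$ (i, i) * (w $ i)\<^sup>2) = (\<Sum>i<n. (Z0 $$ (i, i))\<^sup>2 * (w $ i)\<^sup>2)" using VZ by simp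
      also have "\<dots> \<le> L * scalar_prod (w \<^sub>v* Z0) (w \<^sub>v* Z0)"
        unfolding L_def by (rule triangular_lower_bound[OF Zc Zu Zp Zb _ Zk _ w]) (auto simp: b_def)
      also have "\<dots> \<le> \<kappa> * scalar_prod (w \<^sub>v* Z0) (w \<^sub>v* Z0)"
        unfolding scalar_prod_self_index[OF row_mult_carrier[OF Zc]]
        by (intro mult_right_mono sum_nonneg) (auto simp: \<kappa>_def)
      finally show "(\<Sum>i<n. V $$ (i, i) * (w $ i)\<^sup>2) \<le> \<kappa> * scalar_prod (w \<^sub>v* Z0) (w \<^sub>v* Z0)" .
    qed
  qed
qed

section \<open>The block decomposition\<close>

lemma n_mat_carrier [simp]: "X \<in> carrier_mat n n \<Longrightarrow> n_mat n X \<in> carrier_mat (n + n) (n + n)"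
  by (simp add: n_mat_def)

lemma a_mat_carrier [simp]:
  "Z \<in> carrier_mat n n \<Longrightarrow> mat_inv (transpose_mat Z) \<in> carrier_mat n n \<Longrightarrow> a_mat n Z \<in> carrier_mat (n + n) (n + n)"
  by (simp add: a_mat_def)

lemma zero_block_rules:
  assumes "Y \<in> carrier_mat n m"
  shows "0\<^sub>m n m + Y = (Y :: real mat)" "Y + 0\<^sub>m n m = Y" "Y * 0\<^sub>m m k = 0\<^sub>m n k" "0\<^sub>m k n * Y = 0\<^sub>m k m" "Y * 1\<^sub>m m = Y" "1\<^sub>m n * Y = Y"
  using assms by simp_all

lemma n_mat_mult:
  assumes X: "X \<in> carrier_mat n n" and X': "X' \<in> carrier_mat n n"
  shows "n_mat n X * n_mat n X' = n_mat n (X + X')"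
proof -
  have O: "0\<^sub>m n n \<in> carrier_mat n n" by simp
  note z = zero_block_rules[OF X] zero_block_rules[OF X'] zero_block_rules[OF O] zero_block_rules[OF one_carrier_mat[of n]]
  have "X' + X = X + X'" using X X' by (rule comm_add_mat[rotated])
  then show ?thesis
    unfolding n_mat_def mult_four_block_mat[OF one_carrier_mat X O one_carrier_mat one_carrier_mat X' O one_carrier_mat] z by simp
qed

lemma a_mat_mult:
  assumes Z: "Z \<in> carrier_mat n n" "Determinant.det Z \<noteq> 0" and Z': "Z' \<in> carrier_mat n n" "Determinant.det Z' \<noteq> 0"
  shows "a_mat n Z * a_mat n Z' = a_mat n (Z * Z')"
proof -
  have Zt: "transpose_mat Z \<in> carrier_mat n n" "transpose_mat Z' \<in> carrier_mat n n" using Z(1) Z'(1) by simp_all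
  have d: "Determinant.det (transpose_mat Z) \<noteq> 0" "Determinant.det (transpose_mat Z') \<noteq> 0" using Z Z' by (simp_all add: det_transpose)
  note i = mat_inv[OF Zt(1) d(1)] and i' = mat_inv[OF Zt(2) d(2)]
  have O: "0\<^sub>m n n \<in> carrier_mat n n" by simp
  have inv: "mat_inv (transpose_mat (Z * Z')) = mat_inv (transpose_mat Z) * mat_inv (transpose_mat Z')"
  proof (rule mat_inv_unique)
    show "transpose_mat (Z * Z') \<in> carrier_mat n n" using Z(1) Z'(1) by simp
    show "mat_inv (transpose_mat Z) * mat_inv (transpose_mat Z') \<in> carrier_mat n n" using i(3) i'(3) by simp
    have "transpose_mat (Z * Z') * (mat_inv (transpose_mat Z) * mat_inv (transpose_mat Z'))
      = transpose_mat Z' * (transpose_mat Z * (mat_inv (transpose_mat Z) * mat_inv (transpose_mat Z')))"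
      unfolding transpose_mult[OF Z(1) Z'(1)] by (rule assoc_mult_mat[OF Zt(2) Zt(1) mult_carrier_mat[OF i(3) i'(3)]])
    also have "transpose_mat Z * (mat_inv (transpose_mat Z) * mat_inv (transpose_mat Z')) = transpose_mat Z * mat_inv (transpose_mat Z) * mat_inv (transpose_mat Z')"
      by (rule assoc_mult_mat[symmetric, OF Zt(1) i(3) i'(3)])
    also have "\<dots> = mat_inv (transpose_mat Z')" unfolding i(1) using i'(3) by simp
    finally show "transpose_mat (Z * Z') * (mat_inv (transpose_mat Z) * mat_inv (transpose_mat Z')) = 1\<^sub>m n" unfolding i'(1) .
  qed
  show ?thesis
    unfolding a_mat_def inv mult_four_block_mat[OF Z(1) O O i(3) Z'(1) O O i'(3)]
      zero_block_rules[OF Z(1)] zero_block_rules[OF Z'(1)] zero_block_rules[OF i(3)] zero_block_rules[OF i'(3)]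
      zero_block_rules[OF mult_carrier_mat[OF Z(1) Z'(1)]] zero_block_rules[OF mult_carrier_mat[OF i(3) i'(3)]] zero_block_rules[OF O] ..
qed

text \<open>Conjugation by a(Z) preserves the group of the n(X). This is what brings the second and
  third factors of the decomposition into Iwasawa order.\<close>

lemma a_mat_n_mat_commute:
  assumes Z: "Z \<in> carrier_mat n n" "Determinant.det Z \<noteq> 0" and X: "X \<in> carrier_mat n n"
  shows "a_mat n Z * n_mat n X = n_mat n (Z * X * transpose_mat Z) * a_mat n Z"
proof -
  have Zt: "transpose_mat Z \<in> carrier_mat n n" using Z(1) by simp
  have d: "Determinant.det (transpose_mat Z) \<noteq> 0" using Z by (simp add: det_transpose)
  note i = mat_inv[OF Zt d]
  have O: "0\<^sub>m n n \<in> carrier_mat n n" by simp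
  have ZX: "Z * X \<in> carrier_mat n n" using Z(1) X by simp
  have ZXZ: "Z * X * transpose_mat Z \<in> carrier_mat n n" using ZX Zt by simp
  have "Z * X * transpose_mat Z * mat_inv (transpose_mat Z) = Z * X * (transpose_mat Z * mat_inv (transpose_mat Z))"
    by (rule assoc_mult_mat[OF ZX Zt i(3)])
  then have e: "Z * X * transpose_mat Z * mat_inv (transpose_mat Z) = Z * X" unfolding i(1) right_mult_one_mat[OF ZX] .
  have "a_mat n Z * n_mat n X = four_block_mat Z (Z * X) (0\<^sub>m n n) (mat_inv (transpose_mat Z))"
    unfolding a_mat_def n_mat_def mult_four_block_mat[OF Z(1) O O i(3) one_carrier_mat X O one_carrier_mat]
      zero_block_rules[OF Z(1)] zero_block_rules[OF X] zero_block_rules[OF i(3)] zero_block_rules[OF ZX] zero_block_rules[OF O] ..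
  then show ?thesis unfolding na_mat[OF ZXZ Z(1) i(3)] e .
qed

text \<open>The blocks of the four factors to the left of k(Q); neither g nor Q enters. The primed
  matrices defined below are their n \<times> n assemblies, and Z0 and X0 the resulting Iwasawa
  coordinates.\<close>

locale block_factors =
  fixes n l :: nat and T S U P X Vl Yl Z :: "real mat"
  assumes l: "l \<le> n" and T: "sym_mat l T" and S: "S \<in> carrier_mat l (n - l)"
    and U: "upper_unipotent l U" and P: "P \<in> carrier_mat l (n - l)"
    and X: "sym_mat (n - l) X" and Vl: "pos_diag l Vl" and Z: "tri_root (n - l) Yl Z"
begin

definition T' where "T' = four_block_mat T S (transpose_mat S) (0\<^sub>m (n - l) (n - l))"
definition U' where "U' = four_block_mat U P (0\<^sub>m (n - l) l) (1\<^sub>m (n - l))"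
definition X'' where "X'' = blk_diag (0\<^sub>m l l) X"
definition W where "W = map_mat sqrt Vl"
definition W' where "W' = blk_diag W Z"
definition Z0 where "Z0 = U' * W'"
definition X0 where "X0 = T' + U' * X'' * transpose_mat U'"

lemma carriers:
  "T \<in> carrier_mat l l" "U \<in> carrier_mat l l" "X \<in> carrier_mat (n - l) (n - l)" "W \<in> carrier_mat l l"
  "Z \<in> carrier_mat (n - l) (n - l)" "T' \<in> carrier_mat n n" "U' \<in> carrier_mat n n" "X'' \<in> carrier_mat n n"
  "W' \<in> carrier_mat n n" "Z0 \<in> carrier_mat n n" "X0 \<in> carrier_mat n n"
proof -
  have nl: "l + (n - l) = n" using l by simp
  show c: "T \<in> carrier_mat l l" "U \<in> carrier_mat l l" "X \<in> carrier_mat (n - l) (n - l)" "W \<in> carrier_mat l l"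
    "Z \<in> carrier_mat (n - l) (n - l)"
    using T U X Vl Z by (auto simp: sym_mat_def upper_unipotent_def pos_diag_def tri_root_def W_def)
  show "T' \<in> carrier_mat n n" unfolding T'_def using four_block_carrier_mat[OF c(1), of "0\<^sub>m (n - l) (n - l)" "n - l" "n - l"] nl by simp
  show U': "U' \<in> carrier_mat n n" unfolding U'_def using four_block_carrier_mat[OF c(2) one_carrier_mat[of "n - l"]] nl by simp
  show X'': "X'' \<in> carrier_mat n n" unfolding X''_def using blk_diag_carrier[OF zero_carrier_mat[of l l] c(3)] nl by simp
  show W': "W' \<in> carrier_mat n n" unfolding W'_def using blk_diag_carrier[OF c(4,5)] nl by simp
  show "Z0 \<in> carrier_mat n n" unfolding Z0_def using U' W' by simp
  show "X0 \<in> carrier_mat n n" unfolding X0_def using U' X'' \<open>T' \<in> carrier_mat n n\<close> by simp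
qed

lemma Wdiag: "i < l \<Longrightarrow> j < l \<Longrightarrow> W $$ (i, j) = (if i = j then sqrt (Vl $$ (i, i)) else 0)"
  using Vl by (auto simp: W_def pos_diag_def diagonal_mat_def)

lemma Wt: "transpose_mat W = W"
  using carriers(4) by (intro eq_matI) (auto simp: Wdiag)

lemma triangular_U': "upper_triangular U'" "\<And>i. i < n \<Longrightarrow> U' $$ (i, i) = 1"
proof -
  have Ut: "upper_triangular U" and U1: "\<And>i. i < l \<Longrightarrow> U $$ (i, i) = 1" using U by (auto simp: upper_unipotent_def)
  show "upper_triangular U'"
    by (rule upper_triangularI) (use carriers l upper_triangularD[OF Ut] P in \<open>auto simp: U'_def\<close>)
  show "U' $$ (i, i) = 1" if "i < n" for i using that carriers l U1 P by (auto simp: U'_def)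
qed

lemma triangular_W': "upper_triangular W'" "\<And>i. i < n \<Longrightarrow> W' $$ (i, i) = (if i < l then sqrt (Vl $$ (i, i)) else Z $$ (i - l, i - l))"
proof -
  have Zt: "upper_triangular Z" using Z by (simp add: tri_root_def)
  show "upper_triangular W'"
    by (rule upper_triangularI) (use carriers l upper_triangularD[OF Zt] in \<open>auto simp: W'_def blk_diag_def Wdiag\<close>)
  show "W' $$ (i, i) = (if i < l then sqrt (Vl $$ (i, i)) else Z $$ (i - l, i - l))" if "i < n" for i
    using that carriers l by (auto simp: W'_def blk_diag_def Wdiag)
qed

lemma W'_pos: "i < n \<Longrightarrow> W' $$ (i, i) > 0"
  using triangular_W'(2)[of i] Vl Z l by (auto simp: pos_diag_def tri_root_def)

text \<open>U' is unipotent, so determinants see only W'. The product formula for det Y_l allows it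
  to be estimated by diagonal entries of V later.\<close>

lemma dets: "Determinant.det U' = 1" "Determinant.det W' > 0" "Determinant.det W' = Determinant.det Z0"
    "Determinant.det Z0 = sqrt (Determinant.det Vl) * sqrt (Determinant.det Yl)" "Determinant.det Vl > 0" "Determinant.det Yl > 0"
    "Determinant.det Yl = (\<Prod>j<n - l. (Z $$ (j, j))\<^sup>2)"
proof -
  show U1: "Determinant.det U' = 1"
    using det_triangular_pos(2)[OF carriers(7) triangular_U'(1)] triangular_U'(2) by simp
  show Wp: "Determinant.det W' > 0"
    by (rule det_triangular_pos(1)[OF carriers(9) triangular_W'(1)]) (rule W'_pos)
  show "Determinant.det W' = Determinant.det Z0" unfolding Z0_def det_mult[OF carriers(7,9)] U1 by simp
  have V: "Vl \<in> carrier_mat l l" "diagonal_mat Vl" "\<And>i. i < l \<Longrightarrow> Vl $$ (i, i) > 0" using Vl by (auto simp: pos_diag_def)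
  have Vu: "upper_triangular Vl" by (rule upper_triangularI) (use V in \<open>auto simp: diagonal_mat_def\<close>)
  have dV: "Determinant.det Vl = (\<Prod>i<l. Vl $$ (i, i))" by (rule det_triangular_pos(2)[OF V(1) Vu]) (rule V(3))
  show "Determinant.det Vl > 0" by (rule det_triangular_pos(1)[OF V(1) Vu]) (rule V(3))
  have Zt: "upper_triangular Z" "\<And>i. i < n - l \<Longrightarrow> Z $$ (i, i) > 0" "Yl = Z * transpose_mat Z" using Z by (auto simp: tri_root_def)
  have dZ: "Determinant.det Z = (\<Prod>i<n - l. Z $$ (i, i))" by (rule det_triangular_pos(2)[OF carriers(5) Zt(1)]) (rule Zt(2))
  have dZp: "Determinant.det Z > 0" by (rule det_triangular_pos(1)[OF carriers(5) Zt(1)]) (rule Zt(2))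
  have dY: "Determinant.det Yl = (Determinant.det Z)\<^sup>2"
    unfolding Zt(3) using det_mult[OF carriers(5), of "transpose_mat Z"] det_transpose[OF carriers(5)] carriers(5)
    by (simp add: power2_eq_square)
  then show "Determinant.det Yl > 0" using dZp by simp
  show "Determinant.det Yl = (\<Prod>j<n - l. (Z $$ (j, j))\<^sup>2)"
    unfolding dY dZ by (rule prod_power_distrib)
  have "Determinant.det Z0 = Determinant.det W'" unfolding Z0_def det_mult[OF carriers(7,9)] U1 by simp
  also have "\<dots> = Determinant.det W * Determinant.det Z"
    unfolding W'_def blk_diag_def using carriers by (intro det_four_block_mat_lower_left_zero[of _ l _ "n - l"]) auto
  also have "Determinant.det W = (\<Prod>i<l. W $$ (i, i))"
    by (rule det_triangular_pos(2)[OF carriers(4)]) (use carriers(4) V in \<open>auto simp: Wdiag intro!: upper_triangularI\<close>)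
  also have "\<dots> = sqrt (Determinant.det Vl)"
  proof -
    have "(\<Prod>i<k. sqrt (q i)) = sqrt (\<Prod>i<k. q i)" for k and q :: "nat \<Rightarrow> real"
      by (induction k) (simp_all add: real_sqrt_mult)
    then show ?thesis unfolding dV by (simp add: Wdiag)
  qed
  also have "Determinant.det Z = sqrt (Determinant.det Yl)" unfolding dY using dZp by simp
  finally show "Determinant.det Z0 = sqrt (Determinant.det Vl) * sqrt (Determinant.det Yl)" .
qed

lemma Z0_diag: "i < n \<Longrightarrow> Z0 $$ (i, i) = W' $$ (i, i)"
proof -
  assume i: "i < n"
  have "Z0 $$ (i, i) = (\<Sum>k<n. U' $$ (i, k) * W' $$ (k, i))"
    unfolding Z0_def using carriers(7,9) i by (simp add: scalar_prod_def lessThan_atLeast0)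
  also have "\<dots> = (\<Sum>k\<in>{i}. U' $$ (i, k) * W' $$ (k, i))"
  proof (rule sum.mono_neutral_right)
    show "\<forall>k\<in>{..<n} - {i}. U' $$ (i, k) * W' $$ (k, i) = 0"
    proof
      fix k assume "k \<in> {..<n} - {i}"
      then consider "k < i" | "i < k" "k < n" by fastforce
      then show "U' $$ (i, k) * W' $$ (k, i) = 0"
        using upper_triangularD[OF triangular_U'(1)] upper_triangularD[OF triangular_W'(1)] carriers(7,9) i by cases auto
    qed
  qed (use i in auto)
  finally show ?thesis using triangular_U'(2)[OF i] by simp
qed

lemma Z0_root: "tri_root n (Z0 * transpose_mat Z0) Z0"
proof -
  have "upper_triangular Z0"
  proof (rule upper_triangularI)
    fix i j assume "j < i" "i < dim_row Z0"
    then have ij: "j < i" "i < n" using carriers(10) by auto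
    have "Z0 $$ (i, j) = (\<Sum>k<n. U' $$ (i, k) * W' $$ (k, j))"
      unfolding Z0_def using carriers(7,9) ij by (simp add: scalar_prod_def lessThan_atLeast0)
    also have "\<dots> = 0"
    proof (rule sum.neutral, rule ballI)
      fix k assume "k \<in> {..<n}"
      then consider "k < i" "k < n" | "j < k" "k < n" using ij by fastforce
      then show "U' $$ (i, k) * W' $$ (k, j) = 0"
        using upper_triangularD[OF triangular_U'(1)] upper_triangularD[OF triangular_W'(1)] carriers(7,9) ij by cases auto
    qed
    finally show "Z0 $$ (i, j) = 0" .
  qed
  then show ?thesis using carriers(10) Z0_diag W'_pos by (auto simp: tri_root_def)
qed

lemma T'_sym: "transpose_mat T' = T'"
proof -
  have "transpose_mat T' = four_block_mat (transpose_mat T) (transpose_mat (transpose_mat S)) (transpose_mat S) (transpose_mat (0\<^sub>m (n - l) (n - l)))"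
    unfolding T'_def by (rule transpose_four_block_mat[OF carriers(1) S]) (use S in auto)
  then show ?thesis using T by (simp add: sym_mat_def T'_def)
qed

lemma X0_sym: "sym_mat n X0"
proof -
  have nl: "l + (n - l) = n" using l by simp
  have Xt: "transpose_mat X = X" using X by (simp add: sym_mat_def)
  have dX: "dim_row X = n - l" "dim_col X = n - l" using carriers(3) by auto
  have "transpose_mat X'' = four_block_mat (transpose_mat (0\<^sub>m l l)) (transpose_mat (0\<^sub>m (n - l) l)) (transpose_mat (0\<^sub>m l (n - l))) (transpose_mat X)"
    unfolding X''_def blk_diag_def dX index_zero_mat by (rule transpose_four_block_mat) (use carriers(3) in auto)
  then have X''t: "transpose_mat X'' = X''" by (simp add: Xt X''_def blk_diag_def dX)
  have U't: "transpose_mat U' \<in> carrier_mat n n" using carriers(7) by simp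
  have UX: "U' * X'' \<in> carrier_mat n n" using carriers by simp
  have "transpose_mat (U' * X'' * transpose_mat U') = transpose_mat (transpose_mat U') * transpose_mat (U' * X'')"
    by (rule transpose_mult[OF UX U't])
  also have "transpose_mat (U' * X'') = X'' * transpose_mat U'" using transpose_mult[OF carriers(7,8)] X''t by simp
  also have "transpose_mat (transpose_mat U') * (X'' * transpose_mat U') = U' * X'' * transpose_mat U'"
    using assoc_mult_mat[OF carriers(7,8) U't] by simp
  finally have "transpose_mat (U' * X'' * transpose_mat U') = U' * X'' * transpose_mat U'" .
  then have "transpose_mat X0 = X0" unfolding X0_def
    using transpose_add[OF carriers(6), of "U' * X'' * transpose_mat U'"] UX U't T'_sym by simp
  then show ?thesis using carriers(11) by (simp add: sym_mat_def)
qed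

lemma F1_eq: "F1 n l T S = n_mat n T'"
  by (simp add: F1_def n_mat_def T'_def)

lemma F3_eq: "F3 n l X = n_mat n X''"
  by (simp add: F3_def n_mat_def X''_def)

text \<open>Shows that the lower right block written out in \<open>F2\<close> is the inverse
  transpose of the upper left one, so that \<open>F2\<close> has the form a(U').\<close>

lemma U'_inv: "mat_inv (transpose_mat U') = four_block_mat (mat_inv (transpose_mat U)) (0\<^sub>m l (n - l))
        (- (transpose_mat P * mat_inv (transpose_mat U))) (1\<^sub>m (n - l))"
proof (rule mat_inv_unique)
  have nl: "l + (n - l) = n" using l by simp
  have Ut: "upper_triangular U" and U1: "\<And>i. i < l \<Longrightarrow> U $$ (i, i) = 1" using U by (auto simp: upper_unipotent_def)
  have "Determinant.det U > 0" by (rule det_triangular_pos(1)[OF carriers(2) Ut]) (simp add: U1)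
  then have "Determinant.det (transpose_mat U) \<noteq> 0" using det_transpose[OF carriers(2)] by simp
  moreover have Uc: "transpose_mat U \<in> carrier_mat l l" using carriers(2) by simp
  ultimately have i: "transpose_mat U * mat_inv (transpose_mat U) = 1\<^sub>m l" "mat_inv (transpose_mat U) \<in> carrier_mat l l"
    using mat_inv by blast+
  show "transpose_mat U' \<in> carrier_mat n n" using carriers(7) by simp
  have Pt: "transpose_mat P \<in> carrier_mat (n - l) l" using P by simp
  have PU: "transpose_mat P * mat_inv (transpose_mat U) \<in> carrier_mat (n - l) l" using Pt i(2) by simp
  then have mPU: "- (transpose_mat P * mat_inv (transpose_mat U)) \<in> carrier_mat (n - l) l" by simp
  have O: "0\<^sub>m l (n - l) \<in> carrier_mat l (n - l)" "0\<^sub>m (n - l) l \<in> carrier_mat (n - l) l" by simp_all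
  show "four_block_mat (mat_inv (transpose_mat U)) (0\<^sub>m l (n - l)) (- (transpose_mat P * mat_inv (transpose_mat U))) (1\<^sub>m (n - l)) \<in> carrier_mat n n"
    using four_block_carrier_mat[OF i(2) one_carrier_mat[of "n - l"]] nl by simp
  have t: "transpose_mat U' = four_block_mat (transpose_mat U) (0\<^sub>m l (n - l)) (transpose_mat P) (1\<^sub>m (n - l))"
    unfolding U'_def transpose_four_block_mat[OF carriers(2) P O(2) one_carrier_mat] by simp
  have m: "0\<^sub>m l (n - l) * - (transpose_mat P * mat_inv (transpose_mat U)) = 0\<^sub>m l l"
     "transpose_mat P * mat_inv (transpose_mat U) + 1\<^sub>m (n - l) * - (transpose_mat P * mat_inv (transpose_mat U)) = 0\<^sub>m (n - l) l"
     "transpose_mat U * 0\<^sub>m l (n - l) + 0\<^sub>m l (n - l) * 1\<^sub>m (n - l) = 0\<^sub>m l (n - l)"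
     "transpose_mat P * 0\<^sub>m l (n - l) + 1\<^sub>m (n - l) * 1\<^sub>m (n - l) = 1\<^sub>m (n - l)" "1\<^sub>m l + 0\<^sub>m l l = (1\<^sub>m l :: real mat)"
  proof -
    show "0\<^sub>m l (n - l) * - (transpose_mat P * mat_inv (transpose_mat U)) = 0\<^sub>m l l" by (rule left_mult_zero_mat[OF mPU])
    show "transpose_mat P * mat_inv (transpose_mat U) + 1\<^sub>m (n - l) * - (transpose_mat P * mat_inv (transpose_mat U)) = 0\<^sub>m (n - l) l"
    proof -
      have "Y + - Y = 0\<^sub>m (n - l) l" if "Y \<in> carrier_mat (n - l) l" for Y :: "real mat"
        using that by (intro eq_matI) auto
      from this[OF PU] show ?thesis unfolding left_mult_one_mat[OF mPU] .
    qed
  qed (use Uc Pt in simp_all)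
  show "transpose_mat U' * four_block_mat (mat_inv (transpose_mat U)) (0\<^sub>m l (n - l)) (- (transpose_mat P * mat_inv (transpose_mat U))) (1\<^sub>m (n - l)) = 1\<^sub>m n"
    unfolding t mult_four_block_mat[OF Uc O(1) Pt one_carrier_mat i(2) O(1) mPU one_carrier_mat] i(1) m
    using nl by (intro eq_matI) auto
qed

lemma F2_eq: "F2 n l U P = a_mat n U'"
  by (simp add: F2_def a_mat_def U'_inv) (simp add: U'_def)

lemma W'_inv: "mat_inv (transpose_mat W') = blk_diag (mat_inv W) (mat_inv (transpose_mat Z))"
proof (rule mat_inv_unique)
  have nl: "l + (n - l) = n" using l by simp
  have O: "0\<^sub>m l (n - l) \<in> carrier_mat l (n - l)" "0\<^sub>m (n - l) l \<in> carrier_mat (n - l) l" by simp_all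
  have "Determinant.det W > 0"
    by (rule det_triangular_pos(1)[OF carriers(4)]) (use carriers(4) Vl in \<open>auto simp: Wdiag pos_diag_def intro!: upper_triangularI\<close>)
  then have i: "W * mat_inv W = 1\<^sub>m l" "mat_inv W \<in> carrier_mat l l" using mat_inv[OF carriers(4)] by simp_all
  note z = tri_root_inv[OF Z]
  have Zt: "transpose_mat Z \<in> carrier_mat (n - l) (n - l)" using z(1) by simp
  have d: "dim_row W = l" "dim_col W = l" "dim_row Z = n - l" "dim_col Z = n - l"
    "dim_row (mat_inv W) = l" "dim_col (mat_inv W) = l" "dim_row (mat_inv (transpose_mat Z)) = n - l" "dim_col (mat_inv (transpose_mat Z)) = n - l"
    using carriers(4,5) i(2) z(3) by auto
  show "transpose_mat W' \<in> carrier_mat n n" using carriers(9) by simp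
  show "blk_diag (mat_inv W) (mat_inv (transpose_mat Z)) \<in> carrier_mat n n" using blk_diag_carrier[OF i(2) z(3)] nl by simp
  have t: "transpose_mat W' = four_block_mat W (0\<^sub>m l (n - l)) (0\<^sub>m (n - l) l) (transpose_mat Z)"
    unfolding W'_def blk_diag_def d transpose_four_block_mat[OF carriers(4) O carriers(5)] Wt by simp
  show "transpose_mat W' * blk_diag (mat_inv W) (mat_inv (transpose_mat Z)) = 1\<^sub>m n"
    unfolding t blk_diag_def d mult_four_block_mat[OF carriers(4) O Zt i(2) O z(3)] i(1) z(4)
      zero_block_rules[OF O(1)] zero_block_rules[OF O(2)] zero_block_rules[OF carriers(4)] zero_block_rules[OF Zt]
      zero_block_rules[OF i(2)] zero_block_rules[OF z(3)] zero_block_rules[OF one_carrier_mat]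
      zero_block_rules[OF zero_carrier_mat]
    using nl by (intro eq_matI) auto
qed

lemma F4_eq: "F4 n W Z = a_mat n W'"
proof -
  have d: "dim_row W' = n" "dim_col W' = n" using carriers(9) by auto
  have "mat_inv (transpose_mat W') \<in> carrier_mat n n"
    using tri_root_inv(3)[of n "W' * transpose_mat W'" W'] carriers(9) triangular_W'(1) W'_pos by (auto simp: tri_root_def)
  then have d2: "dim_row (mat_inv (transpose_mat W')) = n" "dim_col (mat_inv (transpose_mat W')) = n" by auto
  have "F4 n W Z = blk_diag W' (mat_inv (transpose_mat W'))"
    by (simp only: F4_def W'_inv) (simp only: W'_def)
  then show ?thesis unfolding a_mat_def blk_diag_def[of W'] d d2 .
qed

text \<open>The factors are n(T') a(U') n(X'') a(W'). Moving n(X'') to the left past a(U')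
  conjugates X'' by U', and then the two unipotent and the two triangular factors merge.\<close>

lemma factorization: "F1 n l T S * F2 n l U P * F3 n l X * F4 n W Z = n_mat n X0 * a_mat n Z0"
proof -
  have dU: "Determinant.det U' \<noteq> 0" and dW: "Determinant.det W' \<noteq> 0" using dets(1,2) by simp_all
  have dUt: "Determinant.det (transpose_mat U') \<noteq> 0" and dWt: "Determinant.det (transpose_mat W') \<noteq> 0"
    using dU dW det_transpose[OF carriers(7)] det_transpose[OF carriers(9)] by simp_all
  have ic: "mat_inv (transpose_mat U') \<in> carrier_mat n n" "mat_inv (transpose_mat W') \<in> carrier_mat n n"
    using mat_inv(3)[OF _ dUt] mat_inv(3)[OF _ dWt] carriers(7,9) by simp_all
  have UXU: "U' * X'' * transpose_mat U' \<in> carrier_mat n n" using carriers(7,8) by simp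
  note nT = n_mat_carrier[OF carriers(6)] and nX = n_mat_carrier[OF carriers(8)] and nU = n_mat_carrier[OF UXU]
    and aU = a_mat_carrier[OF carriers(7) ic(1)] and aW = a_mat_carrier[OF carriers(9) ic(2)]
  have "n_mat n T' * a_mat n U' * n_mat n X'' = n_mat n T' * (a_mat n U' * n_mat n X'')"
    by (rule assoc_mult_mat[OF nT aU nX])
  also have "\<dots> = n_mat n T' * n_mat n (U' * X'' * transpose_mat U') * a_mat n U'"
    unfolding a_mat_n_mat_commute[OF carriers(7) dU carriers(8)] by (rule assoc_mult_mat[symmetric, OF nT nU aU])
  also have "n_mat n T' * n_mat n (U' * X'' * transpose_mat U') = n_mat n X0"
    unfolding X0_def by (rule n_mat_mult[OF carriers(6) UXU])
  finally have "n_mat n T' * a_mat n U' * n_mat n X'' * a_mat n W' = n_mat n X0 * a_mat n U' * a_mat n W'" by simp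
  also have "\<dots> = n_mat n X0 * (a_mat n U' * a_mat n W')"
    by (rule assoc_mult_mat[OF n_mat_carrier[OF carriers(11)] aU aW])
  finally show ?thesis unfolding F1_eq F2_eq F3_eq F4_eq Z0_def a_mat_mult[OF carriers(7) dU carriers(9) dW] .
qed

end

section \<open>The theta function\<close>

text \<open>The phase convention and the parabolic formula give this almost everywhere. Both sides
  are continuous, so it holds at each point, which is essential because the theta series samples a
  null set.\<close>

lemma (in segal_shale_weil) R_iwasawa:
  assumes X: "sym_mat n X" and Z: "tri_root n Y Z" and Q: "Q \<in> unitary_mats n" and f: "schwartz n f"
    and g: "g = n_mat n X * a_mat n Z * k_mat Q" "g \<in> Sp n" and x: "x \<in> carrier_vec n"
  shows "R g f x = of_real (sqrt (Determinant.det Z)) * ee (scalar_prod (x \<^sub>v* X) x / 2) * R (k_mat Q) f (x \<^sub>v* Z)"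
proof -
  let ?F = "R (k_mat Q) f"
  note z = tri_root_inv[OF Z]
  have kS: "k_mat Q \<in> Sp n" by (rule k_mat_props(1)[OF Q])
  have fL: "f \<in> L2 n" by (rule rapid_L2[OF schwartz_rapid[OF f]])
  have FL: "?F \<in> L2 n" by (rule in_L2[OF kS fL])
  have Xc: "X \<in> carrier_mat n n" using X by (simp add: sym_mat_def)
  let ?D = "mat_inv (transpose_mat Z)"
  have XD: "X * ?D \<in> carrier_mat n n" using Xc z(3) by simp
  have "ae_eq n (R (n_mat n X * a_mat n Z) ?F)
    (\<lambda>x. of_real (sqrt \<bar>Determinant.det Z\<bar>) * ee (scalar_prod (x \<^sub>v* (Z * transpose_mat (X * ?D))) x / 2) * ?F (x \<^sub>v* Z))"
    by (rule parabolic[OF z(1) XD na_mat[OF Xc z(1) z(3)] _ na_mat_Sp(1)[OF X Z] FL]) (use z(2) in simp)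
  then have "ae_eq n (R (n_mat n X * a_mat n Z) ?F)
    (\<lambda>x. of_real (sqrt (Determinant.det Z)) * ee (scalar_prod (x \<^sub>v* X) x / 2) * ?F (x \<^sub>v* Z))"
    unfolding na_mat_Sp(2)[OF X Z] using z(2) by simp
  then have ae: "ae_eq n (R g f) (\<lambda>x. of_real (sqrt (Determinant.det Z)) * ee (scalar_prod (x \<^sub>v* X) x / 2) * ?F (x \<^sub>v* Z))"
    unfolding g(1) by (rule ae_eq_trans[OF iwasawa_phase[OF X Z Q fL]])
  have lin: "Matrix.vec n u \<^sub>v* M = Matrix.vec n (\<lambda>j. \<Sum>i<n. u i * M $$ (i, j))" if "M \<in> carrier_mat n n" for M u
    using that by (intro eq_vecI) (simp_all add: row_mult_index[of _ n M n])
  have "continuous_on UNIV (\<lambda>u :: nat \<Rightarrow> real. \<lambda>j. \<Sum>i<n. u i * Z $$ (i, j))"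
  proof (rule continuous_on_coordinatewise_then_product)
    fix j show "continuous_on UNIV (\<lambda>u :: nat \<Rightarrow> real. \<Sum>i<n. u i * Z $$ (i, j))"
      by (intro continuous_on_sum continuous_on_mult continuous_on_const continuous_on_product_coordinates)
  qed
  from continuous_on_compose2[OF continuous_rep[OF kS f, unfolded continuous_vec_def] this]
  have c1: "continuous_on UNIV (\<lambda>u. ?F (Matrix.vec n u \<^sub>v* Z))" unfolding lin[OF z(1)] by simp
  have "continuous_on UNIV (\<lambda>u :: nat \<Rightarrow> real. \<Sum>j<n. (\<Sum>i<n. u i * X $$ (i, j)) * u j)"
    by (intro continuous_on_sum continuous_on_mult continuous_on_const continuous_on_product_coordinates)
  then have c2: "continuous_on UNIV (\<lambda>u :: nat \<Rightarrow> real. scalar_prod (Matrix.vec n u \<^sub>v* X) (Matrix.vec n u))"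
    unfolding lin[OF Xc] by (simp add: scalar_prod_def lessThan_atLeast0)
  have "continuous_vec n (\<lambda>x. of_real (sqrt (Determinant.det Z)) * ee (scalar_prod (x \<^sub>v* X) x / 2) * ?F (x \<^sub>v* Z))"
    unfolding continuous_vec_def
    by (intro continuous_on_mult continuous_on_const continuous_on_ee continuous_on_divide c1 c2) auto
  then show ?thesis by (rule ae_eq_continuous_vec[OF continuous_rep[OF g(2) f] _ ae x])
qed

context block_factors
begin

lemma z_eq:
  assumes x: "x \<in> carrier_vec n" and y: "y \<in> carrier_vec n"
  shows "(x @\<^sub>v y) \<^sub>v* (F1 n l T S * F2 n l U P) = (x \<^sub>v* U') @\<^sub>v ((x \<^sub>v* T' + y) \<^sub>v* mat_inv (transpose_mat U'))"
proof -
  have dUt: "Determinant.det (transpose_mat U') \<noteq> 0" using dets(1) det_transpose[OF carriers(7)] by simp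
  have Ut: "transpose_mat U' \<in> carrier_mat n n" using carriers(7) by simp
  note ic = mat_inv(3)[OF Ut dUt]
  have O: "0\<^sub>m n n \<in> carrier_mat n n" by simp
  have xy: "x @\<^sub>v y \<in> carrier_vec (n + n)" using x y by simp
  have xT: "x \<^sub>v* T' + y \<in> carrier_vec n" using row_mult_carrier[OF carriers(6)] y by simp
  have "(x @\<^sub>v y) \<^sub>v* (F1 n l T S * F2 n l U P) = ((x @\<^sub>v y) \<^sub>v* n_mat n T') \<^sub>v* a_mat n U'"
    unfolding F1_eq F2_eq by (rule row_mult_assoc[OF xy n_mat_carrier[OF carriers(6)] a_mat_carrier[OF carriers(7) ic]])
  also have "(x @\<^sub>v y) \<^sub>v* n_mat n T' = (x \<^sub>v* 1\<^sub>m n + y \<^sub>v* 0\<^sub>m n n) @\<^sub>v (x \<^sub>v* T' + y \<^sub>v* 1\<^sub>m n)"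
    unfolding n_mat_def by (rule row_mult_four_block[OF one_carrier_mat carriers(6) O one_carrier_mat x y])
  also have "\<dots> = x @\<^sub>v (x \<^sub>v* T' + y)" using x y by simp
  also have "\<dots> \<^sub>v* a_mat n U' = (x \<^sub>v* U' + (x \<^sub>v* T' + y) \<^sub>v* 0\<^sub>m n n) @\<^sub>v (x \<^sub>v* 0\<^sub>m n n + (x \<^sub>v* T' + y) \<^sub>v* mat_inv (transpose_mat U'))"
    unfolding a_mat_def by (rule row_mult_four_block[OF carriers(7) O O ic x xT])
  also have "\<dots> = (x \<^sub>v* U') @\<^sub>v ((x \<^sub>v* T' + y) \<^sub>v* mat_inv (transpose_mat U'))"
    unfolding row_mult_zero_mat[OF xT] row_mult_zero_mat[OF x]
    using row_mult_carrier[OF carriers(7), of x] row_mult_carrier[OF ic, of "x \<^sub>v* T' + y"] by simp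
  finally show ?thesis .
qed

text \<open>For m = (0, m2), the matrix U' fixes m, and m T' m^T vanishes because the lower right
  block of T' is zero. The only terms quadratic in m2 therefore come from X, while T' contributes
  cross terms, absorbed by yl, and x T' x^T, absorbed by xl yl^T.\<close>

lemma lattice_term:
  assumes x: "x \<in> carrier_vec n" and y: "y \<in> carrier_vec n" and m2: "m2 \<in> carrier_vec (n - l)"
  defines "m \<equiv> 0\<^sub>v l @\<^sub>v m2" and "xl \<equiv> x \<^sub>v* U'" and "yl \<equiv> (x \<^sub>v* T' + y) \<^sub>v* mat_inv (transpose_mat U')"
  defines "xl2 \<equiv> vec_last xl (n - l)"
  shows "m \<in> carrier_vec n"
    "(m + x) \<^sub>v* Z0 = (vec_first xl l \<^sub>v* W) @\<^sub>v ((m2 + xl2) \<^sub>v* Z)"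
    "- t + scalar_prod x y / 2 + scalar_prod m y + scalar_prod ((m + x) \<^sub>v* X0) (m + x) / 2 =
      - t + scalar_prod xl yl / 2 + (scalar_prod ((m2 + xl2) \<^sub>v* X) (m2 + xl2) / 2 + scalar_prod m2 (vec_last yl (n - l)))"
proof -
  have nl: "l + (n - l) = n" using l by simp
  have zl: "(0\<^sub>v l :: real Matrix.vec) \<in> carrier_vec l" by simp
  show m: "m \<in> carrier_vec n" unfolding m_def using append_carrier_vec[OF zl m2] nl by simp
  have xlc: "xl \<in> carrier_vec n" unfolding xl_def by (rule row_mult_carrier[OF carriers(7)])
  define xl1 where "xl1 = vec_first xl l"
  have x1: "xl1 \<in> carrier_vec l" and x2: "xl2 \<in> carrier_vec (n - l)" by (simp_all add: xl1_def xl2_def)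
  have xls: "xl = xl1 @\<^sub>v xl2" unfolding xl1_def xl2_def using vec_first_last_append[of xl l "n - l"] xlc nl by simp
  have mU: "m \<^sub>v* U' = m"
  proof -
    have O: "0\<^sub>m (n - l) l \<in> carrier_mat (n - l) l" by simp
    have "m \<^sub>v* U' = (0\<^sub>v l \<^sub>v* U + m2 \<^sub>v* 0\<^sub>m (n - l) l) @\<^sub>v (0\<^sub>v l \<^sub>v* P + m2 \<^sub>v* 1\<^sub>m (n - l))"
      unfolding m_def U'_def by (rule row_mult_four_block[OF carriers(2) P O one_carrier_mat zl m2])
    then show ?thesis unfolding zero_row_mult[OF carriers(2)] zero_row_mult[OF P] using m2 by (simp add: m_def)
  qed
  have wU: "(m + x) \<^sub>v* U' = xl1 @\<^sub>v (m2 + xl2)"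
  proof -
    have "(m + x) \<^sub>v* U' = m + xl" unfolding row_mult_add[OF m x carriers(7)] mU xl_def ..
    also have "\<dots> = (0\<^sub>v l + xl1) @\<^sub>v (m2 + xl2)" unfolding m_def xls by (rule append_vec_add[OF zl x1 m2 x2])
    finally show ?thesis using x1 by simp
  qed
  have mx: "m + x \<in> carrier_vec n" using m x by simp
  have m2x: "m2 + xl2 \<in> carrier_vec (n - l)" using m2 x2 by simp
  show "(m + x) \<^sub>v* Z0 = (vec_first xl l \<^sub>v* W) @\<^sub>v ((m2 + xl2) \<^sub>v* Z)"
    unfolding Z0_def row_mult_assoc[OF mx carriers(7,9)] wU
    unfolding W'_def xl1_def[symmetric]
    by (rule row_mult_blk_diag[OF carriers(4,5) x1 m2x])
  have Ut: "transpose_mat U' \<in> carrier_mat n n" using carriers(7) by simp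
  have dUt: "Determinant.det (transpose_mat U') \<noteq> 0" using dets(1) det_transpose[OF carriers(7)] by simp
  note i = mat_inv[OF Ut dUt]
  define v where "v = x \<^sub>v* T' + y"
  have v: "v \<in> carrier_vec n" unfolding v_def using row_mult_carrier[OF carriers(6)] y by simp
  \<comment> \<open>The inverse transpose in yl cancels U', so pairings with yl reduce to pairings
    with x T' + y.\<close>
  have adj: "scalar_prod (w \<^sub>v* U') yl = scalar_prod w v" if w: "w \<in> carrier_vec n" for w
  proof -
    have ylc: "yl \<in> carrier_vec n" unfolding yl_def by (rule row_mult_carrier[OF i(3)])
    have "scalar_prod (w \<^sub>v* U') yl = scalar_prod w (yl \<^sub>v* transpose_mat U')"
      by (rule scalar_prod_row_mult[OF w carriers(7) ylc])
    also have "yl \<^sub>v* transpose_mat U' = v \<^sub>v* (mat_inv (transpose_mat U') * transpose_mat U')"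
      unfolding yl_def v_def[symmetric] by (rule row_mult_assoc[symmetric, OF v i(3) Ut])
    also have "\<dots> = v" unfolding i(2) using v by simp
    finally show ?thesis .
  qed
  have ylc: "yl \<in> carrier_vec n" unfolding yl_def by (rule row_mult_carrier[OF i(3)])
  have yls: "yl = vec_first yl l @\<^sub>v vec_last yl (n - l)" using vec_first_last_append[of yl l "n - l"] ylc nl by simp
  have mv: "scalar_prod m v = scalar_prod m2 (vec_last yl (n - l))"
  proof -
    have "scalar_prod m v = scalar_prod m yl" using adj[OF m] mU by simp
    also have "\<dots> = scalar_prod (0\<^sub>v l) (vec_first yl l) + scalar_prod m2 (vec_last yl (n - l))"
      unfolding m_def by (subst yls, rule scalar_prod_four_append[of _ l _ _ "n - l"]) (use m2 in auto)
    finally show ?thesis by simp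
  qed
  have xv: "scalar_prod xl yl = scalar_prod x v" unfolding xl_def by (rule adj[OF x])
  define a where "a = x \<^sub>v* T'"
  have a: "a \<in> carrier_vec n" unfolding a_def by (rule row_mult_carrier[OF carriers(6)])
  have mT: "m \<^sub>v* T' \<in> carrier_vec n" by (rule row_mult_carrier[OF carriers(6)])
  have mTm: "scalar_prod (m \<^sub>v* T') m = 0"
  proof -
    have O: "0\<^sub>m (n - l) (n - l) \<in> carrier_mat (n - l) (n - l)" and St: "transpose_mat S \<in> carrier_mat (n - l) l" using S by simp_all
    have "m \<^sub>v* T' = (0\<^sub>v l \<^sub>v* T + m2 \<^sub>v* transpose_mat S) @\<^sub>v (0\<^sub>v l \<^sub>v* S + m2 \<^sub>v* 0\<^sub>m (n - l) (n - l))"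
      unfolding m_def T'_def by (rule row_mult_four_block[OF carriers(1) S St O zl m2])
    also have "\<dots> = (m2 \<^sub>v* transpose_mat S) @\<^sub>v 0\<^sub>v (n - l)"
      unfolding zero_row_mult[OF carriers(1)] zero_row_mult[OF S] row_mult_zero_mat[OF m2]
      using row_mult_carrier[OF St, of m2] by simp
    also have "scalar_prod \<dots> m = scalar_prod (m2 \<^sub>v* transpose_mat S) (0\<^sub>v l) + scalar_prod (0\<^sub>v (n - l)) m2"
      unfolding m_def by (rule scalar_prod_four_append) (use row_mult_carrier[OF St, of m2] m2 in auto)
    finally show ?thesis using row_mult_carrier[OF St, of m2] m2 by simp
  qed
  have cross: "scalar_prod (m \<^sub>v* T') x = scalar_prod m a" unfolding a_def
    using scalar_prod_row_mult[OF m carriers(6) x] T'_sym by simp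
  have ma: "scalar_prod a m = scalar_prod m a" by (rule comm_scalar_prod[OF a m])
  \<comment> \<open>After halving, the cross term joins m y^T to form m v^T, and the remaining term
    joins x y^T / 2 to form xl yl^T / 2.\<close>
  have qT: "scalar_prod ((m + x) \<^sub>v* T') (m + x) = 2 * scalar_prod m a + scalar_prod x a"
  proof -
    have "(m + x) \<^sub>v* T' = m \<^sub>v* T' + a" unfolding a_def by (rule row_mult_add[OF m x carriers(6)])
    then have "scalar_prod ((m + x) \<^sub>v* T') (m + x) = (scalar_prod (m \<^sub>v* T') m + scalar_prod (m \<^sub>v* T') x) + (scalar_prod a m + scalar_prod a x)"
      using add_scalar_prod_distrib[OF mT a mx] scalar_prod_add_distrib[OF mT m x] scalar_prod_add_distrib[OF a m x] by simp
    then show ?thesis using mTm cross ma comm_scalar_prod[OF a x] by simp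
  qed
  have qX: "scalar_prod ((m + x) \<^sub>v* (U' * X'' * transpose_mat U')) (m + x) = scalar_prod ((m2 + xl2) \<^sub>v* X) (m2 + xl2)"
  proof -
    define w where "w = (m + x) \<^sub>v* U'"
    have w: "w \<in> carrier_vec n" unfolding w_def by (rule row_mult_carrier[OF carriers(7)])
    have wX: "w \<^sub>v* X'' \<in> carrier_vec n" by (rule row_mult_carrier[OF carriers(8)])
    have "(m + x) \<^sub>v* (U' * X'' * transpose_mat U') = (w \<^sub>v* X'') \<^sub>v* transpose_mat U'"
      unfolding w_def row_mult_assoc[OF mx mult_carrier_mat[OF carriers(7,8)] Ut] row_mult_assoc[OF mx carriers(7,8)] ..
    then have "scalar_prod ((m + x) \<^sub>v* (U' * X'' * transpose_mat U')) (m + x) = scalar_prod (w \<^sub>v* X'') w"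
      using scalar_prod_row_mult[OF wX Ut mx] by (simp add: w_def)
    also have "w \<^sub>v* X'' = (xl1 \<^sub>v* 0\<^sub>m l l) @\<^sub>v ((m2 + xl2) \<^sub>v* X)"
      unfolding w_def wU X''_def by (rule row_mult_blk_diag[OF zero_carrier_mat carriers(3) x1 m2x])
    also have "\<dots> = 0\<^sub>v l @\<^sub>v ((m2 + xl2) \<^sub>v* X)" using x1 by simp
    also have "scalar_prod \<dots> w = scalar_prod (0\<^sub>v l) xl1 + scalar_prod ((m2 + xl2) \<^sub>v* X) (m2 + xl2)"
      unfolding w_def wU by (rule scalar_prod_four_append[OF zl x1 row_mult_carrier[OF carriers(3)] m2x])
    finally show ?thesis using x1 by simp
  qed
  have UXU: "U' * X'' * transpose_mat U' \<in> carrier_mat n n" using carriers(7,8) by simp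
  have q: "scalar_prod ((m + x) \<^sub>v* X0) (m + x) = (2 * scalar_prod m a + scalar_prod x a) + scalar_prod ((m2 + xl2) \<^sub>v* X) (m2 + xl2)"
    unfolding X0_def row_mult_add_mat[OF mx carriers(6) UXU]
      add_scalar_prod_distrib[OF row_mult_carrier[OF carriers(6)] row_mult_carrier[OF UXU] mx] qT qX ..
  have va: "scalar_prod w v = scalar_prod w a + scalar_prod w y" if "w \<in> carrier_vec n" for w
    unfolding v_def a_def[symmetric] by (rule scalar_prod_add_distrib[OF that a y])
  show "- t + scalar_prod x y / 2 + scalar_prod m y + scalar_prod ((m + x) \<^sub>v* X0) (m + x) / 2 =
      - t + scalar_prod xl yl / 2 + (scalar_prod ((m2 + xl2) \<^sub>v* X) (m2 + xl2) / 2 + scalar_prod m2 (vec_last yl (n - l)))"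
    unfolding q xv mv[symmetric] va[OF x] va[OF m] by (simp add: field_simps)
qed

end

section \<open>Lattice sums and shifted integers\<close>

lemma sum_inverse_squares_bounded:
  assumes c: "c > 0"
  obtains B :: real where "B \<ge> 0" "\<And>K. finite K \<Longrightarrow> K \<subseteq> \<int> \<Longrightarrow> (\<Sum>k\<in>K. 1 / (1 + c * k\<^sup>2)) \<le> B"
proof -
  let ?h = "\<lambda>k::real. 1 / (1 + c * k\<^sup>2)"
  have h0: "?h k \<ge> 0" for k using c by (simp add: add_nonneg_nonneg)
  have "summable (\<lambda>n::nat. (1/c) * inverse (real n ^ 2))"
    by (intro summable_mult inverse_power_summable) simp
  moreover have "norm (?h (real n)) \<le> (1/c) * inverse (real n ^ 2)" if "n \<ge> 1" for n
  proof -
    have "1 / (1 + c * (real n)\<^sup>2) \<le> 1 / (c * (real n)\<^sup>2)" using c that by (intro divide_left_mono) (auto intro!: mult_pos_pos add_pos_pos)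
    then show ?thesis using h0[of "real n"] by (simp add: field_simps)
  qed
  ultimately have s: "summable (\<lambda>n. ?h (real n))" by (rule summable_comparison_test'[where N = 1])
  show ?thesis
  proof
    show "0 \<le> 2 * (\<Sum>n. ?h (real n))" using suminf_nonneg[OF s] h0 by simp
    fix K :: "real set" assume K: "finite K" "K \<subseteq> \<int>"
    \<comment> \<open>A crude bound for all |k| with k in K, enough to place K inside the integers
      from -N to N.\<close>
    define N where "N = (\<Sum>k\<in>K. nat \<lfloor>\<bar>k\<bar>\<rfloor>)"
    have "K \<subseteq> real ` {..N} \<union> (\<lambda>n. - real n) ` {..N}"
    proof
      fix k assume k: "k \<in> K"
      then obtain j :: int where j: "k = of_int j" using K(2) by (meson Ints_cases subsetD)
      have "nat \<lfloor>\<bar>k\<bar>\<rfloor> \<le> N" unfolding N_def using K(1) k by (intro member_le_sum) auto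
      then have "nat \<bar>j\<bar> \<le> N" by (simp add: j flip: of_int_abs)
      moreover have "k = real (nat \<bar>j\<bar>) \<or> k = - real (nat \<bar>j\<bar>)" using j by auto
      ultimately obtain a where "a \<le> N" "k = real a \<or> k = - real a" by blast
      then show "k \<in> real ` {..N} \<union> (\<lambda>n. - real n) ` {..N}" by auto
    qed
    then have "(\<Sum>k\<in>K. ?h k) \<le> (\<Sum>k\<in>real ` {..N} \<union> (\<lambda>n. - real n) ` {..N}. ?h k)"
      using h0 by (intro sum_mono2) auto
    also have "\<dots> \<le> (\<Sum>k\<in>real ` {..N}. ?h k) + (\<Sum>k\<in>(\<lambda>n. - real n) ` {..N}. ?h k)"
      using h0 by (subst sum_Un) (auto intro!: sum_nonneg)
    also have "\<dots> = 2 * (\<Sum>n\<le>N. ?h (real n))"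
      by (simp add: sum.reindex inj_on_def)
    also have "\<dots> \<le> 2 * (\<Sum>n. ?h (real n))" using h0 by (intro mult_left_mono sum_le_suminf s) auto
    finally show "(\<Sum>k\<in>K. ?h k) \<le> 2 * (\<Sum>n. ?h (real n))" .
  qed
qed

text \<open>A finite set of lattice points lies in a product K^n, over which the sum of the product
  weight factorizes into n sums that are bounded independently of K.\<close>

lemma lattice_weight_summable:
  assumes c: "c > 0"
  shows "(\<lambda>m. \<Prod>i<n. 1 / (1 + c * (m $ i)\<^sup>2)) summable_on int_vecs n"
proof (rule nonneg_bdd_above_summable_on)
  let ?h = "\<lambda>k::real. 1 / (1 + c * k\<^sup>2)"
  have h0: "?h k \<ge> 0" for k using c by (simp add: add_nonneg_nonneg)
  show "0 \<le> (\<Prod>i<n. ?h (m $ i))" for m using h0 by (intro prod_nonneg) auto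
  obtain B where B: "B \<ge> 0" "\<And>K. finite K \<Longrightarrow> K \<subseteq> \<int> \<Longrightarrow> (\<Sum>k\<in>K. ?h k) \<le> B"
    by (rule sum_inverse_squares_bounded[OF c]) (rule that, auto)
  show "bdd_above (sum (\<lambda>m. \<Prod>i<n. ?h (m $ i)) ` {F. F \<subseteq> int_vecs n \<and> finite F})"
  proof (rule bdd_aboveI2)
    fix F assume "F \<in> {F. F \<subseteq> int_vecs n \<and> finite F}"
    then have F: "F \<subseteq> int_vecs n" "finite F" by auto
    define K where "K = (\<Union>i<n. (\<lambda>m. m $ i) ` F)"
    define \<rho> where "\<rho> = (\<lambda>m :: real Matrix.vec. \<lambda>i\<in>{..<n}. m $ i)"
    have K: "finite K" "K \<subseteq> \<int>" using F by (auto simp: K_def int_vecs_def)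
    have inj: "inj_on \<rho> F"
    proof (rule inj_onI)
      fix m m' assume "m \<in> F" "m' \<in> F" and e: "\<rho> m = \<rho> m'"
      then have "m \<in> carrier_vec n" "m' \<in> carrier_vec n" using F by (auto simp: int_vecs_def)
      moreover have "m $ i = m' $ i" if "i < n" for i using fun_cong[OF e, of i] that by (simp add: \<rho>_def)
      ultimately show "m = m'" by (intro eq_vecI) auto
    qed
    have "(\<Sum>m\<in>F. \<Prod>i<n. ?h (m $ i)) = (\<Sum>p\<in>\<rho> ` F. \<Prod>i<n. ?h (p i))"
      by (subst sum.reindex[OF inj]) (simp add: \<rho>_def)
    also have "\<dots> \<le> (\<Sum>p\<in>Pi\<^sub>E {..<n} (\<lambda>_. K). \<Prod>i<n. ?h (p i))"
    proof (rule sum_mono2)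
      show "\<rho> ` F \<subseteq> Pi\<^sub>E {..<n} (\<lambda>_. K)" 
        unfolding \<rho>_def by (rule image_subsetI, unfold restrict_PiE_iff) (auto simp: K_def)
    qed (use K(1) h0 in \<open>auto intro!: finite_PiE prod_nonneg\<close>)
    also have "\<dots> = (\<Prod>i<n. \<Sum>k\<in>K. ?h k)" using K(1) by (subst prod_sum_PiE) auto
    also have "\<dots> \<le> (\<Prod>i<n. B)" using B(2)[OF K] h0 by (intro prod_mono) (auto intro!: sum_nonneg)
    finally show "(\<Sum>m\<in>F. \<Prod>i<n. ?h (m $ i)) \<le> B ^ n" by simp
  qed
qed

lemma prod_one_plus_le:
  assumes "\<And>i. i < n \<Longrightarrow> (0::real) \<le> a i" "(\<Sum>i<n. a i) \<le> q"
  shows "(\<Prod>i<n. 1 + a i) \<le> (1 + q) ^ n"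
proof -
  have "a i \<le> q" if "i < n" for i
    using member_le_sum[of i "{..<n}" a] assms that by force
  then have "(\<Prod>i<n. 1 + a i) \<le> (\<Prod>i<n. 1 + q)" using assms(1) by (intro prod_mono) (auto intro: add_nonneg_nonneg)
  then show ?thesis by simp
qed

text \<open>An integer is 0 or at least 1 in absolute value; in the second case |x| is at most half
  of it, so m + x stays at distance at least |m|/2 from 0.\<close>

lemma shifted_integer:
  assumes "m \<in> \<int>" "\<bar>x\<bar> \<le> (1/2 :: real)"
  shows "m\<^sup>2 / 4 \<le> (m + x)\<^sup>2" "x\<^sup>2 \<le> (m + x)\<^sup>2" "m \<noteq> 0 \<Longrightarrow> 1/4 \<le> (m + x)\<^sup>2"
proof -
  obtain j :: int where j: "m = of_int j" using assms(1) by (elim Ints_cases)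
  have "j = 0 \<or> 1 \<le> \<bar>j\<bar>" by linarith
  then have "m = 0 \<or> \<bar>m\<bar> \<ge> 1" unfolding j by (auto simp flip: of_int_abs)
  then have "\<bar>m / 2\<bar> \<le> \<bar>m + x\<bar>" "\<bar>x\<bar> \<le> \<bar>m + x\<bar>" "m \<noteq> 0 \<Longrightarrow> \<bar>1/2\<bar> \<le> \<bar>m + x\<bar>"
    using assms(2) by linarith+
  then show "m\<^sup>2 / 4 \<le> (m + x)\<^sup>2" "x\<^sup>2 \<le> (m + x)\<^sup>2" "m \<noteq> 0 \<Longrightarrow> 1/4 \<le> (m + x)\<^sup>2"
    unfolding abs_le_square_iff by (simp_all add: power2_eq_square)
qed

lemma lattice_decomposition:
  assumes l: "l \<le> n"
  shows "bij_betw (\<lambda>m2. 0\<^sub>v l @\<^sub>v m2) (int_vecs (n - l)) {m \<in> int_vecs n. \<forall>i<l. m $ i = 0}"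
proof (rule bij_betwI[where g = "\<lambda>m. vec_last m (n - l)"])
  have nl: "l + (n - l) = n" using l by simp
  show "(\<lambda>m2. 0\<^sub>v l @\<^sub>v m2) \<in> int_vecs (n - l) \<rightarrow> {m \<in> int_vecs n. \<forall>i<l. m $ i = 0}"
  proof
    fix m2 :: "real Matrix.vec" assume "m2 \<in> int_vecs (n - l)"
    then have m2: "m2 \<in> carrier_vec (n - l)" "\<And>i. i < n - l \<Longrightarrow> m2 $ i \<in> \<int>" by (auto simp: int_vecs_def)
    have "0\<^sub>v l @\<^sub>v m2 \<in> carrier_vec n" using append_carrier_vec[OF zero_carrier_vec m2(1), of l] nl by simp
    then show "0\<^sub>v l @\<^sub>v m2 \<in> {m \<in> int_vecs n. \<forall>i<l. m $ i = 0}" using m2 by (auto simp: int_vecs_def)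
  qed
  show "(\<lambda>m. vec_last m (n - l)) \<in> {m \<in> int_vecs n. \<forall>i<l. m $ i = 0} \<rightarrow> int_vecs (n - l)"
    using l by (auto simp: int_vecs_def vec_last_def)
  show "vec_last (0\<^sub>v l @\<^sub>v m2) (n - l) = m2" if "m2 \<in> int_vecs (n - l)" for m2
    using that by (intro vec_last_append) (simp add: int_vecs_def)
  show "0\<^sub>v l @\<^sub>v vec_last m (n - l) = m" if "m \<in> {m \<in> int_vecs n. \<forall>i<l. m $ i = 0}" for m
    using that l by (intro eq_vecI) (auto simp: int_vecs_def vec_last_def)
qed


text \<open>The constant K is quantified before l, g and h, which expresses dependence on A and f
  (and n, R) alone. Indices start at 0, so v_l is the entry l - 1 of V.\<close>

theorem theorem4p4:
  fixes n :: nat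
    and R :: "real mat \<Rightarrow> (real Matrix.vec \<Rightarrow> complex) \<Rightarrow> real Matrix.vec \<Rightarrow> complex"
    and f :: "real Matrix.vec \<Rightarrow> complex"
    and A :: real
  assumes "segal_shale_weil n R" and "schwartz n f" and "A > 0"
  shows "\<exists>K. \<forall>l g x y t T S U P X Vl Yl Z Q V.
    1 \<le> l \<and> l \<le> n \<and> g \<in> siegel_domain n \<and> iwasawa_diag n g V \<and>
    x \<in> carrier_vec n \<and> y \<in> carrier_vec n \<and>
    (\<forall>i<n. \<bar>x $ i\<bar> \<le> 1/2) \<and> (\<forall>i<n. \<bar>y $ i\<bar> \<le> 1/2) \<and>
    sym_mat l T \<and> S \<in> carrier_mat l (n - l) \<and>
    upper_unipotent l U \<and> P \<in> carrier_mat l (n - l) \<and>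
    sym_mat (n - l) X \<and> pos_diag l Vl \<and> pos_def (n - l) Yl \<and> tri_root (n - l) Yl Z \<and>
    Q \<in> unitary_mats n \<and>
    g = F1 n l T S * F2 n l U P * F3 n l X * F4 n (map_mat sqrt Vl) Z * k_mat Q \<longrightarrow>
    (let fQ = R (k_mat Q) f;
         z = (x @\<^sub>v y) \<^sub>v* (F1 n l T S * F2 n l U P);
         xl = vec_first z n; yl = vec_last z n;
         xl1 = vec_first xl l; xl2 = vec_last xl (n - l); yl2 = vec_last yl (n - l);
         main = of_real (Determinant.det Vl powr (1/4) * Determinant.det Yl powr (1/4)) *
           ee (- t + scalar_prod xl yl / 2) *
           (\<Sum>\<^sub>\<infinity>m\<in>int_vecs (n - l).
              fQ ((xl1 \<^sub>v* map_mat sqrt Vl) @\<^sub>v ((m + xl2) \<^sub>v* Z)) *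
              ee (scalar_prod ((m + xl2) \<^sub>v* X) (m + xl2) / 2 + scalar_prod m yl2))
     in norm (theta n R f (x, y, t) g - main)
          \<le> K * Determinant.det Vl powr (1/4) *
            (V $$ (l - 1, l - 1) + scalar_prod (x \<^sub>v* V) x) powr (- A))"
proof (cases "n = 0")
  \<comment> \<open>No l satisfies 1 \<le> l \<le> 0.\<close>
  case True
  then show ?thesis by auto
next
  case False
  then have n: "n > 0" by simp
  interpret segal_shale_weil n R by fact
  note f = \<open>schwartz n f\<close>
  obtain \<kappa> where k1: "\<kappa> \<ge> 1" and bounds: "\<forall>g V X0 Z0 Q. g \<in> siegel_domain n \<and> iwasawa_diag n g V \<and> sym_mat n X0 \<and>
    tri_root n (Z0 * transpose_mat Z0) Z0 \<and> Q \<in> unitary_mats n \<and> g = n_mat n X0 * a_mat n Z0 * k_mat Q \<longrightarrow>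
    pos_diag n V \<and> (\<forall>i<n. V $$ (i, i) = (Z0 $$ (i, i))\<^sup>2) \<and> (\<forall>i j. i \<le> j \<and> j < n \<longrightarrow> V $$ (j, j) \<le> \<kappa> * V $$ (i, i)) \<and>
    (\<forall>i<n. 1 \<le> \<kappa> * V $$ (i, i)) \<and>
    (\<forall>w\<in>carrier_vec n. (\<Sum>i<n. V $$ (i, i) * (w $ i)\<^sup>2) \<le> \<kappa> * scalar_prod (w \<^sub>v* Z0) (w \<^sub>v* Z0))"
    using siegel_bounds[OF n] by (elim exE conjE) (rule that)
  \<comment> \<open>The summand n/4 will be consumed by (det Y_l)^(1/4), leaving exponent A.\<close>
  define p where "p = A + real n / 4"
  have p0: "p > 0" using \<open>A > 0\<close> by (simp add: p_def add_pos_nonneg)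
  define N where "N = nat \<lceil>p\<rceil>"
  have Np: "p \<le> real N" unfolding N_def using p0 by linarith
  obtain C where C: "C \<ge> 0" "\<And>k x. k \<in> Sp_unit n \<Longrightarrow> x \<in> carrier_vec n \<Longrightarrow> (1 + scalar_prod x x) ^ (n + N) * norm (R k f x) \<le> C"
    using R_uniform_decay[OF f, of "n + N"] by blast
  \<comment> \<open>One factor 1/\<kappa> comes from the lower bound on the v, the other from
    comparing V with Y, and 1/4 from |m + x| \<ge> |m|/2.\<close>
  define c where "c = 1 / (4 * \<kappa>\<^sup>2)"
  \<comment> \<open>Both v_l and x V x^T are at most 4 \<kappa> times the V-form at m + x, which is
    itself at most \<kappa> times the Y-form; their sum doubles 4 \<kappa>^2.\<close>
  define c1 where "c1 = 1 / (8 * \<kappa>\<^sup>2)"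
  have c: "c > 0" "c1 > 0" using k1 by (simp_all add: c_def c1_def)
  define wt where "wt = (\<lambda>m :: real Matrix.vec. \<Prod>i<n. 1 / (1 + c * (m $ i)\<^sup>2))"
  have wt0: "wt m \<ge> 0" for m unfolding wt_def using c by (intro prod_nonneg) (auto intro: add_nonneg_nonneg)
  have wts: "wt summable_on int_vecs n" unfolding wt_def by (rule lattice_weight_summable[OF c(1)])
  define \<Sigma> where "\<Sigma> = (\<Sum>\<^sub>\<infinity>m\<in>int_vecs n. wt m)"
  have S0: "\<Sigma> \<ge> 0" unfolding \<Sigma>_def using wt0 by (intro infsum_nonneg) auto
  show ?thesis
  proof (intro exI[of _ "\<kappa> powr (real n / 4) * C * c1 powr (- p) * \<Sigma>"] allI impI)
    fix l g and x y :: "real Matrix.vec" and t T S U P X Vl Yl Z Q V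
    assume asm: "1 \<le> l \<and> l \<le> n \<and> g \<in> siegel_domain n \<and> iwasawa_diag n g V \<and>
      x \<in> carrier_vec n \<and> y \<in> carrier_vec n \<and>
      (\<forall>i<n. \<bar>x $ i\<bar> \<le> 1/2) \<and> (\<forall>i<n. \<bar>y $ i\<bar> \<le> 1/2) \<and>
      sym_mat l T \<and> S \<in> carrier_mat l (n - l) \<and>
      upper_unipotent l U \<and> P \<in> carrier_mat l (n - l) \<and>
      sym_mat (n - l) X \<and> pos_diag l Vl \<and> pos_def (n - l) Yl \<and> tri_root (n - l) Yl Z \<and>
      Q \<in> unitary_mats n \<and>
      g = F1 n l T S * F2 n l U P * F3 n l X * F4 n (map_mat sqrt Vl) Z * k_mat Q"
    interpret B: block_factors n l T S U P X Vl Yl Z using asm by unfold_locales auto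
    have l: "1 \<le> l" "l \<le> n" and x: "x \<in> carrier_vec n" and y: "y \<in> carrier_vec n" and Q: "Q \<in> unitary_mats n"
      and xb: "\<And>i. i < n \<Longrightarrow> \<bar>x $ i\<bar> \<le> 1/2" and gS: "g \<in> Sp n"
      using asm by (auto simp: siegel_domain_def)
    have g: "g = n_mat n B.X0 * a_mat n B.Z0 * k_mat Q" using asm B.factorization by (simp add: B.W_def)
    have kS: "k_mat Q \<in> Sp_unit n" using k_mat_props[OF Q] by (simp add: Sp_unit_def)
    have bd: "pos_diag n V" "\<And>i. i < n \<Longrightarrow> V $$ (i, i) = (B.Z0 $$ (i, i))\<^sup>2" "\<And>i j. i \<le> j \<Longrightarrow> j < n \<Longrightarrow> V $$ (j, j) \<le> \<kappa> * V $$ (i, i)"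
      "\<And>i. i < n \<Longrightarrow> 1 \<le> \<kappa> * V $$ (i, i)"
      "\<And>w. w \<in> carrier_vec n \<Longrightarrow> (\<Sum>i<n. V $$ (i, i) * (w $ i)\<^sup>2) \<le> \<kappa> * scalar_prod (w \<^sub>v* B.Z0) (w \<^sub>v* B.Z0)"
    proof -
      have gd: "g \<in> siegel_domain n" using asm by (elim conjE)
      have iw: "iwasawa_diag n g V" using asm by (elim conjE)
      note b = bounds[THEN spec, THEN spec, THEN spec, THEN spec, THEN spec, THEN mp,
          OF conjI[OF gd conjI[OF iw conjI[OF B.X0_sym conjI[OF B.Z0_root conjI[OF Q g]]]]]]
      note b2 = b[THEN conjunct2] and b3 = b[THEN conjunct2, THEN conjunct2]
      note b4 = b3[THEN conjunct2] and b5 = b3[THEN conjunct2, THEN conjunct2]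
      show "pos_diag n V" by (rule b[THEN conjunct1])
      show "V $$ (i, i) = (B.Z0 $$ (i, i))\<^sup>2" if "i < n" for i
        by (rule b2[THEN conjunct1, rule_format, OF that])
      show "V $$ (j, j) \<le> \<kappa> * V $$ (i, i)" if "i \<le> j" "j < n" for i j
        by (rule b3[THEN conjunct1, rule_format, OF conjI[OF that]])
      show "1 \<le> \<kappa> * V $$ (i, i)" if "i < n" for i
        by (rule b4[THEN conjunct1, rule_format, OF that])
      show "(\<Sum>i<n. V $$ (i, i) * (w $ i)\<^sup>2) \<le> \<kappa> * scalar_prod (w \<^sub>v* B.Z0) (w \<^sub>v* B.Z0)" if "w \<in> carrier_vec n" for w
        by (rule b5[rule_format, OF that])
    qed
    have Vp: "V $$ (i, i) > 0" if "i < n" for i using bd(1) that by (simp add: pos_diag_def)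
    let ?fQ = "R (k_mat Q) f"
    define \<delta> where "\<delta> = Determinant.det Vl powr (1/4) * Determinant.det Yl powr (1/4)"
    \<comment> \<open>R contributes the square root of det Z0, which is itself a product of two
      square roots; this yields the fourth roots.\<close>
    have sd: "sqrt (Determinant.det B.Z0) = \<delta>"
      unfolding B.dets(4) \<delta>_def using B.dets(5,6) by (simp add: real_sqrt_mult powr_half_sqrt[symmetric] powr_powr)
    have \<delta>0: "\<delta> \<ge> 0" by (simp add: \<delta>_def)
    define G where "G = (\<lambda>m. schroedinger (x, y, t) (R g f) m)"
    have G: "G m = ee (- t + scalar_prod x y / 2 + scalar_prod m y) *
        (of_real \<delta> * ee (scalar_prod ((m + x) \<^sub>v* B.X0) (m + x) / 2) * ?fQ ((m + x) \<^sub>v* B.Z0))" if "m \<in> carrier_vec n" for m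
      unfolding G_def schroedinger.simps
      using R_iwasawa[OF B.X0_sym B.Z0_root Q f g gS, of "m + x"] that x by (simp add: sd)
    have nG: "norm (G m) = \<delta> * norm (?fQ ((m + x) \<^sub>v* B.Z0))" if "m \<in> carrier_vec n" for m
      unfolding G[OF that] norm_mult norm_ee using \<delta>0 by simp
    define xVx where "xVx = (\<Sum>i<n. V $$ (i, i) * (x $ i)\<^sup>2)"
    have xVx: "scalar_prod (x \<^sub>v* V) x = xVx"
    proof -
      have Vc: "V \<in> carrier_mat n n" and Vd: "diagonal_mat V" using bd(1) by (auto simp: pos_diag_def)
      have "(x \<^sub>v* V) $ j = V $$ (j, j) * x $ j" if j: "j < n" for j
      proof -
        have "(x \<^sub>v* V) $ j = (\<Sum>i<n. x $ i * V $$ (i, j))" by (rule row_mult_index[OF x Vc j])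
        also have "\<dots> = (\<Sum>i\<in>{j}. x $ i * V $$ (i, j))"
          using Vd Vc j by (intro sum.mono_neutral_right) (auto simp: diagonal_mat_def)
        finally show ?thesis by simp
      qed
      then show ?thesis using x by (simp add: scalar_prod_def xVx_def power2_eq_square lessThan_atLeast0 mult.assoc)
    qed
    have xVx0: "xVx \<ge> 0" unfolding xVx_def using Vp by (intro sum_nonneg mult_nonneg_nonneg) (auto intro: less_imp_le)
    define v where "v = V $$ (l - 1, l - 1)"
    have v: "v > 0" "1 \<le> \<kappa> * v" using Vp[of "l - 1"] bd(4)[of "l - 1"] l by (auto simp: v_def)
    define M where "M = v + xVx"
    have M: "M > 0" "1 \<le> \<kappa> * M" "v \<le> M"
    proof -
      show "M > 0" "v \<le> M" using v xVx0 by (auto simp: M_def)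
      have "\<kappa> * v \<le> \<kappa> * M" using k1 xVx0 by (intro mult_left_mono) (auto simp: M_def)
      then show "1 \<le> \<kappa> * M" using v by linarith
    qed
    have k0: "\<kappa> > 0" using k1 by simp
    \<comment> \<open>The value (m + x) Y (m + x)^T, with Y written through its root Z0.\<close>
    define q where "q = (\<lambda>m. scalar_prod ((m + x) \<^sub>v* B.Z0) ((m + x) \<^sub>v* B.Z0))"
    have uc: "(m + x) \<^sub>v* B.Z0 \<in> carrier_vec n" for m by (rule row_mult_carrier[OF B.carriers(10)])
    have fQ: "(1 + q m) ^ n * (1 + q m) ^ N * norm (?fQ ((m + x) \<^sub>v* B.Z0)) \<le> C" for m
      using C(2)[OF kS uc] by (simp add: q_def power_add)
    have q0: "q m \<ge> 0" for m unfolding q_def by simp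
    have qS: "(\<Sum>i<n. V $$ (i, i) * (m $ i + x $ i)\<^sup>2) \<le> \<kappa> * q m" if "m \<in> carrier_vec n" for m
      using bd(5)[of "m + x"] that x by (simp add: q_def)
    \<comment> \<open>The part of the decay with exponent n dominates a weight in m alone,
      independent of g and x. The part with exponent N stays free for the gain in M.\<close>
    have wtq: "1 \<le> wt m * (1 + q m) ^ n" if m: "m \<in> int_vecs n" for m
    proof -
      have mc: "m \<in> carrier_vec n" and mi: "\<And>i. i < n \<Longrightarrow> m $ i \<in> \<int>" using m by (auto simp: int_vecs_def)
      have "(\<Sum>i<n. c * (m $ i)\<^sup>2) \<le> (\<Sum>i<n. (V $$ (i, i) * (m $ i + x $ i)\<^sup>2) / \<kappa>)"
      proof (rule sum_mono)
        fix i assume "i \<in> {..<n}"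
        then have i: "i < n" by simp
        have "c * (m $ i)\<^sup>2 = (1 / \<kappa>) * (1 / \<kappa>) * ((m $ i)\<^sup>2 / 4)" by (simp add: c_def power2_eq_square)
        also have "\<dots> \<le> (1 / \<kappa>) * V $$ (i, i) * (m $ i + x $ i)\<^sup>2"
          using bd(4)[OF i] k0 shifted_integer(1)[OF mi[OF i] xb[OF i]] Vp[OF i]
          by (intro mult_mono mult_left_mono) (auto simp: field_simps)
        finally show "c * (m $ i)\<^sup>2 \<le> (V $$ (i, i) * (m $ i + x $ i)\<^sup>2) / \<kappa>" by simp
      qed
      also have "\<dots> \<le> q m" using qS[OF mc] k0 by (simp add: sum_divide_distrib[symmetric] field_simps)
      finally have "(\<Prod>i<n. 1 + c * (m $ i)\<^sup>2) \<le> (1 + q m) ^ n" using c by (intro prod_one_plus_le) auto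
      moreover have "(\<Prod>i<n. 1 + c * (m $ i)\<^sup>2) > 0" using c by (intro prod_pos) (auto intro: add_pos_nonneg)
      ultimately show ?thesis by (simp add: wt_def prod_dividef field_simps)
    qed
    have bound: "norm (?fQ ((m + x) \<^sub>v* B.Z0)) \<le> C * wt m / (1 + q m) ^ N" if m: "m \<in> int_vecs n" for m
    proof -
      have pos: "(1 + q m) ^ N > 0" using q0[of m] by (intro zero_less_power) simp
      have "(1 + q m) ^ N * norm (?fQ ((m + x) \<^sub>v* B.Z0)) \<le> (wt m * (1 + q m) ^ n) * ((1 + q m) ^ N * norm (?fQ ((m + x) \<^sub>v* B.Z0)))"
        using mult_right_mono[OF wtq[OF m], of "(1 + q m) ^ N * norm (?fQ ((m + x) \<^sub>v* B.Z0))"] pos by simp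
      also have "\<dots> \<le> wt m * C" using mult_left_mono[OF fQ[of m] wt0[of m]] by (simp add: mult_ac)
      finally show ?thesis using pos by (simp add: field_simps)
    qed
    \<comment> \<open>Dropping the gain in M leaves a summable majorant on the whole lattice, which
      is what justifies splitting the series.\<close>
    have bound1: "norm (G m) \<le> \<delta> * C * wt m" if m: "m \<in> int_vecs n" for m
    proof -
      have mc: "m \<in> carrier_vec n" using m by (simp add: int_vecs_def)
      have "C * wt m / (1 + q m) ^ N \<le> C * wt m / 1"
        using C(1) wt0[of m] q0[of m] by (intro divide_left_mono) auto
      then have "norm (?fQ ((m + x) \<^sub>v* B.Z0)) \<le> C * wt m" using bound[OF m] by simp
      then show ?thesis unfolding nG[OF mc] using \<delta>0 by (simp add: mult.assoc mult_left_mono)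
    qed
    have absG: "(\<lambda>m. norm (G m)) summable_on int_vecs n"
      by (rule summable_on_comparison_test[OF summable_on_cmult_right[OF wts, of "\<delta> * C"]]) (use bound1 in auto)
    then have Gs: "G summable_on int_vecs n" by (rule abs_summable_summable)
    define I0 where "I0 = {m \<in> int_vecs n. \<forall>i<l. m $ i = 0}"
    have I0: "I0 \<subseteq> int_vecs n" by (auto simp: I0_def)
    define \<epsilon> where "\<epsilon> = \<delta> * C * (c1 * M) powr (- p)"
    \<comment> \<open>Outside I0 some entry m_i with i < l is nonzero. It forces the Y-form above a
      multiple of V_ii, hence of v_l, while the comparison with x V x^T holds for every m.\<close>
    have bound2: "norm (G m) \<le> \<epsilon> * wt m" if m: "m \<in> int_vecs n - I0" for m
    proof -
      have mc: "m \<in> carrier_vec n" and mi: "\<And>i. i < n \<Longrightarrow> m $ i \<in> \<int>" and mI: "m \<in> int_vecs n" using m by (auto simp: int_vecs_def)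
      obtain i where i: "i < l" "m $ i \<noteq> 0" using m by (auto simp: I0_def)
      have iN: "i < n" using i l by simp
      let ?S = "\<Sum>i<n. V $$ (i, i) * (m $ i + x $ i)\<^sup>2"
      have S1: "xVx \<le> ?S" unfolding xVx_def
        using shifted_integer(2)[OF mi xb] Vp by (intro sum_mono mult_left_mono) (auto intro: less_imp_le)
      have "V $$ (i, i) * (1/4) \<le> V $$ (i, i) * (m $ i + x $ i)\<^sup>2"
        using shifted_integer(3)[OF mi[OF iN] xb[OF iN] i(2)] Vp[OF iN] by (intro mult_left_mono) auto
      also have "\<dots> \<le> ?S" using iN Vp[THEN less_imp_le] by (intro member_le_sum) auto
      finally have S2: "V $$ (i, i) / 4 \<le> ?S" by simp
      have "v \<le> \<kappa> * V $$ (i, i)" unfolding v_def using i l by (intro bd(3)) auto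
      also have "\<kappa> * V $$ (i, i) \<le> \<kappa> * (4 * ?S)" using S2 k0 by (intro mult_left_mono) auto
      finally have "v \<le> 4 * \<kappa> * ?S" by simp
      moreover have "xVx \<le> 4 * \<kappa> * ?S"
      proof -
        have "1 * ?S \<le> 4 * \<kappa> * ?S" using S1 xVx0 k1 by (intro mult_right_mono) auto
        then show ?thesis using S1 by linarith
      qed
      ultimately have "M \<le> 8 * \<kappa> * ?S" by (simp add: M_def)
      also have "\<dots> \<le> 8 * \<kappa> * (\<kappa> * q m)" using qS[OF mc] k0 by (intro mult_left_mono) auto
      finally have c1M: "c1 * M \<le> q m" using k0 by (simp add: c1_def field_simps power2_eq_square)
      have "(c1 * M) powr p \<le> (1 + q m) powr p" using c1M c(2) M(1) p0 by (intro powr_mono2) auto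
      also have "\<dots> \<le> (1 + q m) powr real N" using Np q0[of m] by (intro powr_mono) auto
      also have "\<dots> = (1 + q m) ^ N" using q0[of m] by (intro powr_realpow) (simp add: add_pos_nonneg)
      finally have le: "(c1 * M) powr p \<le> (1 + q m) ^ N" .
      have pos: "0 < (c1 * M) powr p" using c(2) M(1) by simp
      have posN: "0 < (1 + q m) ^ N" using le pos by linarith
      have "C * wt m / (1 + q m) ^ N \<le> C * wt m / (c1 * M) powr p"
        by (rule divide_left_mono[OF le mult_nonneg_nonneg[OF C(1) wt0] mult_pos_pos[OF posN pos]])
      also have "\<dots> = C * (c1 * M) powr (- p) * wt m" by (simp add: powr_minus divide_inverse)
      finally have "norm (?fQ ((m + x) \<^sub>v* B.Z0)) \<le> C * (c1 * M) powr (- p) * wt m" using bound[OF mI] by simp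
      from mult_left_mono[OF this \<delta>0] show ?thesis by (simp add: nG[OF mc] \<epsilon>_def mult.assoc)
    qed
    have eps0: "\<epsilon> \<ge> 0" unfolding \<epsilon>_def using \<delta>0 C(1) by simp
    have split: "theta n R f (x, y, t) g = infsum G I0 + infsum G (int_vecs n - I0)"
    proof -
      have "infsum G (I0 \<union> (int_vecs n - I0)) = infsum G I0 + infsum G (int_vecs n - I0)"
        using summable_on_subset_banach[OF Gs] I0 by (intro infsum_Un_disjoint) auto
      moreover have "I0 \<union> (int_vecs n - I0) = int_vecs n" using I0 by auto
      ultimately show ?thesis by (simp add: theta_def G_def)
    qed
    have rest: "norm (infsum G (int_vecs n - I0)) \<le> \<epsilon> * \<Sigma>"
    proof -
      have a: "(\<lambda>m. norm (G m)) summable_on (int_vecs n - I0)" by (rule summable_on_subset_banach[OF absG]) auto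
      have b: "wt summable_on (int_vecs n - I0)" by (rule summable_on_subset_banach[OF wts]) auto
      have "norm (infsum G (int_vecs n - I0)) \<le> (\<Sum>\<^sub>\<infinity>m\<in>int_vecs n - I0. norm (G m))" by (rule norm_infsum_bound[OF a])
      also have "\<dots> \<le> (\<Sum>\<^sub>\<infinity>m\<in>int_vecs n - I0. \<epsilon> * wt m)"
        by (rule infsum_mono[OF a summable_on_cmult_right[OF b] bound2])
      also have "\<dots> = \<epsilon> * (\<Sum>\<^sub>\<infinity>m\<in>int_vecs n - I0. wt m)" by (rule infsum_cmult_right[OF b])
      also have "(\<Sum>\<^sub>\<infinity>m\<in>int_vecs n - I0. wt m) \<le> \<Sigma>" unfolding \<Sigma>_def
        using wt0 by (intro infsum_mono2 b wts) auto
      finally show ?thesis using eps0 by (simp add: mult_left_mono)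
    qed
    define z where "z = (x @\<^sub>v y) \<^sub>v* (F1 n l T S * F2 n l U P)"
    have dUt: "Determinant.det (transpose_mat B.U') \<noteq> 0" using B.dets(1) det_transpose[OF B.carriers(7)] by simp
    have Ut: "transpose_mat B.U' \<in> carrier_mat n n" using B.carriers(7) by simp
    define xl where "xl = vec_first z n"
    define yl where "yl = vec_last z n"
    have xl: "xl = x \<^sub>v* B.U'" unfolding xl_def z_def B.z_eq[OF x y]
      by (rule vec_first_append[OF row_mult_carrier[OF B.carriers(7)]])
    have yl: "yl = (x \<^sub>v* B.T' + y) \<^sub>v* mat_inv (transpose_mat B.U')" unfolding yl_def z_def B.z_eq[OF x y]
      by (rule vec_last_append[OF row_mult_carrier[OF mat_inv(3)[OF Ut dUt]]])
    define summand where "summand = (\<lambda>m. ?fQ ((vec_first xl l \<^sub>v* map_mat sqrt Vl) @\<^sub>v ((m + vec_last xl (n - l)) \<^sub>v* Z)) *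
              ee (scalar_prod ((m + vec_last xl (n - l)) \<^sub>v* X) (m + vec_last xl (n - l)) / 2 + scalar_prod m (vec_last yl (n - l))))"
    have main: "infsum G I0 = of_real \<delta> * ee (- t + scalar_prod xl yl / 2) * (\<Sum>\<^sub>\<infinity>m\<in>int_vecs (n - l). summand m)"
    proof -
      have "infsum G I0 = (\<Sum>\<^sub>\<infinity>m\<in>int_vecs (n - l). G (0\<^sub>v l @\<^sub>v m))"
        unfolding I0_def by (rule infsum_reindex_bij_betw[symmetric, OF lattice_decomposition[OF l(2)]])
      also have "\<dots> = (\<Sum>\<^sub>\<infinity>m\<in>int_vecs (n - l). (of_real \<delta> * ee (- t + scalar_prod xl yl / 2)) * summand m)"
      proof (rule infsum_cong)
        fix m assume "m \<in> int_vecs (n - l)"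
        then have mc: "m \<in> carrier_vec (n - l)" by (simp add: int_vecs_def)
        note lt = B.lattice_term[OF x y mc, folded xl yl]
        have "G (0\<^sub>v l @\<^sub>v m) = of_real \<delta> * ee (- t + scalar_prod x y / 2 + scalar_prod (0\<^sub>v l @\<^sub>v m) y
            + scalar_prod (((0\<^sub>v l @\<^sub>v m) + x) \<^sub>v* B.X0) ((0\<^sub>v l @\<^sub>v m) + x) / 2) * ?fQ (((0\<^sub>v l @\<^sub>v m) + x) \<^sub>v* B.Z0)"
          unfolding G[OF lt(1)] by (simp only: ee_add mult_ac)
        also have "\<dots> = (of_real \<delta> * ee (- t + scalar_prod xl yl / 2)) * summand m"
          unfolding lt(2) lt(3)[of t] summand_def B.W_def ee_add by (simp only: mult_ac)
        finally show "G (0\<^sub>v l @\<^sub>v m) = (of_real \<delta> * ee (- t + scalar_prod xl yl / 2)) * summand m" .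
      qed
      also have "\<dots> = of_real \<delta> * ee (- t + scalar_prod xl yl / 2) * (\<Sum>\<^sub>\<infinity>m\<in>int_vecs (n - l). summand m)"
        by (rule infsum_cmult_right')
      finally show ?thesis .
    qed
    \<comment> \<open>The squared diagonal entries of Z are the v with index beyond l, each at most
      \<kappa> v_l. As \<kappa> M \<ge> 1, the exponent n - l may be raised to n, which makes the
      constant independent of l.\<close>
    have detY: "Determinant.det Yl powr (1/4) \<le> \<kappa> powr (real n / 4) * M powr (real n / 4)"
    proof -
      have "(\<Prod>j<n - l. (Z $$ (j, j))\<^sup>2) \<le> (\<Prod>j<n - l. \<kappa> * M)"
      proof (rule prod_mono)
        fix j assume "j \<in> {..<n - l}"
        then have j: "l + j < n" by auto
        have "(Z $$ (j, j))\<^sup>2 = V $$ (l + j, l + j)" using bd(2)[OF j] B.Z0_diag[OF j] B.triangular_W'(2)[OF j] by simp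
        also have "\<dots> \<le> \<kappa> * v" unfolding v_def using j by (intro bd(3)) auto
        also have "\<dots> \<le> \<kappa> * M" using M(3) k0 by simp
        finally show "0 \<le> (Z $$ (j, j))\<^sup>2 \<and> (Z $$ (j, j))\<^sup>2 \<le> \<kappa> * M" by simp
      qed
      then have "Determinant.det Yl \<le> (\<kappa> * M) ^ (n - l)" unfolding B.dets(7) by simp
      also have "\<dots> \<le> (\<kappa> * M) ^ n" using M(2) by (intro power_increasing) auto
      also have "\<dots> = (\<kappa> * M) powr real n" using k0 M(1) by (simp add: powr_realpow)
      finally have "Determinant.det Yl powr (1/4) \<le> ((\<kappa> * M) powr real n) powr (1/4)" using B.dets(6) by (intro powr_mono2) auto
      also have "\<dots> = \<kappa> powr (real n / 4) * M powr (real n / 4)"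
        using k0 M(1) by (simp add: powr_powr powr_mult)
      finally show ?thesis .
    qed
    have "\<epsilon> * \<Sigma> = Determinant.det Vl powr (1/4) * Determinant.det Yl powr (1/4) * C * (c1 powr (- p) * M powr (- p)) * \<Sigma>"
      unfolding \<epsilon>_def \<delta>_def using c(2) M(1) by (simp add: powr_mult)
    also have "\<dots> \<le> Determinant.det Vl powr (1/4) * (\<kappa> powr (real n / 4) * M powr (real n / 4)) * C * (c1 powr (- p) * M powr (- p)) * \<Sigma>"
      using detY C(1) S0 by (intro mult_right_mono mult_left_mono) auto
    also have "\<dots> = \<kappa> powr (real n / 4) * C * c1 powr (- p) * \<Sigma> * Determinant.det Vl powr (1/4) * (M powr (real n / 4) * M powr (- p))"
      by (simp only: mult_ac)
    \<comment> \<open>Here n/4 - p = -A.\<close>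
    also have "M powr (real n / 4) * M powr (- p) = M powr (- A)"
      by (simp add: p_def flip: powr_add)
    finally have final: "\<epsilon> * \<Sigma> \<le> \<kappa> powr (real n / 4) * C * c1 powr (- p) * \<Sigma> * Determinant.det Vl powr (1/4) * M powr (- A)" .
    show "let fQ = R (k_mat Q) f;
         z = (x @\<^sub>v y) \<^sub>v* (F1 n l T S * F2 n l U P);
         xl = vec_first z n; yl = vec_last z n;
         xl1 = vec_first xl l; xl2 = vec_last xl (n - l); yl2 = vec_last yl (n - l);
         main = of_real (Determinant.det Vl powr (1/4) * Determinant.det Yl powr (1/4)) *
           ee (- t + scalar_prod xl yl / 2) *
           (\<Sum>\<^sub>\<infinity>m\<in>int_vecs (n - l).
              fQ ((xl1 \<^sub>v* map_mat sqrt Vl) @\<^sub>v ((m + xl2) \<^sub>v* Z)) *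
              ee (scalar_prod ((m + xl2) \<^sub>v* X) (m + xl2) / 2 + scalar_prod m yl2))
     in norm (theta n R f (x, y, t) g - main)
          \<le> \<kappa> powr (real n / 4) * C * c1 powr (- p) * \<Sigma> * Determinant.det Vl powr (1/4) *
            (V $$ (l - 1, l - 1) + scalar_prod (x \<^sub>v* V) x) powr (- A)"
      unfolding Let_def z_def[symmetric] xl_def[symmetric] yl_def[symmetric] xVx v_def[symmetric] M_def[symmetric]
        \<delta>_def[symmetric] summand_def[symmetric] main[symmetric] split
      using order_trans[OF rest final] by simp
  qed
qed

end
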